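(* Let $G$ be a bipartite graph on $[d]$ with bipartition $[d]=V_1\cup V_2$, and let $\mathcal{B}_G$ be the convex hull of $\{\mathbf{0},\pm\mathbf{e}_1,\ldots,\pm\mathbf{e}_d\}\cup\{\pm\mathbf{e}_i\pm\mathbf{e}_j : \{i,j\}\in E(G)\}\subset\mathbb{R}^d$. Let $\widehat{G}$ be the bipartite graph on $[d+2]$ with edge set $$E(\widehat{G})=E(G)\cup\{\{i,d+1\}: i\in V_1\}\cup\{\{j,d+2\}: j\in V_2\cup\{d+1\}\}.$$ Then $$h^*(\mathcal{B}_G,x)=(x+1)^d\, I_{\widehat{G}}\!\left(\frac{4x}{(x+1)^2}\right),$$ where $I_{\widehat{G}}(x)$ is the interior polynomial of $\widehat{G}$. In particular, $h^*(\mathcal{B}_G,x)$ is $\gamma$-positive. Moreover, $h^*(\mathcal{B}_G,x)$ is real-rooted if and only if $I_{\widehat{G}}(x)$ is real-rooted.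
   Context: $\widehat{G}$ is connected. For a $d$-dimensional lattice polytope $\mathcal{P}\subset\mathbb{R}^d$, let $L_{\mathcal{P}}(n)=|n\mathcal{P}\cap\mathbb{Z}^d|$; the $h^*$-polynomial is defined by $1+\sum_{k\ge1}L_{\mathcal{P}}(k)x^k = h^*(\mathcal{P},x)/(1-x)^{d+1}$. A polynomial $f$ of degree $\le d$ is $\gamma$-positive if $f(x)=\sum_{i\ge0}\gamma_i x^i(1+x)^{d-2i}$ with all $\gamma_i\ge 0$ (here $d$ is the degree/dimension, $d=\dim\mathcal{B}_G$). Interior polynomial: a hypergraph $\mathcal{H}=(V,E)$ has vertex set $V$ and a finite multiset $E=\{e_1,\ldots,e_n\}$ (ordered) of nonempty subsets of $V$; $\mathrm{Bip}\,\mathcal{H}$ is the bipartite graph on $V\cup E$ with $\{v,e\}$ an edge iff $v\in e$; assume it is connected. A hypertree is a function $\mathbf{f}:E\to\mathbb{Z}_{\ge0}$ such that some spanning tree of $\mathrm{Bip}\,\mathcal{H}$ has degree $\mathbf{f}(e)+1$ at each $e\in E$. A hyperedge $e_j$ is internally active for $\mathbf{f}$ if it is not possible to decrease $\mathbf{f}(e_j)$ by $1$ and increase $\mathbf{f}(e_{j'})$ by $1$ for some $j'<j$ so that a hypertree results; otherwise internally inactive; $\overline{\iota}(\mathbf{f})$ is the number of internally inactive hyperedges. The interior polynomial is $I_{\mathcal{H}}(x)=\sum_{\mathbf{f}}x^{\overline{\iota}(\mathbf{f})}$ over all hypertrees. For a connected bipartite graph $H$, $I_H(x)=I_{\mathcal{H}}(x)$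 for a hypergraph with $\mathrm{Bip}\,\mathcal{H}=H$ (this is independent of which side is taken as hyperedges and of the ordering; it equals the $h^*$-polynomial of the edge polytope $\mathrm{conv}\{\mathbf{e}_i+\mathbf{e}_j:\{i,j\}\in E(H)\}$). *)

theory Defs
  imports
    "HOL-Analysis.Analysis"
    "HOL-Computational_Algebra.Computational_Algebra"
begin

subsection \<open>Finite simple graphs\<close>

text \<open>A graph is a pair (vertices, edges), an edge being a two-element set of vertices.\<close>

type_synonym 'a ugraph = "'a set \<times> 'a set set"

definition bipartite_graph :: "'a set \<Rightarrow> 'a set \<Rightarrow> 'a set set \<Rightarrow> bool" where
  "bipartite_graph V1 V2 E \<longleftrightarrow>
     V1 \<inter> V2 = {} \<and> (\<forall>e\<in>E. \<exists>i\<in>V1. \<exists>j\<in>V2. e = {i, j})"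

definition connected_graph :: "'a ugraph \<Rightarrow> bool" where
  "connected_graph G \<longleftrightarrow>
     fst G \<noteq> {} \<and> (\<forall>u\<in>fst G. \<forall>v\<in>fst G. (u, v) \<in> {(a, b). {a, b} \<in> snd G}\<^sup>*)"

definition graph_cycle :: "'a set set \<Rightarrow> 'a list \<Rightarrow> bool" where
  "graph_cycle E c \<longleftrightarrow>
     3 \<le> length c \<and> distinct c \<and>
     (\<forall>i<length c. {c ! i, c ! (Suc i mod length c)} \<in> E)"

definition tree_graph :: "'a ugraph \<Rightarrow> bool" where
  "tree_graph G \<longleftrightarrow> connected_graph G \<and> (\<nexists>c. graph_cycle (snd G) c)"

definition spanning_tree :: "'a ugraph \<Rightarrow> 'a set set \<Rightarrow> bool" where
  "spanning_tree G T \<longleftrightarrow> T \<subseteq> snd G \<and> tree_graph (fst G, T)"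

definition vertex_degree :: "'a set set \<Rightarrow> 'a \<Rightarrow> nat" where
  "vertex_degree T v = card {e \<in> T. v \<in> e}"

definition graph_isomorphic :: "'a ugraph \<Rightarrow> 'b ugraph \<Rightarrow> bool" where
  "graph_isomorphic G H \<longleftrightarrow>
     (\<exists>\<phi>. bij_betw \<phi> (fst G) (fst H) \<and> (\<lambda>e. \<phi> ` e) ` snd G = snd H)"


subsection \<open>Hypergraphs and the interior polynomial\<close>

text \<open>
  The ordered finite multiset of hyperedges is a list; a hyperedge is referred to by its
  position in that list, so that repeated hyperedges stay distinct.
\<close>

definition hypergraph :: "'v set \<Rightarrow> 'v set list \<Rightarrow> bool" where
  "hypergraph V Es \<longleftrightarrow> finite V \<and> (\<forall>e\<in>set Es. e \<noteq> {} \<and> e \<subseteq> V)"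

definition Bip :: "'v set \<Rightarrow> 'v set list \<Rightarrow> ('v + nat) ugraph" where
  "Bip V Es =
     (Inl ` V \<union> Inr ` {..<length Es},
      {{Inl v, Inr j} | v j. v \<in> V \<and> j < length Es \<and> v \<in> Es ! j})"

text \<open>
  Functions on the hyperedges are extended by 0 beyond the last position, so that distinct
  functions of type \<^typ>\<open>nat \<Rightarrow> nat\<close> are distinct hypertrees.
\<close>

definition hypertree :: "'v set \<Rightarrow> 'v set list \<Rightarrow> (nat \<Rightarrow> nat) \<Rightarrow> bool" where
  "hypertree V Es f \<longleftrightarrow>
     (\<forall>j\<ge>length Es. f j = 0) \<and>
     (\<exists>T. spanning_tree (Bip V Es) T \<and>
          (\<forall>j<length Es. vertex_degree T (Inr j) = f j + 1))"

definition internally_active :: "'v set \<Rightarrow> 'v set list \<Rightarrow> (nat \<Rightarrow> nat) \<Rightarrow> nat \<Rightarrow> bool" where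
  "internally_active V Es f j \<longleftrightarrow>
     \<not> (\<exists>j'<j. 0 < f j \<and> hypertree V Es (f(j := f j - 1, j' := f j' + 1)))"

definition internal_inactivity :: "'v set \<Rightarrow> 'v set list \<Rightarrow> (nat \<Rightarrow> nat) \<Rightarrow> nat" where
  "internal_inactivity V Es f = card {j. j < length Es \<and> \<not> internally_active V Es f j}"

definition hypergraph_interior_poly :: "'v set \<Rightarrow> 'v set list \<Rightarrow> real poly" where
  "hypergraph_interior_poly V Es =
     (\<Sum>f | hypertree V Es f. monom 1 (internal_inactivity V Es f))"

text \<open>
  The interior polynomial of a connected bipartite graph \<open>H\<close>: the common value over all
  hypergraphs whose \<^const>\<open>Bip\<close> is \<open>H\<close>, for either choice of the side of the hyperedges
  and every ordering.  Drawing the hypergraph vertices from the vertex type of \<open>H\<close> is no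
  restriction.
\<close>

definition interior_poly :: "'a ugraph \<Rightarrow> real poly" where
  "interior_poly H =
     (THE p. \<exists>(V :: 'a set) Es. hypergraph V Es \<and> graph_isomorphic (Bip V Es) H \<and>
        p = hypergraph_interior_poly V Es)"


subsection \<open>Ehrhart series and h*-polynomial\<close>

definition lattice_count :: "(real ^ 'n) set \<Rightarrow> nat \<Rightarrow> nat" where
  "lattice_count P k = card (((*\<^sub>R) (real k) ` P) \<inter> {v. \<forall>i. v $ i \<in> \<int>})"

definition ehrhart_series :: "(real ^ 'n) set \<Rightarrow> real fps" where
  "ehrhart_series P = Abs_fps (\<lambda>k. if k = 0 then 1 else real (lattice_count P k))"

text \<open>Meaningful for full-dimensional lattice polytopes only.\<close>

definition h_star :: "(real ^ 'n) set \<Rightarrow> real poly" where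
  "h_star P =
     (THE p. ehrhart_series P = fps_of_poly p / (1 - fps_X) ^ (CARD('n) + 1))"


subsection \<open>Gamma-positivity and real-rootedness\<close>

definition gamma_positive :: "nat \<Rightarrow> real poly \<Rightarrow> bool" where
  "gamma_positive d f \<longleftrightarrow>
     (\<exists>\<gamma> :: nat \<Rightarrow> real. (\<forall>i. 0 \<le> \<gamma> i) \<and>
        f = (\<Sum>i\<le>d div 2. smult (\<gamma> i) (monom 1 i * [:1, 1:] ^ (d - 2 * i))))"

definition real_rooted :: "real poly \<Rightarrow> bool" where
  "real_rooted p \<longleftrightarrow> (\<forall>z :: complex. poly (map_poly of_real p) z = 0 \<longrightarrow> z \<in> \<real>)"


subsection \<open>The polytope and the extended graph of a bipartite graph\<close>

definition B_polytope :: "'n set set \<Rightarrow> (real ^ 'n) set" where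
  "B_polytope E = convex hull
     ({0} \<union> {s *\<^sub>R axis i 1 | s i. s \<in> {- 1, 1}}
          \<union> {s *\<^sub>R axis i 1 + t *\<^sub>R axis j 1 | s t i j.
               s \<in> {- 1, 1} \<and> t \<in> {- 1, 1} \<and> {i, j} \<in> E})"

text \<open>
  With the finite type \<open>'n\<close> in the role of \<open>[d]\<close>, the following type is \<open>[d + 2]\<close>; the last
  two constructors are the vertices \<open>d + 1\<close> and \<open>d + 2\<close>.
\<close>

datatype 'n hat_vertex = Base 'n | Dplus1 | Dplus2

definition hat_graph :: "'n set \<Rightarrow> 'n set \<Rightarrow> 'n set set \<Rightarrow> 'n hat_vertex ugraph" where
  "hat_graph V1 V2 E =
     (UNIV,
      (\<lambda>e. Base ` e) ` E
        \<union> {{i, Dplus1} | i. i \<in> Base ` V1}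
        \<union> {{j, Dplus2} | j. j \<in> Base ` V2 \<union> {Dplus1}})"

end

theory Submission
  imports Defs
begin

text \<open>
  For a relation \<open>R \<subseteq> A \<times> B\<close> call \<open>g : A \<rightarrow> \<nat>\<close> independent if \<open>g(S) \<le> |R(S)|\<close> for all \<open>S \<subseteq> A\<close>, and let
  \<open>I\<^sub>A(x)\<close> be the sum of \<open>x\<close> to the size of the support of \<open>g\<close>, over all independent \<open>g\<close>.

  \<^item> \<open>R\<close> and its converse have equally many independent vectors: both sets are in bijection with the
    trees that are tight for some integer potential of a generic transportation problem on \<open>R\<close> with
    a universal vertex added on either side.  Replacing each \<open>i \<in> A\<close> by \<open>y\<^sub>i\<close> copies and summing over
    \<open>y\<close> turns this into \<open>I\<^sub>A(x) / (1 - x)\<^bsup>d + 1\<^esup>\<close> being the series counting the nonnegative lattice points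
    of the dilations of \<open>\<B>\<^sub>G\<close>, and in particular \<open>I\<^sub>A = I\<^sub>B\<close>.

  \<^item> Moebius inversion over induced subgraphs writes \<open>I\<^sub>A\<close> as a sum over vertex sets \<open>T\<close> of multiples of
    \<open>x\<close> to the power \<open>|T \<inter> V\<^sub>1|\<close>, and by symmetry also with \<open>|T \<inter> V\<^sub>2|\<close>, so only sets with
    \<open>|T| = 2 |T \<inter> V\<^sub>1|\<close> contribute.  As \<open>\<B>\<^sub>G\<close> is invariant under sign changes, the Ehrhart series
    is the series above with weight 2 to the size of the support, which gives the formula for \<open>h\<^sup>*\<close>.

  \<^item> Let the hyperedge that contains all vertices of the hypergraph come first.  A unit can always be
    moved to it, so a hyperedge is inactive iff the hypertree is positive there, and the interior
    polynomial is \<open>I\<^sub>A\<close>.  The ordering does not matter: each integer vector below some hypertree is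
    below exactly one hypertree \<open>f\<close> that exceeds it on active hyperedges of \<open>f\<close> only.
\<close>


subsection \<open>Transportation\<close>

text \<open>Many spanning trees share a degree vector, so counting needs one tree per vector, chosen
  alike for both sides. A generic cost makes the choice: rows ask for \<open>1 + p * g i\<close>,
  columns for \<open>p = card P\<close>, and the cheapest flow is supported on a single tree. The
  summand 1 is a perturbation that keeps this support connected. The constant 4 comes from the sign
  changes. The weight 2 to the size of the support is a signed sum of unweighted counts on
  coordinate subspaces \<open>S\<close>. A set \<open>T\<close> occurs in all \<open>S\<close> above
  it, and the binomial theorem collects these terms into
  \<open>2 ^ card T * (x + 1) ^ (d - card T)\<close>, which for \<open>card T = 2 * i\<close> is
  \<open>4 ^ i * (x + 1) ^ (d - 2 * i)\<close>. The interior polynomial is a definite description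
  over all hypergraphs that present the graph. Hence every presentation has to be evaluated: the
  hyperedge that contains all vertices may stand anywhere in the list, and either side of the graph
  may carry the hyperedges.\<close>

lemma sum_Un_Int_nat:
  fixes w :: "'a \<Rightarrow> nat"
  assumes "finite S" "finite T"
  shows "sum w (S \<union> T) + sum w (S \<inter> T) = sum w S + sum w T"
  using sum.union_inter[OF assms] .

lemma sum_fun_upd_Suc_minus:
  fixes w :: "'a \<Rightarrow> nat"
  assumes "finite S" "w b > 0"
  shows "sum (w(b := w b - 1)) S = sum w S - (if b \<in> S then 1 else 0)"
proof (cases "b \<in> S")
  case True
  have "sum w S = w b + sum w (S - {b})"
    using assms True by (simp add: sum.remove)
  moreover have "sum (w(b := w b - 1)) S = (w b - 1) + sum (w(b := w b - 1)) (S - {b})"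
    using assms True by (simp add: sum.remove)
  moreover have "sum (w(b := w b - 1)) (S - {b}) = sum w (S - {b})"
    by (rule sum.cong) auto
  ultimately show ?thesis using True assms(2) by simp
next
  case False
  have "sum (w(b := w b - 1)) S = sum w S"
    by (rule sum.cong) (use False in auto)
  with False show ?thesis by simp
qed

text \<open>Induction on the total demand, serving one unit of some \<open>b\<close> at a time. The
  sets without \<open>b\<close> that use up their whole supply are closed under union; the unit may
  come from any nonempty supplier of \<open>b\<close> that no such set touches, and then all
  inequalities survive.\<close>

theorem supply_demand:
  fixes w :: "'b \<Rightarrow> nat" and y :: "'a \<Rightarrow> nat"
  assumes "finite A" "finite B" "R \<subseteq> A \<times> B"
    and "\<And>T. T \<subseteq> B \<Longrightarrow> sum w T \<le> sum y (R\<inverse> `` T)"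
  shows "\<exists>x :: 'a \<Rightarrow> 'b \<Rightarrow> nat. (\<forall>i j. (i, j) \<notin> R \<longrightarrow> x i j = 0) \<and>
           (\<forall>j\<in>B. (\<Sum>i\<in>A. x i j) = w j) \<and> (\<forall>i\<in>A. (\<Sum>j\<in>B. x i j) \<le> y i)"
  using assms(4)
proof (induction "sum w B" arbitrary: w y)
  case 0
  then have "\<forall>j\<in>B. w j = 0" using assms(2) by simp
  then show ?case by (intro exI[of _ "\<lambda>_ _. 0"]) auto
next
  case (Suc n)
  note hall = Suc.prems
  have fin: "finite T" "finite (R\<inverse> `` T)" if "T \<subseteq> B" for T
    using finite_subset[OF that assms(2)] finite_subset[of "R\<inverse> `` T" A] assms(1,3) by blast+
  obtain b where b: "b \<in> B" "w b > 0"
    using Suc.hyps(2) assms(2) by (metis neq0_conv sum.neutral Zero_not_Suc)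
  define tight where "tight T \<longleftrightarrow> T \<subseteq> B \<and> b \<notin> T \<and> sum w T = sum y (R\<inverse> `` T)" for T
  have tight_Un: "tight (S \<union> T)" if "tight S" "tight T" for S T
  proof -
    have ST: "S \<subseteq> B" "T \<subseteq> B" using that by (auto simp: tight_def)
    have "sum w (S \<union> T) + sum w (S \<inter> T) = sum w S + sum w T"
      using fin ST by (intro sum_Un_Int_nat) auto
    also have "\<dots> = sum y (R\<inverse> `` S) + sum y (R\<inverse> `` T)" using that by (simp add: tight_def)
    also have "\<dots> = sum y (R\<inverse> `` S \<union> R\<inverse> `` T) + sum y (R\<inverse> `` S \<inter> R\<inverse> `` T)"
      using fin ST by (intro sum_Un_Int_nat[symmetric]) auto
    also have "\<dots> \<ge> sum y (R\<inverse> `` (S \<union> T)) + sum y (R\<inverse> `` (S \<inter> T))"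
      using fin[OF ST(1)] fin[OF ST(2)] by (intro add_mono sum_mono2) auto
    finally have "sum w (S \<union> T) + sum w (S \<inter> T) \<ge>
      sum y (R\<inverse> `` (S \<union> T)) + sum y (R\<inverse> `` (S \<inter> T))" .
    moreover have "sum w (S \<union> T) \<le> sum y (R\<inverse> `` (S \<union> T))"
      "sum w (S \<inter> T) \<le> sum y (R\<inverse> `` (S \<inter> T))"
      using hall[of "S \<union> T"] hall[of "S \<inter> T"] ST by auto
    ultimately have "sum w (S \<union> T) = sum y (R\<inverse> `` (S \<union> T))" by linarith
    then show ?thesis using that by (auto simp: tight_def)
  qed
  have tight_UN: "tight (\<Union>\<F>)" if "finite \<F>" "\<forall>T\<in>\<F>. tight T" for \<F>
    using that
  proof (induction rule: finite_induct)
    case empty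
    then show ?case by (simp add: tight_def)
  next
    case (insert T \<F>)
    then show ?case using tight_Un[of T "\<Union>\<F>"] by simp
  qed
  define U where "U = \<Union>{T. tight T}"
  have "{T. tight T} \<subseteq> Pow B" by (auto simp: tight_def)
  then have "finite {T. tight T}" using assms(2) by (simp add: finite_subset)
  then have U: "tight U" unfolding U_def by (intro tight_UN) auto
  \<comment> \<open>Otherwise the suppliers of \<open>b\<close> outside the neighbourhood of
    \<open>U\<close> are empty, and \<open>insert b U\<close> demands \<open>w b\<close> units
    beyond what the tight set \<open>U\<close> has already exhausted.\<close>
  have "\<exists>i. (i, b) \<in> R \<and> y i > 0 \<and> i \<notin> R\<inverse> `` U"
  proof (rule ccontr)
    assume "\<not> ?thesis"
    then have *: "\<And>i. (i, b) \<in> R \<Longrightarrow> i \<notin> R\<inverse> `` U \<Longrightarrow> y i = 0" by auto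
    have "sum w (insert b U) = w b + sum w U"
      using U fin[of U] by (simp add: tight_def)
    moreover have "sum w (insert b U) \<le> sum y (R\<inverse> `` (insert b U))"
      using hall[of "insert b U"] U b by (auto simp: tight_def)
    moreover have "sum y (R\<inverse> `` (insert b U)) = sum y (R\<inverse> `` U)"
      using fin[of "insert b U"] U b *
      by (intro sum.mono_neutral_right) (auto simp: tight_def)
    ultimately show False using U b(2) by (simp add: tight_def)
  qed
  then obtain i where i: "(i, b) \<in> R" "y i > 0" "i \<notin> R\<inverse> `` U" by blast
  let ?w = "w(b := w b - 1)" and ?y = "y(i := y i - 1)"
  have iA: "i \<in> A" using i assms by auto
  have "sum ?w B = n"
    using sum_fun_upd_Suc_minus[of B w b] assms b Suc.hyps(2) by simp
  moreover have "sum ?w T \<le> sum ?y (R\<inverse> `` T)" if T: "T \<subseteq> B" for T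
  proof (cases "i \<in> R\<inverse> `` T")
    case False
    then show ?thesis
      using sum_fun_upd_Suc_minus[of T w b] sum_fun_upd_Suc_minus[of "R\<inverse> `` T" y i]
        fin[OF T] hall[OF T] b i by (simp split: if_splits)
  next
    case iT: True
    show ?thesis
    proof (cases "b \<in> T")
      case True
      then show ?thesis
        using iT sum_fun_upd_Suc_minus[of T w b] sum_fun_upd_Suc_minus[of "R\<inverse> `` T" y i]
          fin[OF T] hall[OF T] b i by simp
    next
      case False
      have "\<not> tight T" using i(3) iT by (auto simp: U_def)
      then have "sum w T < sum y (R\<inverse> `` T)" using hall[OF T] False T by (auto simp: tight_def)
      then show ?thesis
        using iT False sum_fun_upd_Suc_minus[of T w b] sum_fun_upd_Suc_minus[of "R\<inverse> `` T" y i]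
          fin[OF T] b i by simp
    qed
  qed
  ultimately obtain x :: "'a \<Rightarrow> 'b \<Rightarrow> nat" where x: "\<And>i j. (i, j) \<notin> R \<Longrightarrow> x i j = 0"
    "\<And>j. j \<in> B \<Longrightarrow> (\<Sum>i\<in>A. x i j) = ?w j" "\<And>i. i \<in> A \<Longrightarrow> (\<Sum>j\<in>B. x i j) \<le> ?y i"
    using Suc.hyps(1)[of ?w ?y] by blast
  define x' where "x' k j = x k j + (if k = i \<and> j = b then 1 else 0)" for k j
  have "(\<Sum>k\<in>A. x' k j) = w j" if "j \<in> B" for j
    using x(2)[OF that] b(2) iA assms(1)
    by (cases "j = b") (simp_all add: x'_def sum.distrib)
  moreover have "(\<Sum>j\<in>B. x' k j) \<le> y k" if "k \<in> A" for k
    using x(3)[OF that] b i(2) assms(2)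
    by (cases "k = i") (simp_all add: x'_def sum.distrib)
  moreover have "x' k j = 0" if "(k, j) \<notin> R" for k j
    using x(1)[OF that] that i by (auto simp: x'_def)
  ultimately show ?case by blast
qed

text \<open>Super-increasing costs: the newest element costs more than any combination of the
  earlier ones with coefficients bounded by \<open>M\<close>, so the coefficients have to vanish
  from the newest element downwards.\<close>

lemma bounded_generic_cost:
  fixes M :: int
  assumes "finite W"
  shows "\<exists>c :: 'e \<Rightarrow> int. (\<forall>e. 0 \<le> c e) \<and>
    (\<forall>z. (\<forall>e\<in>W. \<bar>z e\<bar> \<le> M) \<longrightarrow> (\<Sum>e\<in>W. z e * c e) = 0 \<longrightarrow> (\<forall>e\<in>W. z e = 0))"
  using assms
proof (induction rule: finite_induct)
  case empty
  then show ?case by (intro exI[of _ "\<lambda>_. 0"]) auto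
next
  case (insert a W)
  then obtain c where c: "\<And>e. 0 \<le> c e"
    "\<And>z. (\<forall>e\<in>W. \<bar>z e\<bar> \<le> M) \<Longrightarrow> (\<Sum>e\<in>W. z e * c e) = 0 \<Longrightarrow> \<forall>e\<in>W. z e = 0" by blast
  define c' where "c' = c(a := 1 + \<bar>M\<bar> * sum c W)"
  have sc: "sum c W \<ge> 0" using c(1) by (intro sum_nonneg)
  have "\<forall>e\<in>insert a W. z e = 0"
    if z: "\<forall>e\<in>insert a W. \<bar>z e\<bar> \<le> M" "(\<Sum>e\<in>insert a W. z e * c' e) = 0" for z
  proof -
    have eq: "(\<Sum>e\<in>W. z e * c' e) = (\<Sum>e\<in>W. z e * c e)"
      using insert by (intro sum.cong) (auto simp: c'_def)
    then have *: "z a * (1 + \<bar>M\<bar> * sum c W) + (\<Sum>e\<in>W. z e * c e) = 0"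
      using z(2) insert by (simp add: c'_def)
    have "\<bar>\<Sum>e\<in>W. z e * c e\<bar> \<le> (\<Sum>e\<in>W. \<bar>z e * c e\<bar>)" by (rule sum_abs)
    also have "\<dots> \<le> (\<Sum>e\<in>W. \<bar>M\<bar> * c e)"
      using z(1) c(1) by (intro sum_mono) (auto simp: abs_mult intro!: mult_right_mono)
    also have "\<dots> = \<bar>M\<bar> * sum c W" by (simp add: sum_distrib_left)
    finally have bd: "\<bar>\<Sum>e\<in>W. z e * c e\<bar> \<le> \<bar>M\<bar> * sum c W" .
    have "z a = 0"
    proof (rule ccontr)
      assume "z a \<noteq> 0"
      then have "1 \<le> \<bar>z a\<bar>" by simp
      moreover have "0 \<le> 1 + \<bar>M\<bar> * sum c W" using sc by simp
      ultimately have "\<bar>z a * (1 + \<bar>M\<bar> * sum c W)\<bar> \<ge> 1 + \<bar>M\<bar> * sum c W"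
        by (simp add: abs_mult mult_le_cancel_right1)
      with * bd show False by linarith
    qed
    then have "\<forall>e\<in>W. z e = 0" using z(1) * by (intro c(2)) auto
    then show ?thesis using \<open>z a = 0\<close> by blast
  qed
  moreover have "\<And>e. 0 \<le> c' e" using c(1) sc by (simp add: c'_def)
  ultimately show ?case by blast
qed


subsection \<open>Bipartite trees and flows\<close>

text \<open>Trees in a bipartite graph, built from one left vertex by attaching leaves on either
  side. Undoing the last attachment replaces arguments about connectivity and cycles by a leaf
  induction.\<close>

inductive leaf_tree :: "'a set \<Rightarrow> 'b set \<Rightarrow> ('a \<times> 'b) set \<Rightarrow> bool" where
  root: "leaf_tree {i} {} {}"
| right_leaf: "leaf_tree S T F \<Longrightarrow> i \<in> S \<Longrightarrow> j \<notin> T \<Longrightarrow> leaf_tree S (insert j T) (insert (i, j) F)"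
| left_leaf: "leaf_tree S T F \<Longrightarrow> j \<in> T \<Longrightarrow> i \<notin> S \<Longrightarrow> leaf_tree (insert i S) T (insert (i, j) F)"

lemma leaf_tree_finite: "leaf_tree S T F \<Longrightarrow> finite S \<and> finite T \<and> finite F"
  by (induction rule: leaf_tree.induct) auto

lemma leaf_tree_subset: "leaf_tree S T F \<Longrightarrow> F \<subseteq> S \<times> T"
  by (induction rule: leaf_tree.induct) auto

lemma leaf_tree_right_covered: "leaf_tree S T F \<Longrightarrow> j \<in> T \<Longrightarrow> \<exists>i. (i, j) \<in> F"
  by (induction rule: leaf_tree.induct) auto

lemma leaf_tree_left_covered: "leaf_tree S T F \<Longrightarrow> T \<noteq> {} \<Longrightarrow> i \<in> S \<Longrightarrow> \<exists>j. (i, j) \<in> F"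
proof -
  have "T = {} \<and> (\<exists>i. S = {i}) \<or> (\<forall>i\<in>S. \<exists>j. (i, j) \<in> F)" if "leaf_tree S T F"
    using that by (induction rule: leaf_tree.induct) auto
  then show "leaf_tree S T F \<Longrightarrow> T \<noteq> {} \<Longrightarrow> i \<in> S \<Longrightarrow> \<exists>j. (i, j) \<in> F" by blast
qed

text \<open>Entries may be negative, so that differences of flows are flows again; nonnegativity is
  a separate hypothesis wherever it matters.\<close>

definition flow_on :: "('a \<times> 'b) set \<Rightarrow> 'a set \<Rightarrow> 'b set \<Rightarrow> ('a \<Rightarrow> int) \<Rightarrow> ('b \<Rightarrow> int) \<Rightarrow> ('a \<Rightarrow> 'b \<Rightarrow> int) \<Rightarrow> bool"
  where "flow_on F S T a b x \<longleftrightarrow> (\<forall>i j. (i, j) \<notin> F \<longrightarrow> x i j = 0) \<and>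
    (\<forall>i\<in>S. (\<Sum>j\<in>T. x i j) = a i) \<and> (\<forall>j\<in>T. (\<Sum>i\<in>S. x i j) = b j)"

lemma flow_on_converse: "flow_on (F\<inverse>) T S b a (\<lambda>j i. x i j) \<longleftrightarrow> flow_on F S T a b x"
  by (auto simp: flow_on_def)

text \<open>The leaf column \<open>j\<close> has a single edge, so the entry there is
  \<open>b j\<close>, and row \<open>i\<close> has that much less to send into the old tree.\<close>

lemma flow_on_add_right_leaf:
  assumes "finite S" "finite T" "F \<subseteq> S \<times> T" "i \<in> S" "j \<notin> T" "flow_on F S T (a(i := a i - b j)) b x"
  shows "flow_on (insert (i, j) F) S (insert j T) a b (x(i := (x i)(j := b j)))"
proof -
  let ?x = "x(i := (x i)(j := b j))"
  have z: "x k j = 0" for k using assms by (auto simp: flow_on_def)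
  have "(\<Sum>l\<in>T. ?x k l) = (\<Sum>l\<in>T. x k l)" for k
    using assms(5) by (intro sum.cong) auto
  then have "(\<Sum>l\<in>insert j T. ?x k l) = a k" if "k \<in> S" for k
    using assms that z[of k] by (auto simp: flow_on_def)
  moreover have "(\<Sum>k\<in>S. ?x k l) = b l" if "l \<in> insert j T" for l
  proof (cases "l = j")
    case True
    have "?x k j = (if k = i then b j else 0)" for k using z by auto
    then show ?thesis using True assms(1,4) by (simp del: fun_upd_apply)
  next
    case False
    then have "(\<Sum>k\<in>S. ?x k l) = (\<Sum>k\<in>S. x k l)" by (intro sum.cong) auto
    with False that assms(6) show ?thesis by (simp add: flow_on_def)
  qed
  ultimately show ?thesis using assms(6) by (auto simp: flow_on_def)
qed

lemma flow_on_add_left_leaf: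
  assumes "finite S" "finite T" "F \<subseteq> S \<times> T" "j \<in> T" "i \<notin> S" "flow_on F S T a (b(j := b j - a i)) x"
  shows "flow_on (insert (i, j) F) (insert i S) T a b (x(i := (x i)(j := a i)))"
proof -
  have "F\<inverse> \<subseteq> T \<times> S" using assms(3) by auto
  moreover have "flow_on (F\<inverse>) T S (b(j := b j - a i)) a (\<lambda>l k. x k l)"
    using assms(6) by (simp only: flow_on_converse)
  ultimately have "flow_on (insert (j, i) (F\<inverse>)) T (insert i S) b a ((\<lambda>l k. x k l)(j := (\<lambda>k. x k j)(i := a i)))"
    by (rule flow_on_add_right_leaf[OF assms(2,1) _ assms(4,5)])
  moreover have "insert (j, i) (F\<inverse>) = (insert (i, j) F)\<inverse>" by auto
  moreover have "(\<lambda>l k. x k l)(j := (\<lambda>k. x k j)(i := a i)) = (\<lambda>l k. (x(i := (x i)(j := a i))) k l)"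
    by (auto simp: fun_eq_iff)
  ultimately show ?thesis by (simp only: flow_on_converse)
qed

lemma flow_on_remove_right_leaf:
  assumes "finite S" "finite T" "F \<subseteq> S \<times> T" "i \<in> S" "j \<notin> T" "flow_on (insert (i, j) F) S (insert j T) a b x"
  shows "x i j = b j" "flow_on F S T (a(i := a i - b j)) b (x(i := (x i)(j := 0)))"
proof -
  let ?x = "x(i := (x i)(j := 0))"
  have z: "x k j = 0" if "k \<noteq> i" for k using assms(3,5,6) that by (auto simp: flow_on_def)
  have "b j = (\<Sum>k\<in>S. x k j)" using assms(6) by (simp add: flow_on_def)
  also have "\<dots> = (\<Sum>k\<in>S. if k = i then x i j else 0)" using z by (intro sum.cong) auto
  finally show bj: "x i j = b j" using assms(1,4) by simp
  have "(\<Sum>l\<in>T. ?x k l) = (a(i := a i - b j)) k" if "k \<in> S" for k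
  proof -
    have "(\<Sum>l\<in>T. ?x k l) = (\<Sum>l\<in>T. x k l)" using assms(5) by (intro sum.cong) auto
    moreover have "x k j + (\<Sum>l\<in>T. x k l) = a k" using assms(2,5,6) that by (simp add: flow_on_def)
    ultimately show ?thesis using z[of k] bj by (cases "k = i") auto
  qed
  moreover have "(\<Sum>k\<in>S. ?x k l) = b l" if "l \<in> T" for l
  proof -
    have "(\<Sum>k\<in>S. ?x k l) = (\<Sum>k\<in>S. x k l)" using assms(5) that by (intro sum.cong) auto
    then show ?thesis using assms(6) that by (simp add: flow_on_def)
  qed
  ultimately show "flow_on F S T (a(i := a i - b j)) b ?x" using assms(6) by (auto simp: flow_on_def)
qed

lemma flow_on_remove_left_leaf:
  assumes "finite S" "finite T" "F \<subseteq> S \<times> T" "j \<in> T" "i \<notin> S" "flow_on (insert (i, j) F) (insert i S) T a b x"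
  shows "x i j = a i" "flow_on F S T a (b(j := b j - a i)) (x(i := (x i)(j := 0)))"
proof -
  have F: "F\<inverse> \<subseteq> T \<times> S" using assms(3) by auto
  have "insert (j, i) (F\<inverse>) = (insert (i, j) F)\<inverse>" by auto
  then have x: "flow_on (insert (j, i) (F\<inverse>)) T (insert i S) b a (\<lambda>l k. x k l)"
    using assms(6) by (simp only: flow_on_converse)
  note leaf = flow_on_remove_right_leaf[OF assms(2,1) F assms(4,5) x]
  show "x i j = a i" by (rule leaf(1))
  have "(\<lambda>l k. x k l)(j := (\<lambda>k. x k j)(i := 0)) = (\<lambda>l k. (x(i := (x i)(j := 0))) k l)"
    by (auto simp: fun_eq_iff)
  with leaf(2) show "flow_on F S T a (b(j := b j - a i)) (x(i := (x i)(j := 0)))"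
    by (simp only: flow_on_converse)
qed

lemma sum_fun_upd_minus:
  fixes a :: "'a \<Rightarrow> int"
  assumes "finite S" "i \<in> S"
  shows "sum (a(i := a i - c)) S = sum a S - c"
proof -
  have "sum (a(i := a i - c)) (S - {i}) = sum a (S - {i})" by (rule sum.cong) auto
  then show ?thesis using assms by (simp add: sum.remove[of S i])
qed

lemma sum_abs_fun_upd_minus:
  fixes a :: "'a \<Rightarrow> int"
  assumes "finite S" "i \<in> S"
  shows "(\<Sum>k\<in>S. \<bar>(a(i := a i - c)) k\<bar>) \<le> (\<Sum>k\<in>S. \<bar>a k\<bar>) + \<bar>c\<bar>"
proof -
  have "(\<Sum>k\<in>S-{i}. \<bar>(a(i := a i - c)) k\<bar>) = (\<Sum>k\<in>S-{i}. \<bar>a k\<bar>)" by (rule sum.cong) auto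
  then show ?thesis using assms by (simp add: sum.remove[of S i])
qed

text \<open>The margin of a leaf is the value on its edge and is passed on to its neighbour, which
  does not increase the total absolute margin. The bound matters because costs are generic only
  against bounded coefficients.\<close>

lemma leaf_tree_balanced_flow:
  assumes "leaf_tree S T F" "sum a S = sum b T"
  shows "\<exists>x. flow_on F S T a b x \<and> (\<forall>i j. \<bar>x i j\<bar> \<le> (\<Sum>i\<in>S. \<bar>a i\<bar>) + (\<Sum>j\<in>T. \<bar>b j\<bar>))"
  using assms
proof (induction arbitrary: a b rule: leaf_tree.induct)
  case (root i)
  then show ?case by (intro exI[of _ "\<lambda>_ _. 0"]) (auto simp: flow_on_def)
next
  case (right_leaf S T F i j)
  have fin: "finite S" "finite T" and F: "F \<subseteq> S \<times> T"
    using leaf_tree_finite[OF right_leaf.hyps(1)] leaf_tree_subset[OF right_leaf.hyps(1)] by auto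
  let ?a = "a(i := a i - b j)"
  have "sum ?a S = sum b T"
    using right_leaf.prems sum_fun_upd_minus[of S i a "b j"] fin right_leaf.hyps by simp
  then obtain x where x: "flow_on F S T ?a b x"
    "\<And>k l. \<bar>x k l\<bar> \<le> (\<Sum>i\<in>S. \<bar>?a i\<bar>) + (\<Sum>j\<in>T. \<bar>b j\<bar>)" using right_leaf.IH by blast
  have "\<bar>(x(i := (x i)(j := b j))) k l\<bar> \<le> (\<Sum>i\<in>S. \<bar>a i\<bar>) + (\<Sum>j\<in>insert j T. \<bar>b j\<bar>)" for k l
    using x(2)[of k l] sum_abs_fun_upd_minus[of S i a "b j"] fin right_leaf.hyps
      sum_nonneg[of S "\<lambda>i. \<bar>a i\<bar>"] sum_nonneg[of T "\<lambda>i. \<bar>b i\<bar>"] by auto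
  with flow_on_add_right_leaf[OF fin F right_leaf.hyps(2,3) x(1)] show ?case by blast
next
  case (left_leaf S T F j i)
  have fin: "finite S" "finite T" and F: "F \<subseteq> S \<times> T"
    using leaf_tree_finite[OF left_leaf.hyps(1)] leaf_tree_subset[OF left_leaf.hyps(1)] by auto
  let ?b = "b(j := b j - a i)"
  have "sum a S = sum ?b T"
    using left_leaf.prems sum_fun_upd_minus[of T j b "a i"] fin left_leaf.hyps by simp
  then obtain x where x: "flow_on F S T a ?b x"
    "\<And>k l. \<bar>x k l\<bar> \<le> (\<Sum>i\<in>S. \<bar>a i\<bar>) + (\<Sum>j\<in>T. \<bar>?b j\<bar>)" using left_leaf.IH by blast
  have "\<bar>(x(i := (x i)(j := a i))) k l\<bar> \<le> (\<Sum>i\<in>insert i S. \<bar>a i\<bar>) + (\<Sum>j\<in>T. \<bar>b j\<bar>)" for k l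
    using x(2)[of k l] sum_abs_fun_upd_minus[of T j b "a i"] fin left_leaf.hyps
      sum_nonneg[of S "\<lambda>i. \<bar>a i\<bar>"] sum_nonneg[of T "\<lambda>i. \<bar>b i\<bar>"] by auto
  with flow_on_add_left_leaf[OF fin F left_leaf.hyps(2,3) x(1)] show ?case by blast
qed

text \<open>On a tree every entry is an integer combination of the margins, as peeling off leaves
  shows. For the difference of two flows whose margins agree modulo \<open>p\<close> this makes the
  entries agree modulo \<open>p\<close>.\<close>

lemma leaf_tree_flow_dvd:
  fixes p :: int
  assumes "leaf_tree S T F" "flow_on F S T a b x" "\<forall>i\<in>S. p dvd a i" "\<forall>j\<in>T. p dvd b j"
  shows "p dvd x i j"
  using assms
proof (induction arbitrary: a b x rule: leaf_tree.induct)
  case (root i)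
  then show ?case by (auto simp: flow_on_def)
next
  case (right_leaf S T F k l)
  have fin: "finite S" "finite T" and F: "F \<subseteq> S \<times> T"
    using leaf_tree_finite[OF right_leaf.hyps(1)] leaf_tree_subset[OF right_leaf.hyps(1)] by auto
  note leaf = flow_on_remove_right_leaf[OF fin F right_leaf.hyps(2,3) right_leaf.prems(1)]
  have "\<forall>m\<in>S. p dvd (a(k := a k - b l)) m" using right_leaf.prems(2,3) by simp
  then have "p dvd (x(k := (x k)(l := 0))) i j" using right_leaf.IH[OF leaf(2)] right_leaf.prems(3) by blast
  then show ?case using leaf(1) right_leaf.prems(3) by (auto split: if_splits)
next
  case (left_leaf S T F l k)
  have fin: "finite S" "finite T" and F: "F \<subseteq> S \<times> T"
    using leaf_tree_finite[OF left_leaf.hyps(1)] leaf_tree_subset[OF left_leaf.hyps(1)] by auto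
  note leaf = flow_on_remove_left_leaf[OF fin F left_leaf.hyps(2,3) left_leaf.prems(1)]
  have "\<forall>m\<in>T. p dvd (b(l := b l - a k)) m" using left_leaf.prems(2,3) by simp
  then have "p dvd (x(k := (x k)(l := 0))) i j" using left_leaf.IH[OF leaf(2)] left_leaf.prems(2) by blast
  then show ?case using leaf(1) left_leaf.prems(2) by (auto split: if_splits)
qed

text \<open>The entry on an edge \<open>(i, j)\<close> is the \<open>\<alpha>\<close>-weight of the
  component of \<open>i\<close> that remains when this edge is deleted. Margins of this form record
  the degrees on the left while every entry on the tree stays positive.\<close>

lemma leaf_tree_degree_flow:
  fixes \<alpha> :: "'a \<Rightarrow> int"
  assumes "leaf_tree S T F" "\<forall>i\<in>S. 0 < \<alpha> i" "M = sum \<alpha> S"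
  shows "\<exists>x. flow_on F S T (\<lambda>i. \<alpha> i + M * (int (card (F `` {i})) - 1)) (\<lambda>_. M) x \<and>
             (\<forall>(i, j)\<in>F. \<alpha> i \<le> x i j)"
  using assms
proof (induction arbitrary: \<alpha> M rule: leaf_tree.induct)
  case (root i)
  then show ?case by (intro exI[of _ "\<lambda>_ _. 0"]) (auto simp: flow_on_def)
next
  case (right_leaf S T F i j)
  have fin: "finite S" "finite T" "finite F" and F: "F \<subseteq> S \<times> T"
    using leaf_tree_finite[OF right_leaf.hyps(1)] leaf_tree_subset[OF right_leaf.hyps(1)] by auto
  obtain x where x: "flow_on F S T (\<lambda>i. \<alpha> i + M * (int (card (F `` {i})) - 1)) (\<lambda>_. M) x"
    "\<And>i j. (i, j) \<in> F \<Longrightarrow> \<alpha> i \<le> x i j" using right_leaf.IH[OF right_leaf.prems] by blast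
  have "finite (F `` {i})" "j \<notin> F `` {i}"
    using fin(2) F right_leaf.hyps(3) finite_subset[of "F `` {i}" T] by blast+
  moreover have "insert (i, j) F `` {i} = insert j (F `` {i})" by auto
  ultimately have ci: "card (insert (i, j) F `` {i}) = Suc (card (F `` {i}))" by simp
  have ck: "insert (i, j) F `` {k} = F `` {k}" if "k \<noteq> i" for k using that by auto
  have "(\<lambda>k. \<alpha> k + M * (int (card (F `` {k})) - 1)) =
    (let a = \<lambda>k. \<alpha> k + M * (int (card (insert (i, j) F `` {k})) - 1) in a(i := a i - M))"
    by (auto simp: ci ck Let_def algebra_simps fun_eq_iff)
  then have "flow_on (insert (i, j) F) S (insert j T)
      (\<lambda>k. \<alpha> k + M * (int (card (insert (i, j) F `` {k})) - 1)) (\<lambda>_. M) (x(i := (x i)(j := M)))"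
    using x(1) flow_on_add_right_leaf[OF fin(1,2) F right_leaf.hyps(2,3)] by (metis (no_types, lifting))
  moreover have "\<alpha> k \<le> (x(i := (x i)(j := M))) k l" if kl: "(k, l) \<in> insert (i, j) F" for k l
  proof (cases "(k, l) = (i, j)")
    case True
    have "\<alpha> i \<le> M" using right_leaf.prems right_leaf.hyps fin member_le_sum[of i S \<alpha>]
      by (simp add: less_imp_le)
    then show ?thesis using True by simp
  next
    case False
    then show ?thesis using kl x(2)[of k l] by auto
  qed
  ultimately show ?case by blast
next
  case (left_leaf S T F j i)
  have fin: "finite S" "finite T" "finite F" and F: "F \<subseteq> S \<times> T"
    using leaf_tree_finite[OF left_leaf.hyps(1)] leaf_tree_subset[OF left_leaf.hyps(1)] by auto
  obtain k where k: "(k, j) \<in> F" using leaf_tree_right_covered left_leaf.hyps by metis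
  then have kS: "k \<in> S" "k \<noteq> i" using F left_leaf.hyps by auto
  \<comment> \<open>The weight of the new leaf \<open>i\<close> is lent to a left neighbour
    \<open>k\<close> of \<open>j\<close>, so that the total stays \<open>M\<close>; afterwards the
    entry at \<open>(k, j)\<close> hands it over to the new edge \<open>(i, j)\<close>.\<close>
  let ?\<beta> = "\<alpha>(k := \<alpha> k - (- \<alpha> i))"
  have "\<forall>i\<in>S. 0 < ?\<beta> i" using left_leaf.prems by auto
  moreover have "M = sum ?\<beta> S"
    using left_leaf.prems left_leaf.hyps fin kS sum_fun_upd_minus[of S k \<alpha> "- \<alpha> i"] by simp
  ultimately have "\<exists>x. flow_on F S T (\<lambda>i. ?\<beta> i + M * (int (card (F `` {i})) - 1)) (\<lambda>_. M) x \<and>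
      (\<forall>(i, j)\<in>F. ?\<beta> i \<le> x i j)" by (rule left_leaf.IH)
  then obtain x where
    x: "flow_on F S T (\<lambda>i. ?\<beta> i + M * (int (card (F `` {i})) - 1)) (\<lambda>_. M) x"
    "\<And>i j. (i, j) \<in> F \<Longrightarrow> ?\<beta> i \<le> x i j" by fast
  let ?a = "\<lambda>l. \<alpha> l + M * (int (card (insert (i, j) F `` {l})) - 1)"
  have "F `` {i} = {}" using F left_leaf.hyps by auto
  then have "insert (i, j) F `` {i} = {j}" by auto
  then have ci: "?a i = \<alpha> i" by simp
  have ck: "insert (i, j) F `` {l} = F `` {l}" if "l \<noteq> i" for l using that by auto
  define x' where "x' = x(k := (x k)(j := x k j - \<alpha> i))"
  have "flow_on F S T ?a ((\<lambda>_. M)(j := M - \<alpha> i)) x'"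
    unfolding flow_on_def
  proof (intro conjI allI impI ballI)
    fix m n assume "(m, n) \<notin> F"
    then show "x' m n = 0" using x(1) k by (auto simp: x'_def flow_on_def)
  next
    fix m assume m: "m \<in> S"
    then have mi: "m \<noteq> i" using left_leaf.hyps by blast
    have "(\<Sum>n\<in>T. x' m n) = (\<Sum>n\<in>T. x m n) - (if m = k then \<alpha> i else 0)"
    proof (cases "m = k")
      case True
      then have "(\<Sum>n\<in>T. x' m n) = (\<Sum>n\<in>T. ((x k)(j := x k j - \<alpha> i)) n)" by (simp add: x'_def)
      then show ?thesis using sum_fun_upd_minus[of T j "x k" "\<alpha> i"] fin left_leaf.hyps True by simp
    qed (simp add: x'_def)
    also have "(\<Sum>n\<in>T. x m n) = ?\<beta> m + M * (int (card (F `` {m})) - 1)"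
      using x(1) m by (simp add: flow_on_def)
    finally show "(\<Sum>n\<in>T. x' m n) = ?a m"
      using ck[OF mi] by (auto split: if_splits)
  next
    fix n assume n: "n \<in> T"
    have "(\<Sum>m\<in>S. x' m n) = (\<Sum>m\<in>S. x m n) - (if n = j then \<alpha> i else 0)"
    proof (cases "n = j")
      case True
      have "(\<Sum>m\<in>S. x' m n) = (\<Sum>m\<in>S. ((\<lambda>m. x m j)(k := x k j - \<alpha> i)) m)"
        using True by (intro sum.cong) (auto simp: x'_def)
      then show ?thesis
        using sum_fun_upd_minus[of S k "\<lambda>m. x m j" "\<alpha> i"] fin kS True by simp
    next
      case False
      then have "(\<Sum>m\<in>S. x' m n) = (\<Sum>m\<in>S. x m n)" by (intro sum.cong) (auto simp: x'_def)
      then show ?thesis using False by simp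
    qed
    then show "(\<Sum>m\<in>S. x' m n) = ((\<lambda>_. M)(j := M - \<alpha> i)) n"
      using x(1) n by (simp add: flow_on_def)
  qed
  then have "flow_on F S T ?a ((\<lambda>_. M)(j := (\<lambda>_. M) j - ?a i)) x'" by (simp only: ci)
  from flow_on_add_left_leaf[OF fin(1,2) F left_leaf.hyps(2,3) this]
  have "flow_on (insert (i, j) F) (insert i S) T ?a (\<lambda>_. M) (x'(i := (x' i)(j := \<alpha> i)))"
    by (simp only: ci)
  moreover have "\<alpha> m \<le> (x'(i := (x' i)(j := \<alpha> i))) m n" if mn: "(m, n) \<in> insert (i, j) F" for m n
  proof (cases "(m, n) = (i, j)")
    case False
    then have "(m, n) \<in> F" using mn by auto
    moreover from this have "m \<noteq> i" using F left_leaf.hyps by auto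
    moreover have "0 < \<alpha> i" using left_leaf.prems by simp
    ultimately show ?thesis using x(2)[of m n] by (auto simp: x'_def split: if_splits)
  qed simp
  ultimately show ?case by blast
qed

text \<open>A largest tree through \<open>i\<^sub>0\<close> inside \<open>G\<close> fills its
  component: an edge with exactly one end in the tree could be attached as a further leaf.\<close>

lemma leaf_tree_grow:
  assumes "finite P" "finite Q" "G \<subseteq> P \<times> Q" "i\<^sub>0 \<in> P"
  obtains S T F where "leaf_tree S T F" "S \<subseteq> P" "T \<subseteq> Q" "F \<subseteq> G" "i\<^sub>0 \<in> S"
    "\<And>i j. (i, j) \<in> G \<Longrightarrow> i \<in> S \<longleftrightarrow> j \<in> T"
proof -
  define ok where "ok = (\<lambda>(S, T, F). leaf_tree S T F \<and> S \<subseteq> P \<and> T \<subseteq> Q \<and> F \<subseteq> G \<and> i\<^sub>0 \<in> S)"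
  define m where "m = (\<lambda>(S :: 'a set, T :: 'b set, F :: ('a \<times> 'b) set). card S + card T)"
  have "ok ({i\<^sub>0}, {}, {})" using assms by (auto simp: ok_def intro: leaf_tree.root)
  moreover have "\<forall>t. ok t \<longrightarrow> m t < Suc (card P + card Q)"
    using assms by (auto simp: ok_def m_def less_Suc_eq_le intro!: add_mono card_mono)
  ultimately obtain t where t: "ok t" "\<And>t'. ok t' \<Longrightarrow> m t' \<le> m t"
    using ex_has_greatest_nat[of ok "({i\<^sub>0}, {}, {})" m "Suc (card P + card Q)"] by blast
  obtain S T F where STF: "t = (S, T, F)" by (cases t)
  have tr: "leaf_tree S T F" "S \<subseteq> P" "T \<subseteq> Q" "F \<subseteq> G" "i\<^sub>0 \<in> S"
    using t(1) by (auto simp: ok_def STF)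
  have fin: "finite S" "finite T" using leaf_tree_finite[OF tr(1)] by auto
  have "i \<in> S \<longleftrightarrow> j \<in> T" if ij: "(i, j) \<in> G" for i j
  proof (rule ccontr)
    assume "(i \<in> S) \<noteq> (j \<in> T)"
    then consider "i \<in> S" "j \<notin> T" | "i \<notin> S" "j \<in> T" by blast
    then show False
    proof cases
      case 1
      then have "ok (S, insert j T, insert (i, j) F)"
        using tr ij assms(3) leaf_tree.right_leaf[OF tr(1) 1] by (auto simp: ok_def)
      from t(2)[OF this] show False using 1 fin by (simp add: m_def STF)
    next
      case 2
      then have "ok (insert i S, T, insert (i, j) F)"
        using tr ij assms(3) leaf_tree.left_leaf[OF tr(1) 2(2,1)] by (auto simp: ok_def)
      from t(2)[OF this] show False using 2 fin by (simp add: m_def STF)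
    qed
  qed
  with tr show thesis using that by blast
qed


subsection \<open>Duality of hypertree counts\<close>

text \<open>When total supply equals total demand, no row can have anything left over.\<close>

lemma supply_demand_balanced:
  fixes b :: "'b \<Rightarrow> nat" and a :: "'a \<Rightarrow> nat"
  assumes "finite P" "finite Q" "R \<subseteq> P \<times> Q"
    and "\<And>T. T \<subseteq> Q \<Longrightarrow> sum b T \<le> sum a (R\<inverse> `` T)" and "sum a P = sum b Q"
  obtains x where "flow_on R P Q (int \<circ> a) (int \<circ> b) x" "\<And>i j. 0 \<le> x i j"
proof -
  from supply_demand[OF assms(1-4)]
  obtain x :: "'a \<Rightarrow> 'b \<Rightarrow> nat" where x: "\<And>i j. (i, j) \<notin> R \<Longrightarrow> x i j = 0"
    "\<And>j. j \<in> Q \<Longrightarrow> (\<Sum>i\<in>P. x i j) = b j" "\<And>i. i \<in> P \<Longrightarrow> (\<Sum>j\<in>Q. x i j) \<le> a i" by blast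
  have "(\<Sum>i\<in>P. \<Sum>j\<in>Q. x i j) = (\<Sum>j\<in>Q. \<Sum>i\<in>P. x i j)" by (rule sum.swap)
  also have "\<dots> = sum a P" using x(2) assms(5) by simp
  finally have tot: "(\<Sum>i\<in>P. \<Sum>j\<in>Q. x i j) = sum a P" .
  have rows: "(\<Sum>j\<in>Q. x i j) = a i" if "i \<in> P" for i
  proof (rule ccontr)
    assume "(\<Sum>j\<in>Q. x i j) \<noteq> a i"
    then have "(\<Sum>i\<in>P. \<Sum>j\<in>Q. x i j) < sum a P"
      using x(3) that assms(1) by (intro sum_strict_mono_ex1) (auto simp: order.strict_iff_order)
    with tot show False by simp
  qed
  have "flow_on R P Q (int \<circ> a) (int \<circ> b) (\<lambda>i j. int (x i j))"
    using x(1,2) rows by (auto simp: flow_on_def simp flip: of_nat_sum)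
  then show thesis by (rule that) simp
qed

section \<open>Optimal potentials and integral duality\<close>

lemma flow_on_mono: "flow_on F P Q a b x \<Longrightarrow> F \<subseteq> R \<Longrightarrow> flow_on R P Q a b x"
  unfolding flow_on_def by blast

lemma flow_on_cong_weight:
  "flow_on F P Q a b x \<Longrightarrow> (\<And>i j. (i, j) \<in> F \<Longrightarrow> f i j = h i j) \<Longrightarrow> x i j * f i j = x i j * h i j"
  by (cases "(i, j) \<in> F") (simp_all add: flow_on_def)

text \<open>Against a potential the cost of a flow depends on its margins alone; weak duality and
  the vanishing of tight circulations both rest on this.\<close>

lemma flow_on_pairing:
  fixes u :: "'a \<Rightarrow> int" and v :: "'b \<Rightarrow> int"
  assumes "finite P" "finite Q" "R \<subseteq> P \<times> Q" "flow_on R P Q a b x"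
  shows "(\<Sum>(i, j)\<in>R. x i j * (u i + v j)) = (\<Sum>i\<in>P. a i * u i) + (\<Sum>j\<in>Q. b j * v j)"
proof -
  have "(\<Sum>(i, j)\<in>R. x i j * (u i + v j)) = (\<Sum>(i, j)\<in>P \<times> Q. x i j * (u i + v j))"
    using assms by (intro sum.mono_neutral_left) (auto simp: flow_on_def)
  also have "\<dots> = (\<Sum>i\<in>P. \<Sum>j\<in>Q. x i j * u i) + (\<Sum>i\<in>P. \<Sum>j\<in>Q. x i j * v j)"
    by (simp add: sum.cartesian_product[symmetric] algebra_simps sum.distrib)
  also have "(\<Sum>i\<in>P. \<Sum>j\<in>Q. x i j * v j) = (\<Sum>j\<in>Q. \<Sum>i\<in>P. x i j * v j)" by (rule sum.swap)
  finally show ?thesis using assms(4) by (simp add: flow_on_def flip: sum_distrib_right)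
qed

text \<open>Potentials below the cost have value at most the cost of any feasible flow, so by
  integrality one of maximal value exists. If Hall's condition failed on its tight edges for some
  \<open>T\<close>, a unit shift of the potential would increase the value.\<close>

lemma optimal_potential:
  fixes b :: "'b \<Rightarrow> nat" and a :: "'a \<Rightarrow> nat" and c :: "'a \<times> 'b \<Rightarrow> int"
  assumes "finite P" "finite Q" "R \<subseteq> P \<times> Q"
    and "\<And>T. T \<subseteq> Q \<Longrightarrow> sum b T \<le> sum a (R\<inverse> `` T)" and "sum a P = sum b Q"
    and "\<And>e. 0 \<le> c e"
  obtains u v x where "\<And>i j. (i, j) \<in> R \<Longrightarrow> u i + v j \<le> c (i, j)"
    "flow_on {(i, j) \<in> R. u i + v j = c (i, j)} P Q (int \<circ> a) (int \<circ> b) x" "\<And>i j. 0 \<le> x i j"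
proof -
  define feas where "feas = (\<lambda>(u, v). \<forall>(i, j)\<in>R. u i + v j \<le> c (i, j))"
  define obj where "obj = (\<lambda>(u, v). (\<Sum>i\<in>P. int (a i) * u i) + (\<Sum>j\<in>Q. int (b j) * v j))"
  obtain x0 where x0: "flow_on R P Q (int \<circ> a) (int \<circ> b) x0" "\<And>i j. 0 \<le> x0 i j"
    using supply_demand_balanced[OF assms(1-5)] by blast
  define C where "C = (\<Sum>(i, j)\<in>R. x0 i j * c (i, j))"
  have bound: "obj t \<le> C" if "feas t" for t
  proof -
    obtain u v where t: "t = (u, v)" by (cases t)
    have "obj t = (\<Sum>(i, j)\<in>R. x0 i j * (u i + v j))"
      using flow_on_pairing[OF assms(1-3) x0(1)] by (simp add: obj_def t)
    also have "\<dots> \<le> C" unfolding C_def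
      using that x0(2) by (intro sum_mono) (auto simp: feas_def t intro!: mult_left_mono)
    finally show ?thesis .
  qed
  \<comment> \<open>Nonnegative costs enter here: the zero potential is feasible.\<close>
  have "feas (\<lambda>_. 0, \<lambda>_. 0)" using assms(6) by (simp add: feas_def)
  then obtain t where t: "feas t" "\<And>t'. feas t' \<Longrightarrow> nat (C - obj t) \<le> nat (C - obj t')"
    using ex_has_least_nat[of feas _ "\<lambda>t. nat (C - obj t)"] by blast
  have max: "obj t' \<le> obj t" if "feas t'" for t'
    using t(2)[OF that] bound[OF that] bound[OF t(1)] by linarith
  obtain u v where uv: "t = (u, v)" by (cases t)
  define F where "F = {(i, j) \<in> R. u i + v j = c (i, j)}"
  have FPQ: "F \<subseteq> P \<times> Q" using assms(3) by (auto simp: F_def)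
  have hall: "sum b T \<le> sum a (F\<inverse> `` T)" if T: "T \<subseteq> Q" for T
  proof -
    \<comment> \<open>Lower the tight neighbours of \<open>T\<close> by 1 and raise \<open>T\<close>
      by 1. An edge into \<open>T\<close> from any other vertex is not tight, hence by integrality
      has slack at least 1.\<close>
    define u' where "u' i = u i - (if i \<in> F\<inverse> `` T then 1 else 0)" for i
    define v' where "v' j = v j + (if j \<in> T then 1 else 0)" for j
    have "u' i + v' j \<le> c (i, j)" if ij: "(i, j) \<in> R" for i j
    proof (cases "j \<in> T \<and> i \<notin> F\<inverse> `` T")
      case True
      then have "(i, j) \<notin> F" by auto
      moreover have "u i + v j \<le> c (i, j)" using t(1) ij by (auto simp: feas_def uv)
      ultimately have "u i + v j < c (i, j)" using ij by (auto simp: F_def)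
      then show ?thesis using True by (simp add: u'_def v'_def)
    next
      case False
      moreover have "u i + v j \<le> c (i, j)" using t(1) ij by (auto simp: feas_def uv)
      ultimately show ?thesis by (auto simp: u'_def v'_def)
    qed
    then have "obj (u', v') \<le> obj t" by (intro max) (auto simp: feas_def)
    moreover have "(\<Sum>i\<in>P. int (a i) * u' i) = (\<Sum>i\<in>P. int (a i) * u i) - int (sum a (F\<inverse> `` T))"
    proof -
      have "(\<Sum>i\<in>P. int (a i) * u' i) = (\<Sum>i\<in>P. int (a i) * u i - (if i \<in> F\<inverse> `` T then int (a i) else 0))"
        by (intro sum.cong) (auto simp: u'_def algebra_simps)
      also have "(\<Sum>i\<in>P. if i \<in> F\<inverse> `` T then int (a i) else 0) = (\<Sum>i\<in>F\<inverse> `` T. int (a i))"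
        using assms(1) FPQ by (subst sum.inter_restrict[symmetric]) (auto intro!: sum.cong)
      ultimately show ?thesis by (simp add: sum_subtractf)
    qed
    moreover have "(\<Sum>j\<in>Q. int (b j) * v' j) = (\<Sum>j\<in>Q. int (b j) * v j) + int (sum b T)"
    proof -
      have "(\<Sum>j\<in>Q. int (b j) * v' j) = (\<Sum>j\<in>Q. int (b j) * v j + (if j \<in> T then int (b j) else 0))"
        by (intro sum.cong) (auto simp: v'_def algebra_simps)
      also have "(\<Sum>j\<in>Q. if j \<in> T then int (b j) else 0) = (\<Sum>j\<in>T. int (b j))"
        using assms(2) T by (subst sum.inter_restrict[symmetric]) (auto intro!: sum.cong)
      ultimately show ?thesis by (simp add: sum.distrib)
    qed
    ultimately show ?thesis by (simp add: obj_def uv del: of_nat_sum)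
  qed
  obtain x where "flow_on F P Q (int \<circ> a) (int \<circ> b) x" "\<And>i j. 0 \<le> x i j"
    using supply_demand_balanced[OF assms(1,2) FPQ hall assms(5)] by blast
  moreover have "\<And>i j. (i, j) \<in> R \<Longrightarrow> u i + v j \<le> c (i, j)" using t(1) by (auto simp: feas_def uv)
  ultimately show thesis using that F_def by blast
qed

text \<open>The vectors \<open>g\<close> such that some spanning tree has degree \<open>g i + 1\<close> at every \<open>i \<in> P\<close>,
  given by their defining inequalities.\<close>

definition ht :: "'a set \<Rightarrow> 'b set \<Rightarrow> ('a \<times> 'b) set \<Rightarrow> ('a \<Rightarrow> nat) set" where
  "ht P Q R = {g. (\<forall>i. i \<notin> P \<longrightarrow> g i = 0) \<and> sum g P + 1 = card Q \<and>
     (\<forall>S\<subseteq>P. S \<noteq> {} \<longrightarrow> sum g S < card (R `` S))}"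

text \<open>Connectedness of the graph on \<open>P\<close> and \<open>Q\<close> with edges
  \<open>F\<close>, phrased through unions of components, because on these the row sums and the
  column sums of a flow have to balance.\<close>

definition joined :: "'a set \<Rightarrow> 'b set \<Rightarrow> ('a \<times> 'b) set \<Rightarrow> bool" where
  "joined P Q F \<longleftrightarrow> (\<forall>S T. S \<subseteq> P \<longrightarrow> T \<subseteq> Q \<longrightarrow> (\<forall>(i, j)\<in>F. i \<in> S \<longleftrightarrow> j \<in> T) \<longrightarrow>
     S = {} \<and> T = {} \<or> S = P \<and> T = Q)"

text \<open>For connected \<open>R\<close> and generic \<open>c\<close> these are the maximal
  simplices of the regular triangulation of the root polytope of \<open>R\<close> induced by the
  heights \<open>c\<close>. Acyclicity is a consequence of genericity, by
  \<open>leaf_tree_eq_tight\<close>.\<close>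

definition opt_trees :: "'a set \<Rightarrow> 'b set \<Rightarrow> ('a \<times> 'b) set \<Rightarrow> ('a \<times> 'b \<Rightarrow> int) \<Rightarrow> ('a \<times> 'b) set set" where
  "opt_trees P Q R c = {F. F \<subseteq> R \<and> joined P Q F \<and>
     (\<exists>u v. (\<forall>i j. (i, j) \<in> R \<longrightarrow> u i + v j \<le> c (i, j)) \<and>
             (\<forall>i j. (i, j) \<in> F \<longrightarrow> u i + v j = c (i, j)))}"

text \<open>Two kinds of coefficients \<open>z\<close> occur: differences of flows with entries
  between 0 and \<open>card P\<close>, and a unit on one edge minus a tree flow bounded by 2, hence
  at most 3. The bound covers both and is symmetric in \<open>P\<close> and \<open>Q\<close>, so
  that the transposed problem is generic as well.\<close>

locale generic_bipartite =
  fixes P :: "'a set" and Q :: "'b set" and R :: "('a \<times> 'b) set" and c :: "'a \<times> 'b \<Rightarrow> int"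
  assumes finP: "finite P" and finQ: "finite Q" and neP: "P \<noteq> {}" and neQ: "Q \<noteq> {}"
    and R: "R \<subseteq> P \<times> Q" and c_nonneg: "\<And>e. 0 \<le> c e"
    and generic: "\<And>z e. (\<And>e. e \<in> R \<Longrightarrow> \<bar>z e\<bar> \<le> int (card P + card Q) + 3) \<Longrightarrow>
      (\<Sum>e\<in>R. z e * c e) = 0 \<Longrightarrow> e \<in> R \<Longrightarrow> z e = 0"
begin

abbreviation p :: int where "p \<equiv> int (card P)"

lemma p_pos: "0 < p" using finP neP by (simp add: card_gt_0_iff)

text \<open>Tight edges cost exactly their potential, which pairs to 0 with zero margins. A bounded
  circulation on tight edges therefore has cost 0, and genericity kills it.\<close>

lemma tight_circulation_zero:
  assumes "F \<subseteq> R" "\<forall>i j. (i, j) \<in> F \<longrightarrow> u i + v j = c (i, j)"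
    and "flow_on F P Q (\<lambda>_. 0) (\<lambda>_. 0) z" "\<forall>i j. \<bar>z i j\<bar> \<le> int (card P + card Q) + 3"
  shows "z i j = 0"
proof (cases "(i, j) \<in> R")
  case False
  then show ?thesis using assms(1,3) by (auto simp: flow_on_def)
next
  case True
  have "flow_on R P Q (\<lambda>_. 0) (\<lambda>_. 0) z" using assms(1,3) by (auto simp: flow_on_def)
  from flow_on_pairing[OF finP finQ R this]
  have "(\<Sum>(i, j)\<in>R. z i j * (u i + v j)) = 0" by simp
  moreover have "z i j * (u i + v j) = z i j * c (i, j)" for i j
    using flow_on_cong_weight[OF assms(3), of "\<lambda>i j. u i + v j" "\<lambda>i j. c (i, j)"] assms(2) by simp
  ultimately have "(\<Sum>e\<in>R. (case e of (i, j) \<Rightarrow> z i j) * c e) = 0"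
    by (simp add: case_prod_unfold)
  from generic[OF _ this True] show ?thesis using assms(4) by auto
qed

lemma flow_diff:
  "flow_on F P Q a b x \<Longrightarrow> flow_on F P Q a' b' x' \<Longrightarrow>
   flow_on F P Q (\<lambda>i. a i - a' i) (\<lambda>j. b j - b' j) (\<lambda>i j. x i j - x' i j)"
  by (auto simp: flow_on_def sum_subtractf)

text \<open>A further tight edge would close a cycle: the unit on it minus the flow along the tree
  with the same margins is a nonzero circulation on tight edges.\<close>

lemma leaf_tree_eq_tight:
  assumes "leaf_tree P Q T" "T \<subseteq> F" "F \<subseteq> R" "\<forall>i j. (i, j) \<in> F \<longrightarrow> u i + v j = c (i, j)"
  shows "T = F"
proof (rule ccontr)
  assume "T \<noteq> F"
  then obtain k l where kl: "(k, l) \<in> F" "(k, l) \<notin> T" using assms(2) by auto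
  then have klPQ: "k \<in> P" "l \<in> Q" using assms(3) R by auto
  let ?a = "\<lambda>i. if i = k then 1 else 0 :: int" and ?b = "\<lambda>j. if j = l then 1 else 0 :: int"
  have sums: "sum ?a P = 1" "sum ?b Q = 1" "(\<Sum>i\<in>P. \<bar>?a i\<bar>) = 1" "(\<Sum>j\<in>Q. \<bar>?b j\<bar>) = 1"
    using klPQ finP finQ by (simp_all add: if_distrib cong: if_cong)
  then obtain y where y: "flow_on T P Q ?a ?b y" "\<And>i j. \<bar>y i j\<bar> \<le> 2"
    using leaf_tree_balanced_flow[OF assms(1), of ?a ?b] by auto
  let ?e = "\<lambda>i j. if i = k \<and> j = l then 1 else 0 :: int"
  have "?e i j = (if j = l then ?a i else 0)" "?e i j = (if i = k then ?b j else 0)" for i j by auto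
  then have "flow_on F P Q ?a ?b ?e"
    using kl klPQ finP finQ unfolding flow_on_def by (auto simp: if_distrib cong: if_cong)
  moreover have "flow_on F P Q ?a ?b y" using y(1) assms(2) by (auto simp: flow_on_def)
  ultimately have "flow_on F P Q (\<lambda>i. 0) (\<lambda>j. 0) (\<lambda>i j. ?e i j - y i j)"
    using flow_diff by fastforce
  moreover have "\<bar>?e i j - y i j\<bar> \<le> int (card P + card Q) + 3" for i j
    using y(2)[of i j] by auto
  ultimately have "?e k l - y k l = 0"
    using tight_circulation_zero[OF assms(3,4), of "\<lambda>i j. ?e i j - y i j" k l] by blast
  moreover have "y k l = 0" using y(1) kl by (simp add: flow_on_def)
  ultimately show False by simp
qed

lemma opt_tree_leaf_tree:
  assumes "F \<in> opt_trees P Q R c"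
  shows "leaf_tree P Q F"
proof -
  obtain u v where F: "F \<subseteq> R" "joined P Q F" "\<And>i j. (i, j) \<in> F \<Longrightarrow> u i + v j = c (i, j)"
    using assms unfolding opt_trees_def by blast
  obtain i\<^sub>0 where i0: "i\<^sub>0 \<in> P" using neP by auto
  have "F \<subseteq> P \<times> Q" using F(1) R by auto
  from leaf_tree_grow[OF finP finQ this i0]
  obtain S T F' where G: "leaf_tree S T F'" "S \<subseteq> P" "T \<subseteq> Q" "F' \<subseteq> F" "i\<^sub>0 \<in> S"
    "\<And>i j. (i, j) \<in> F \<Longrightarrow> i \<in> S \<longleftrightarrow> j \<in> T" by metis
  then have "S = P \<and> T = Q" using F(2)[unfolded joined_def, rule_format, of S T] by auto
  then have "leaf_tree P Q F'" using G(1) by simp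
  moreover have "F' = F" using leaf_tree_eq_tight[OF calculation G(4) F(1)] F(3) by blast
  ultimately show ?thesis by simp
qed

definition deg1 :: "('a \<times> 'b) set \<Rightarrow> 'a \<Rightarrow> nat" where
  "deg1 F i = (if i \<in> P then card (F `` {i}) - 1 else 0)"

text \<open>Unit weights, with total \<open>p\<close>, turn the left degrees into row sums. The
  entries are positive exactly on \<open>F\<close>, so the tree can be read off from the
  flow.\<close>

lemma leaf_tree_deg1_flow:
  assumes "leaf_tree P Q F"
  obtains x where "flow_on F P Q (\<lambda>i. 1 + p * int (deg1 F i)) (\<lambda>_. p) x"
    "\<And>i j. (i, j) \<in> F \<Longrightarrow> 1 \<le> x i j" "\<And>i j. 0 \<le> x i j" "\<And>i j. x i j \<le> p"
proof -
  have "\<exists>x. flow_on F P Q (\<lambda>i. 1 + p * (int (card (F `` {i})) - 1)) (\<lambda>_. p) x \<and>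
             (\<forall>(i, j)\<in>F. 1 \<le> x i j)"
    using leaf_tree_degree_flow[OF assms, of "\<lambda>_. 1" p] by simp
  then obtain x where x: "flow_on F P Q (\<lambda>i. 1 + p * (int (card (F `` {i})) - 1)) (\<lambda>_. p) x"
    "\<And>i j. (i, j) \<in> F \<Longrightarrow> 1 \<le> x i j" by blast
  have nn: "0 \<le> x i j" for i j using x by (cases "(i, j) \<in> F") (force simp: flow_on_def)+
  have le: "x i j \<le> p" for i j
  proof (cases "(i, j) \<in> F")
    case True
    then have "i \<in> P" "j \<in> Q" using leaf_tree_subset[OF assms] by auto
    then have "x i j \<le> (\<Sum>i\<in>P. x i j)" using nn finP by (intro member_le_sum) auto
    then show ?thesis using x(1) \<open>j \<in> Q\<close> by (simp add: flow_on_def)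
  qed (use x(1) in \<open>auto simp: flow_on_def\<close>)
  \<comment> \<open>The truncated subtraction in \<open>deg1\<close> loses nothing: \<open>Q\<close>
    is nonempty, so every left vertex of the tree lies on an edge.\<close>
  have "int (card (F `` {i})) - 1 = int (deg1 F i)" if "i \<in> P" for i
  proof -
    have "finite (F `` {i})" using leaf_tree_subset[OF assms] finQ finite_subset[of "F `` {i}" Q] by blast
    moreover have "F `` {i} \<noteq> {}" using leaf_tree_left_covered[OF assms neQ that] by blast
    ultimately have "card (F `` {i}) \<noteq> 0" by simp
    then show ?thesis using that by (simp add: deg1_def)
  qed
  then have "flow_on F P Q (\<lambda>i. 1 + p * int (deg1 F i)) (\<lambda>_. p) x"
    using x(1) by (simp add: flow_on_def)
  then show thesis using that x(2) nn le by blast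
qed

text \<open>With row sums \<open>1 + p * g i\<close> and column sums \<open>p = card P\<close>, no proper union of components can be
  balanced modulo \<open>p\<close>, and on a tree the entries of such a flow are determined modulo \<open>p\<close>.\<close>

lemma flow_hypertree:
  assumes "flow_on R P Q (\<lambda>i. 1 + p * int (g i)) (\<lambda>_. p) x" "\<And>i j. 0 \<le> x i j" "\<And>i. i \<notin> P \<Longrightarrow> g i = 0"
  shows "g \<in> ht P Q R"
proof -
  have "(\<Sum>i\<in>P. 1 + p * int (g i)) = (\<Sum>i\<in>P. \<Sum>j\<in>Q. x i j)" using assms(1) by (simp add: flow_on_def)
  also have "\<dots> = (\<Sum>j\<in>Q. \<Sum>i\<in>P. x i j)" by (rule sum.swap)
  also have "\<dots> = (\<Sum>j\<in>Q. p)" using assms(1) by (simp add: flow_on_def)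
  finally have "p + p * int (sum g P) = p * int (card Q)"
    by (simp add: sum.distrib mult.commute flip: sum_distrib_left)
  then have "p * (1 + int (sum g P)) = p * int (card Q)" by (simp add: algebra_simps)
  then have "1 + int (sum g P) = int (card Q)" using p_pos by simp
  then have tot: "sum g P + 1 = card Q" by linarith
  have "sum g S < card (R `` S)" if S: "S \<subseteq> P" "S \<noteq> {}" for S
  proof -
    have fin: "finite S" "R `` S \<subseteq> Q" using S finP R finite_subset by auto
    then have fin2: "finite (R `` S)" using finQ finite_subset by blast
    have "int (card S) + p * int (sum g S) = (\<Sum>i\<in>S. 1 + p * int (g i))"
      by (simp add: sum.distrib flip: sum_distrib_left)
    also have "\<dots> = (\<Sum>i\<in>S. \<Sum>j\<in>Q. x i j)" using assms(1) S by (intro sum.cong) (auto simp: flow_on_def)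
    also have "\<dots> = (\<Sum>i\<in>S. \<Sum>j\<in>R `` S. x i j)"
    proof (rule sum.cong[OF refl])
      fix i assume "i \<in> S"
      then have "x i j = 0" if "j \<in> Q - R `` S" for j
        using assms(1) that by (auto simp: flow_on_def)
      then show "(\<Sum>j\<in>Q. x i j) = (\<Sum>j\<in>R `` S. x i j)"
        using fin finQ by (intro sum.mono_neutral_right) auto
    qed
    also have "\<dots> = (\<Sum>j\<in>R `` S. \<Sum>i\<in>S. x i j)" by (rule sum.swap)
    also have "\<dots> \<le> (\<Sum>j\<in>R `` S. \<Sum>i\<in>P. x i j)"
      using assms(2) S finP by (intro sum_mono sum_mono2) auto
    also have "\<dots> = (\<Sum>j\<in>R `` S. p)" using assms(1) fin by (intro sum.cong) (auto simp: flow_on_def)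
    finally have "int (card S) + p * int (sum g S) \<le> p * int (card (R `` S))" by (simp add: mult.commute)
    \<comment> \<open>The extra units 1 of the rows in \<open>S\<close> turn the weak inequality
      into the strict one of \<open>ht\<close>.\<close>
    moreover have "card S > 0" using S fin by (simp add: card_gt_0_iff)
    ultimately have "p * int (sum g S) < p * int (card (R `` S))" by linarith
    then show ?thesis using p_pos by (simp del: of_nat_sum)
  qed
  then show ?thesis using tot assms(3) by (simp add: ht_def)
qed

lemma deg1_in_ht:
  assumes "leaf_tree P Q F" "F \<subseteq> R"
  shows "deg1 F \<in> ht P Q R"
proof -
  obtain x where x: "flow_on F P Q (\<lambda>i. 1 + p * int (deg1 F i)) (\<lambda>_. p) x" "\<And>i j. 0 \<le> x i j"
    using leaf_tree_deg1_flow[OF assms(1)] by metis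
  have "flow_on R P Q (\<lambda>i. 1 + p * int (deg1 F i)) (\<lambda>_. p) x"
    using x(1) assms(2) by (auto simp: flow_on_def)
  then show ?thesis using x(2) by (rule flow_hypertree) (simp add: deg1_def)
qed

text \<open>Equal degrees give two flows with equal margins, each of least cost by its own
  potential. Complementary slackness places both on the edges tight for one potential, where they
  differ by a circulation; so they coincide, and with them their supports.\<close>

lemma inj_on_deg1: "inj_on deg1 (opt_trees P Q R c)"
proof (rule inj_onI)
  fix F F' assume F: "F \<in> opt_trees P Q R c" and F': "F' \<in> opt_trees P Q R c" and eq: "deg1 F = deg1 F'"
  obtain x where x: "flow_on F P Q (\<lambda>i. 1 + p * int (deg1 F i)) (\<lambda>_. p) x"
    "\<And>i j. (i, j) \<in> F \<Longrightarrow> 1 \<le> x i j" "\<And>i j. 0 \<le> x i j" "\<And>i j. x i j \<le> p"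
    using leaf_tree_deg1_flow[OF opt_tree_leaf_tree[OF F]] by metis
  obtain x' where x': "flow_on F' P Q (\<lambda>i. 1 + p * int (deg1 F i)) (\<lambda>_. p) x'"
    "\<And>i j. (i, j) \<in> F' \<Longrightarrow> 1 \<le> x' i j" "\<And>i j. 0 \<le> x' i j" "\<And>i j. x' i j \<le> p"
    using leaf_tree_deg1_flow[OF opt_tree_leaf_tree[OF F']] eq by metis
  obtain u v where u: "F \<subseteq> R" "\<And>i j. (i, j) \<in> R \<Longrightarrow> u i + v j \<le> c (i, j)"
    "\<And>i j. (i, j) \<in> F \<Longrightarrow> u i + v j = c (i, j)" using F unfolding opt_trees_def by blast
  obtain u' v' where u': "F' \<subseteq> R" "\<And>i j. (i, j) \<in> R \<Longrightarrow> u' i + v' j \<le> c (i, j)"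
    "\<And>i j. (i, j) \<in> F' \<Longrightarrow> u' i + v' j = c (i, j)" using F' unfolding opt_trees_def by blast
  let ?a = "\<lambda>i. 1 + p * int (deg1 F i)"
  have fR: "flow_on R P Q ?a (\<lambda>_. p) x" "flow_on R P Q ?a (\<lambda>_. p) x'"
    using flow_on_mono x(1) x'(1) u(1) u'(1) by blast+
  have finR: "finite R" using finite_subset[OF R] finP finQ by simp
  have cost: "(\<Sum>(i, j)\<in>R. x i j * c (i, j)) = (\<Sum>(i, j)\<in>R. x i j * (u i + v j))"
    using flow_on_cong_weight[OF x(1), of "\<lambda>i j. c (i, j)" "\<lambda>i j. u i + v j"] u(3)
    by (intro sum.cong) auto
  \<comment> \<open>The second potential shows that \<open>x'\<close> costs at most as much as
    \<open>x\<close>, whose cost is the value of the first potential. Hence \<open>x'\<close> has no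
    slack against the first potential either.\<close>
  have "(\<Sum>(i, j)\<in>R. x' i j * c (i, j)) = (\<Sum>(i, j)\<in>R. x' i j * (u' i + v' j))"
    using flow_on_cong_weight[OF x'(1), of "\<lambda>i j. c (i, j)" "\<lambda>i j. u' i + v' j"] u'(3)
    by (intro sum.cong) auto
  also have "\<dots> = (\<Sum>(i, j)\<in>R. x i j * (u' i + v' j))"
    using flow_on_pairing[OF finP finQ R fR(1)] flow_on_pairing[OF finP finQ R fR(2)] by simp
  also have "\<dots> \<le> (\<Sum>(i, j)\<in>R. x i j * c (i, j))"
    using u'(2) x(3) by (intro sum_mono) (auto intro!: mult_left_mono)
  also have "\<dots> = (\<Sum>(i, j)\<in>R. x' i j * (u i + v j))"
    using cost flow_on_pairing[OF finP finQ R fR(1)] flow_on_pairing[OF finP finQ R fR(2)] by simp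
  finally have le: "(\<Sum>(i, j)\<in>R. x' i j * (c (i, j) - (u i + v j))) \<le> 0"
    by (simp add: right_diff_distrib case_prod_unfold sum_subtractf)
  have nn: "0 \<le> x' i j * (c (i, j) - (u i + v j))" if "(i, j) \<in> R" for i j
    using u(2)[OF that] x'(3)[of i j] by simp
  have "(\<Sum>(i, j)\<in>R. x' i j * (c (i, j) - (u i + v j))) = 0"
    using le nn by (intro antisym sum_nonneg) auto
  then have zero: "\<And>i j. (i, j) \<in> R \<Longrightarrow> x' i j * (c (i, j) - (u i + v j)) = 0"
    using sum_nonneg_eq_0_iff[OF finR, of "\<lambda>(i, j). x' i j * (c (i, j) - (u i + v j))"] nn by fast
  define G where "G = {(i, j) \<in> R. u i + v j = c (i, j)}"
  have G: "G \<subseteq> R" "\<And>i j. (i, j) \<in> G \<Longrightarrow> u i + v j = c (i, j)" by (auto simp: G_def)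
  have "flow_on G P Q ?a (\<lambda>_. p) x"
    by (rule flow_on_mono[OF x(1)]) (use u in \<open>auto simp: G_def\<close>)
  moreover have "x' i j = 0" if "(i, j) \<notin> G" for i j
    using that zero[of i j] fR(2) by (cases "(i, j) \<in> R") (auto simp: G_def flow_on_def)
  then have "flow_on G P Q ?a (\<lambda>_. p) x'" using fR(2) by (auto simp: flow_on_def)
  ultimately have "flow_on G P Q (\<lambda>i. 0) (\<lambda>j. 0) (\<lambda>i j. x i j - x' i j)"
    using flow_diff by fastforce
  moreover have "\<bar>x i j - x' i j\<bar> \<le> int (card P + card Q) + 3" for i j
    using x(3,4)[of i j] x'(3,4)[of i j] by linarith
  ultimately have "x i j - x' i j = 0" for i j
    using tight_circulation_zero[of G u v "\<lambda>i j. x i j - x' i j" i j] G by blast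
  then have eqx: "x i j = x' i j" for i j by (metis eq_iff_diff_eq_0)
  have "x i j = 0" if "(i, j) \<notin> F" for i j using x(1) that by (simp add: flow_on_def)
  moreover have "x' i j = 0" if "(i, j) \<notin> F'" for i j using x'(1) that by (simp add: flow_on_def)
  ultimately have "(i, j) \<in> F \<longleftrightarrow> (i, j) \<in> F'" for i j
    using x(2)[of i j] x'(2)[of i j] eqx[of i j] by fastforce
  then show "F = F'" by auto
qed

text \<open>Row sums that are 1 modulo \<open>p\<close> prevent the support of an optimal flow from
  falling apart: in a balanced union of components the number of rows is divisible by
  \<open>p\<close>. The resulting tree also carries the flow of its own degrees, and the two flows
  turn out to be equal.\<close>

lemma deg1_surj:
  assumes g: "g \<in> ht P Q R"
  obtains F where "F \<in> opt_trees P Q R c" "deg1 F = g"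
proof -
  have g0: "\<And>i. i \<notin> P \<Longrightarrow> g i = 0" and gt: "sum g P + 1 = card Q"
    and gS: "\<And>S. S \<subseteq> P \<Longrightarrow> S \<noteq> {} \<Longrightarrow> sum g S < card (R `` S)" using g by (auto simp: ht_def)
  let ?a = "\<lambda>i. card P * g i + 1" and ?b = "\<lambda>_ :: 'b. card P"
  have suma: "sum ?a S = card P * sum g S + card S" for S
    unfolding sum.distrib by (simp add: sum_distrib_left)
  have tot: "sum ?a P = sum ?b Q" unfolding suma by (simp flip: gt)
  have hall: "sum ?b T \<le> sum ?a (R\<inverse> `` T)" if T: "T \<subseteq> Q" for T
  proof -
    \<comment> \<open>Hall's condition is checked on the complement. The neighbours of
      \<open>S\<close> avoid \<open>T\<close>, and the \<open>card S\<close> extra units, at most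
      \<open>p\<close>, fit into the gap left by the strict inequality of \<open>ht\<close>.\<close>
    define S where "S = P - R\<inverse> `` T"
    have "R\<inverse> `` T \<subseteq> P" using R by auto
    then have split: "sum ?a (R\<inverse> `` T) + sum ?a S = sum ?a P"
      unfolding S_def using finP by (metis add.commute sum.subset_diff)
    have Q: "card (Q - T) + card T = card Q"
      using T finQ by (metis card_Diff_subset card_mono finite_subset le_add_diff_inverse2)
    have "sum ?a S \<le> card P * card (Q - T)"
    proof (cases "S = {}")
      case False
      have "S \<subseteq> P" by (auto simp: S_def)
      have "sum g S < card (R `` S)" using gS[OF \<open>S \<subseteq> P\<close> False] .
      also have "\<dots> \<le> card (Q - T)" using R finQ by (intro card_mono) (auto simp: S_def)
      finally have "card P * Suc (sum g S) \<le> card P * card (Q - T)" by (intro mult_le_mono2) simp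
      moreover have "card S \<le> card P" using \<open>S \<subseteq> P\<close> finP by (rule card_mono[rotated])
      ultimately show ?thesis unfolding suma by simp
    qed simp
    moreover have "sum ?a P = card P * card (Q - T) + card P * card T"
      unfolding tot by (simp flip: Q add: algebra_simps)
    ultimately show ?thesis using split by (simp add: mult.commute)
  qed
  obtain u v x where uv: "\<And>i j. (i, j) \<in> R \<Longrightarrow> u i + v j \<le> c (i, j)"
    and x0: "flow_on {(i, j) \<in> R. u i + v j = c (i, j)} P Q (int \<circ> ?a) (int \<circ> ?b) x"
    and xnn: "\<And>i j. 0 \<le> x i j"
    by (rule optimal_potential[of P Q R ?b ?a c, OF finP finQ R hall tot c_nonneg]; blast)
  define F where "F = {(i, j). x i j \<noteq> 0}"
  have FR: "F \<subseteq> R" "\<And>i j. (i, j) \<in> F \<Longrightarrow> u i + v j = c (i, j)"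
    using x0 by (auto simp: F_def flow_on_def)
  have FPQ: "F \<subseteq> P \<times> Q" using FR R by auto
  have x: "flow_on F P Q (\<lambda>i. 1 + p * int (g i)) (\<lambda>_. p) x"
    using x0 by (auto simp: F_def flow_on_def)
  have joined: "joined P Q F"
    unfolding joined_def
  proof (intro allI impI)
    fix S T assume S: "S \<subseteq> P" and T: "T \<subseteq> Q" and cl: "\<forall>(i, j)\<in>F. (i \<in> S) = (j \<in> T)"
    have "int (card S) + p * int (sum g S) = (\<Sum>i\<in>S. 1 + p * int (g i))"
      by (simp add: sum.distrib flip: sum_distrib_left)
    also have "\<dots> = (\<Sum>i\<in>S. \<Sum>j\<in>Q. x i j)" using x S by (intro sum.cong) (auto simp: flow_on_def)
    also have "\<dots> = (\<Sum>i\<in>S. \<Sum>j\<in>T. x i j)"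
      using T finQ cl by (intro sum.cong sum.mono_neutral_right) (auto simp: F_def)
    also have "\<dots> = (\<Sum>j\<in>T. \<Sum>i\<in>S. x i j)" by (rule sum.swap)
    also have "\<dots> = (\<Sum>j\<in>T. \<Sum>i\<in>P. x i j)"
      using S finP cl by (intro sum.cong sum.mono_neutral_left) (auto simp: F_def)
    also have "\<dots> = (\<Sum>j\<in>T. p)" using x T by (intro sum.cong) (auto simp: flow_on_def)
    finally have eq: "int (card S) + p * int (sum g S) = p * int (card T)" by (simp add: mult.commute)
    have Sle: "card S \<le> card P" using S finP by (rule card_mono[rotated])
    have "int (card S) = p * (int (card T) - int (sum g S))" using eq by (simp add: algebra_simps)
    then have dvd: "card P dvd card S" by (metis dvd_triv_left int_dvd_int_iff)
    have finT: "finite T" "finite S" using T S finP finQ finite_subset by auto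
    show "S = {} \<and> T = {} \<or> S = P \<and> T = Q"
    proof (cases "S = {}")
      case True
      then have "p * int (card T) = 0" using eq by simp
      then show ?thesis using True p_pos finT by simp
    next
      case False
      then have "card S > 0" using finT by (simp add: card_gt_0_iff)
      then have "card S = card P" using dvd Sle dvd_imp_le by fastforce
      then have SP: "S = P" using S finP card_subset_eq by blast
      have "p * int (card T) = p * int (card Q)" using eq by (simp add: SP algebra_simps flip: gt)
      then have "card T = card Q" using p_pos by simp
      then show ?thesis using SP T finQ card_subset_eq by blast
    qed
  qed
  have Fopt: "F \<in> opt_trees P Q R c" using FR joined uv by (auto simp: opt_trees_def)
  obtain y where y: "flow_on F P Q (\<lambda>i. 1 + p * int (deg1 F i)) (\<lambda>_. p) y"
    "\<And>i j. (i, j) \<in> F \<Longrightarrow> 1 \<le> y i j" "\<And>i j. 0 \<le> y i j" "\<And>i j. y i j \<le> p"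
    using leaf_tree_deg1_flow[OF opt_tree_leaf_tree[OF Fopt]] by metis
  have xle: "x i j \<le> p" if "(i, j) \<in> F" for i j
  proof -
    have "i \<in> P" "j \<in> Q" using that FPQ by auto
    then have "x i j \<le> (\<Sum>i\<in>P. x i j)" using xnn finP by (intro member_le_sum) auto
    then show ?thesis using x \<open>j \<in> Q\<close> by (simp add: flow_on_def)
  qed
  have dvd: "p dvd x i j - y i j" for i j
    by (rule leaf_tree_flow_dvd[OF opt_tree_leaf_tree[OF Fopt] flow_diff[OF x y(1)]]) auto
  have xy: "x i j = y i j" for i j
  proof (cases "(i, j) \<in> F")
    case True
    have "1 \<le> x i j" using True xnn[of i j] by (auto simp: F_def)
    \<comment> \<open>Both entries lie between 1 and \<open>p\<close>, so that congruence modulo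
      \<open>p\<close> becomes equality.\<close>
    then have "\<bar>x i j - y i j\<bar> < p" using xle[OF True] y(2)[OF True] y(4)[of i j] by linarith
    then have "x i j - y i j = 0" using dvd[of i j] by (metis abs_ge_zero dvd_abs_iff dvd_imp_le_int linorder_not_le abs_of_nat)
    then show ?thesis by simp
  qed (use x y in \<open>auto simp: flow_on_def\<close>)
  have "deg1 F i = g i" for i
  proof (cases "i \<in> P")
    case True
    have "(\<Sum>j\<in>Q. x i j) = (\<Sum>j\<in>Q. y i j)" using xy by simp
    moreover have "(\<Sum>j\<in>Q. x i j) = 1 + p * int (g i)" using True x by (simp add: flow_on_def)
    moreover have "(\<Sum>j\<in>Q. y i j) = 1 + p * int (deg1 F i)" using True y(1) by (simp add: flow_on_def)
    ultimately have "p * int (deg1 F i) = p * int (g i)" by linarith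
    then show ?thesis using p_pos by simp
  qed (simp add: g0 deg1_def)
  then show thesis using that Fopt by blast
qed

lemma card_ht: "card (ht P Q R) = card (opt_trees P Q R c)"
proof -
  have "deg1 ` opt_trees P Q R c = ht P Q R"
  proof (intro equalityI subsetI)
    fix g assume "g \<in> deg1 ` opt_trees P Q R c"
    then obtain F where F: "F \<in> opt_trees P Q R c" "g = deg1 F" by blast
    moreover have "F \<subseteq> R" using F(1) by (simp add: opt_trees_def)
    ultimately show "g \<in> ht P Q R" using deg1_in_ht opt_tree_leaf_tree by blast
  next
    fix g assume "g \<in> ht P Q R"
    then show "g \<in> deg1 ` opt_trees P Q R c" by (rule deg1_surj) blast
  qed
  then show ?thesis using inj_on_deg1 card_image by metis
qed

end

section \<open>Exchanging the two sides\<close>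

lemma opt_trees_converse:
  "F \<in> opt_trees P Q R c \<Longrightarrow> F\<inverse> \<in> opt_trees Q P (R\<inverse>) (\<lambda>(j, i). c (i, j))"
proof -
  assume "F \<in> opt_trees P Q R c"
  then obtain u v where F: "F \<subseteq> R" "joined P Q F" "\<And>i j. (i, j) \<in> R \<Longrightarrow> u i + v j \<le> c (i, j)"
    "\<And>i j. (i, j) \<in> F \<Longrightarrow> u i + v j = c (i, j)" unfolding opt_trees_def by blast
  have "joined Q P (F\<inverse>)"
    unfolding joined_def
  proof (intro allI impI)
    fix T S assume "T \<subseteq> Q" "S \<subseteq> P" "\<forall>(j, i)\<in>F\<inverse>. (j \<in> T) = (i \<in> S)"
    moreover from this have "\<forall>(i, j)\<in>F. (i \<in> S) = (j \<in> T)" by auto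
    ultimately show "T = {} \<and> S = {} \<or> T = Q \<and> S = P" using F(2) unfolding joined_def by blast
  qed
  moreover have "\<forall>j i. (j, i) \<in> R\<inverse> \<longrightarrow> v j + u i \<le> (\<lambda>(j, i). c (i, j)) (j, i)"
    "\<forall>j i. (j, i) \<in> F\<inverse> \<longrightarrow> v j + u i = (\<lambda>(j, i). c (i, j)) (j, i)"
    using F(3,4) by (simp_all add: add.commute)
  moreover have "F\<inverse> \<subseteq> R\<inverse>" using F(1) by auto
  ultimately show ?thesis unfolding opt_trees_def by blast
qed

lemma generic_bipartite_exists:
  assumes "finite P" "finite Q" "P \<noteq> {}" "Q \<noteq> {}" "R \<subseteq> P \<times> Q"
  obtains c where "generic_bipartite P Q R c"
proof -
  have "finite R" using finite_subset[OF assms(5)] assms(1,2) by simp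
  then obtain c where c: "\<And>e. (0::int) \<le> c e" "\<And>z. (\<forall>e\<in>R. \<bar>z e\<bar> \<le> int (card P + card Q) + 3) \<Longrightarrow>
      (\<Sum>e\<in>R. z e * c e) = 0 \<Longrightarrow> (\<forall>e\<in>R. z e = 0)"
    using bounded_generic_cost[of R "int (card P + card Q) + 3"] by blast
  have "generic_bipartite P Q R c"
  proof
    fix z :: "'a \<times> 'b \<Rightarrow> int" and e
    assume "\<And>e. e \<in> R \<Longrightarrow> \<bar>z e\<bar> \<le> int (card P + card Q) + 3" "(\<Sum>e\<in>R. z e * c e) = 0" "e \<in> R"
    then show "z e = 0" using c(2)[of z] by blast
  qed (fact assms c(1))+
  then show thesis by (rule that)
qed

text \<open>One cost serves both sides: transposition maps optimal trees to optimal trees, and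
  degrees are read off on the left before it and on the former right side after it.\<close>

theorem card_ht_converse:
  assumes "finite P" "finite Q" "P \<noteq> {}" "Q \<noteq> {}" "R \<subseteq> P \<times> Q"
  shows "card (ht P Q R) = card (ht Q P (R\<inverse>))"
proof -
  obtain c where "generic_bipartite P Q R c" using generic_bipartite_exists[OF assms] .
  then interpret A: generic_bipartite P Q R c .
  let ?d = "\<lambda>(j, i). c (i, j)"
  interpret B: generic_bipartite Q P "R\<inverse>" ?d
  proof
    fix z :: "'b \<times> 'a \<Rightarrow> int" and e
    assume z: "\<And>e. e \<in> R\<inverse> \<Longrightarrow> \<bar>z e\<bar> \<le> int (card Q + card P) + 3"
      and s: "(\<Sum>e\<in>R\<inverse>. z e * ?d e) = 0" and e: "e \<in> R\<inverse>"
    have eq: "(\<Sum>e\<in>R. z (prod.swap e) * c e) = (\<Sum>e\<in>R\<inverse>. z e * ?d e)"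
      by (rule sum.reindex_bij_witness[of _ prod.swap prod.swap]) auto
    have bd: "\<bar>z (prod.swap e)\<bar> \<le> int (card P + card Q) + 3" if "e \<in> R" for e
      using z[of "prod.swap e"] that by (cases e) simp
    have "\<forall>e\<in>R. z (prod.swap e) = 0"
    proof
      fix e assume "e \<in> R"
      show "z (prod.swap e) = 0"
        by (rule A.generic[of "\<lambda>e. z (prod.swap e)", OF bd _ \<open>e \<in> R\<close>]) (use eq s in argo)+
    qed
    moreover obtain i j where "e = (j, i)" "(i, j) \<in> R" using e by auto
    ultimately show "z e = 0" using bspec[of R "\<lambda>e. z (prod.swap e) = 0" "(i, j)"] by simp
  qed (use assms A.c_nonneg in auto)
  have "bij_betw converse (opt_trees P Q R c) (opt_trees Q P (R\<inverse>) ?d)"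
  proof (rule bij_betw_byWitness[where f' = converse])
    show "converse ` opt_trees P Q R c \<subseteq> opt_trees Q P (R\<inverse>) ?d"
      using opt_trees_converse[of _ P Q R c] by blast
    have "F\<inverse> \<in> opt_trees P Q R c" if "F \<in> opt_trees Q P (R\<inverse>) ?d" for F
      using opt_trees_converse[OF that] by (simp add: case_prod_unfold)
    then show "converse ` opt_trees Q P (R\<inverse>) ?d \<subseteq> opt_trees P Q R c" by blast
  qed simp_all
  from bij_betw_same_card[OF this] show ?thesis using A.card_ht B.card_ht by simp
qed


subsection \<open>Independent vectors\<close>

definition indep :: "'a set \<Rightarrow> ('a \<times> 'b) set \<Rightarrow> ('a \<Rightarrow> nat) set" where
  "indep A R = {g. (\<forall>i. i \<notin> A \<longrightarrow> g i = 0) \<and> (\<forall>S\<subseteq>A. sum g S \<le> card (R `` S))}"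

lemma indepD: "g \<in> indep A R \<Longrightarrow> S \<subseteq> A \<Longrightarrow> sum g S \<le> card (R `` S)"
  by (simp add: indep_def)

lemma finite_indep:
  assumes "finite A" "finite B" "R \<subseteq> A \<times> B"
  shows "finite (indep A R)"
proof (rule finite_subset)
  show "indep A R \<subseteq> {g. \<forall>i. (i \<in> A \<longrightarrow> g i \<in> {..card B}) \<and> (i \<notin> A \<longrightarrow> g i = 0)}"
  proof (intro subsetI CollectI allI conjI impI)
    fix g i assume g: "g \<in> indep A R"
    show "g i = 0" if "i \<notin> A" using g that by (simp add: indep_def)
    assume "i \<in> A"
    then have "sum g {i} \<le> card (R `` {i})" using g by (simp add: indep_def del: sum.insert)
    also have "\<dots> \<le> card B" using assms by (intro card_mono) auto
    finally show "g i \<in> {..card B}" by simp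
  qed
qed (use assms in \<open>intro finite_set_of_finite_funs; simp\<close>)

definition apex :: "'a set \<Rightarrow> 'b set \<Rightarrow> ('a \<times> 'b) set \<Rightarrow> ('a option \<times> 'b option) set" where
  "apex A B R = (\<lambda>(i, j). (Some i, Some j)) ` R \<union> {None} \<times> insert None (Some ` B) \<union> insert None (Some ` A) \<times> {None}"

lemma apex_iff:
  "(Some i, Some j) \<in> apex A B R \<longleftrightarrow> (i, j) \<in> R"
  "(None, y) \<in> apex A B R \<longleftrightarrow> y \<in> insert None (Some ` B)"
  "(x, None) \<in> apex A B R \<longleftrightarrow> x \<in> insert None (Some ` A)"
  by (auto simp: apex_def)

lemma apex_subset: "R \<subseteq> A \<times> B \<Longrightarrow> apex A B R \<subseteq> insert None (Some ` A) \<times> insert None (Some ` B)"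
  unfolding apex_def by auto

lemma converse_apex: "(apex A B R)\<inverse> = apex B A (R\<inverse>)"
  by (auto simp: apex_def)

lemma sum_option:
  assumes "finite A"
  shows "sum h (insert None (Some ` A)) = h None + (\<Sum>i\<in>A. h (Some i))"
  using assms by (simp add: sum.reindex)

lemma subset_option_cases:
  assumes "S \<subseteq> insert None (Some ` A)"
  obtains S' where "S' \<subseteq> A" "S = Some ` S'" | S' where "S' \<subseteq> A" "S = insert None (Some ` S')"
proof -
  let ?S' = "{i \<in> A. Some i \<in> S}"
  show thesis
  proof (cases "None \<in> S")
    case True
    then have "S = insert None (Some ` ?S')" using assms by auto
    then show thesis using that(2)[of ?S'] by blast
  next
    case False
    then have "S = Some ` ?S'" using assms by auto
    then show thesis using that(1)[of ?S'] by blast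
  qed
qed

text \<open>The universal vertex on the left absorbs the rest \<open>card B - sum g A\<close>; the
  one on the right enlarges each nonempty neighbourhood by one, which turns the strict inequalities
  of \<open>ht\<close> into weak ones.\<close>

lemma card_indep_eq_ht:
  assumes "finite A" "finite B" "R \<subseteq> A \<times> B"
  shows "card (indep A R) = card (ht (insert None (Some ` A)) (insert None (Some ` B)) (apex A B R))"
proof -
  let ?P = "insert None (Some ` A)" and ?Q = "insert None (Some ` B)"
  define ext where "ext g = case_option (card B - sum g A) g" for g :: "'a \<Rightarrow> nat"
  have cQ: "card ?Q = Suc (card B)" using assms(2) by (simp add: card_image)
  have RB: "finite (R `` S)" "R `` S \<subseteq> B" for S using assms finite_subset[of "R `` S" B] by auto
  have img: "card (apex A B R `` (Some ` S)) = Suc (card (R `` S))" if "S \<subseteq> A" "S \<noteq> {}" for S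
  proof -
    have "apex A B R `` (Some ` S) = insert None (Some ` (R `` S))"
    proof (rule set_eqI)
      fix y show "y \<in> apex A B R `` (Some ` S) \<longleftrightarrow> y \<in> insert None (Some ` (R `` S))"
        by (cases y) (use that in \<open>auto simp: Image_iff apex_iff\<close>)
    qed
    then show ?thesis using RB[of S] by (simp add: card_image)
  qed
  have imgN: "apex A B R `` (insert None S) = ?Q" if "S \<subseteq> ?P" for S
  proof
    show "apex A B R `` (insert None S) \<subseteq> ?Q" using apex_subset[OF assms(3)] by blast
    show "?Q \<subseteq> apex A B R `` (insert None S)"
    proof
      fix y assume "y \<in> ?Q"
      then have "(None, y) \<in> apex A B R" by (simp add: apex_iff)
      then show "y \<in> apex A B R `` (insert None S)" by blast
    qed
  qed
  have "bij_betw ext (indep A R) (ht ?P ?Q (apex A B R))"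
  proof (rule bij_betw_byWitness[where f' = "\<lambda>h. h \<circ> Some"])
    show "\<forall>g\<in>indep A R. ext g \<circ> Some = g" by (auto simp: ext_def)
    show "\<forall>h\<in>ht ?P ?Q (apex A B R). ext (h \<circ> Some) = h"
    proof
      fix h assume "h \<in> ht ?P ?Q (apex A B R)"
      then have "h None + (\<Sum>i\<in>A. h (Some i)) = card B"
        using cQ sum_option[OF assms(1), of h] by (simp add: ht_def)
      then show "ext (h \<circ> Some) = h" by (auto simp: ext_def fun_eq_iff split: option.split)
    qed
    show "ext ` indep A R \<subseteq> ht ?P ?Q (apex A B R)"
    proof (intro image_subsetI)
      fix g assume g: "g \<in> indep A R"
      have "sum g A \<le> card (R `` A)" using g by (simp add: indep_def)
      also have "\<dots> \<le> card B" using RB assms(2) by (intro card_mono)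
      finally have tot: "sum (ext g) ?P = card B" using sum_option[OF assms(1), of "ext g"] by (simp add: ext_def)
      have "sum (ext g) S < card (apex A B R `` S)" if S: "S \<subseteq> ?P" "S \<noteq> {}" for S
        using S(1)
      proof (cases rule: subset_option_cases)
        case (1 S')
        have "sum (ext g) S = sum g S'" by (simp add: 1 sum.reindex ext_def)
        also have "\<dots> \<le> card (R `` S')" using g 1 by (simp add: indep_def)
        finally show ?thesis using img[of S'] 1 S(2) by auto
      next
        case (2 S')
        have "sum (ext g) S \<le> sum (ext g) ?P" using S assms(1) by (intro sum_mono2) auto
        moreover have "apex A B R `` S = ?Q" using imgN[of "Some ` S'"] 2 by auto
        ultimately show ?thesis using tot cQ by simp
      qed
      moreover have "ext g i = 0" if "i \<notin> ?P" for i
        using that g by (cases i) (auto simp: ext_def indep_def)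
      ultimately show "ext g \<in> ht ?P ?Q (apex A B R)" using tot cQ by (simp add: ht_def)
    qed
    show "(\<lambda>h. h \<circ> Some) ` ht ?P ?Q (apex A B R) \<subseteq> indep A R"
    proof (intro image_subsetI)
      fix h assume h: "h \<in> ht ?P ?Q (apex A B R)"
      then have hS: "\<And>S. S \<subseteq> ?P \<Longrightarrow> S \<noteq> {} \<Longrightarrow> sum h S < card (apex A B R `` S)"
        and h0: "\<And>i. i \<notin> ?P \<Longrightarrow> h i = 0" unfolding ht_def by blast+
      have "sum (h \<circ> Some) S \<le> card (R `` S)" if S: "S \<subseteq> A" for S
      proof (cases "S = {}")
        case False
        have "sum h (Some ` S) < card (apex A B R `` (Some ` S))"
          using hS[of "Some ` S"] S False by blast
        then show ?thesis using img[OF S False] by (simp add: sum.reindex)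
      qed simp
      moreover have "(h \<circ> Some) i = 0" if "i \<notin> A" for i using h0[of "Some i"] that by auto
      ultimately show "h \<circ> Some \<in> indep A R" by (simp add: indep_def)
    qed
  qed
  then show ?thesis by (rule bij_betw_same_card)
qed

theorem card_indep_converse:
  assumes "finite A" "finite B" "R \<subseteq> A \<times> B"
  shows "card (indep A R) = card (indep B (R\<inverse>))"
proof -
  note apex_subset[OF assms(3)]
  moreover have "R\<inverse> \<subseteq> B \<times> A" using assms(3) by auto
  ultimately show ?thesis
    using card_indep_eq_ht[OF assms] card_indep_eq_ht[of B A "R\<inverse>"] assms(1,2)
      card_ht_converse[of "insert None (Some ` A)" "insert None (Some ` B)" "apex A B R"]
    by (simp add: converse_apex)
qed

section \<open>Generating functions and weak compositions counted by length\<close>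

definition gf :: "('c \<Rightarrow> nat) \<Rightarrow> 'c set \<Rightarrow> real fps" where
  "gf \<kappa> X = Abs_fps (\<lambda>k. real (card {x \<in> X. \<kappa> x = k}))"

text \<open>A function on \<open>insert a I\<close> is a value at \<open>a\<close> together with a
  function on \<open>I\<close>, so the coefficients convolve. Finiteness of the level sets is
  carried through the induction because \<open>card\<close> is 0 on infinite sets.\<close>

lemma gf_PiE:
  assumes "finite I" "\<And>i k. i \<in> I \<Longrightarrow> finite {x \<in> X i. \<kappa> i x = k}"
  shows "finite {f \<in> PiE I X. (\<Sum>i\<in>I. \<kappa> i (f i)) = k}"
    and "gf (\<lambda>f. \<Sum>i\<in>I. \<kappa> i (f i)) (PiE I X) = (\<Prod>i\<in>I. gf (\<kappa> i) (X i))"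
proof -
  have "(\<forall>k. finite {f \<in> PiE I X. (\<Sum>i\<in>I. \<kappa> i (f i)) = k}) \<and>
    gf (\<lambda>f. \<Sum>i\<in>I. \<kappa> i (f i)) (PiE I X) = (\<Prod>i\<in>I. gf (\<kappa> i) (X i))"
    using assms
  proof (induction rule: finite_induct)
    case empty
    have "{f \<in> PiE {} X. (\<Sum>i\<in>{}. \<kappa> i (f i)) = k} = (if k = 0 then {\<lambda>_. undefined} else {})" for k
      by auto
    then show ?case by (auto simp: gf_def fps_eq_iff)
  next
    case (insert a I)
    let ?F = "\<lambda>k. {f \<in> PiE I X. (\<Sum>i\<in>I. \<kappa> i (f i)) = k}"
    let ?E = "\<lambda>k. {x \<in> X a. \<kappa> a x = k}"
    let ?c = "\<lambda>(y, g). g(a := y)"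
    have IH: "finite (?F k)" "gf (\<lambda>f. \<Sum>i\<in>I. \<kappa> i (f i)) (PiE I X) = (\<Prod>i\<in>I. gf (\<kappa> i) (X i))" for k
      using insert by auto
    have inj: "inj_on ?c (X a \<times> PiE I X)" by (rule inj_combinator) (use insert in simp)
    have upd: "(\<Sum>i\<in>I. \<kappa> i ((g(a := y)) i)) = (\<Sum>i\<in>I. \<kappa> i (g i))" for g y
      using insert by (intro sum.cong) auto
    have eq: "{f \<in> PiE (insert a I) X. (\<Sum>i\<in>insert a I. \<kappa> i (f i)) = k} =
        ?c ` (\<Union>j\<in>{0..k}. ?E j \<times> ?F (k - j))" (is "?L = _") for k
    proof
      show "?L \<subseteq> ?c ` (\<Union>j\<in>{0..k}. ?E j \<times> ?F (k - j))"
      proof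
        fix f assume f: "f \<in> ?L"
        then obtain y g where yg: "y \<in> X a" "g \<in> PiE I X" "f = g(a := y)"
          by (auto simp: PiE_insert_eq)
        then have "\<kappa> a y + (\<Sum>i\<in>I. \<kappa> i (g i)) = k" using f insert upd by simp
        then have "(y, g) \<in> (\<Union>j\<in>{0..k}. ?E j \<times> ?F (k - j))" using yg by auto
        then show "f \<in> ?c ` (\<Union>j\<in>{0..k}. ?E j \<times> ?F (k - j))" using yg by force
      qed
      show "?c ` (\<Union>j\<in>{0..k}. ?E j \<times> ?F (k - j)) \<subseteq> ?L"
        using insert upd by (auto simp: PiE_insert_eq)
    qed
    have finE: "finite (?E j \<times> ?F (k - j))" for j k using insert IH by simp
    have "card {f \<in> PiE (insert a I) X. (\<Sum>i\<in>insert a I. \<kappa> i (f i)) = k} =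
      (\<Sum>j=0..k. card (?E j) * card (?F (k - j)))" for k
    proof -
      have "card {f \<in> PiE (insert a I) X. (\<Sum>i\<in>insert a I. \<kappa> i (f i)) = k} =
          card (\<Union>j\<in>{0..k}. ?E j \<times> ?F (k - j))"
        unfolding eq by (rule card_image) (rule inj_on_subset[OF inj], auto)
      also have "\<dots> = (\<Sum>j=0..k. card (?E j \<times> ?F (k - j)))"
        by (rule card_UN_disjoint) (use finE in auto)
      finally show ?thesis by (simp add: card_cartesian_product)
    qed
    then have "gf (\<lambda>f. \<Sum>i\<in>insert a I. \<kappa> i (f i)) (PiE (insert a I) X) =
        gf (\<kappa> a) (X a) * gf (\<lambda>f. \<Sum>i\<in>I. \<kappa> i (f i)) (PiE I X)"
      by (simp add: gf_def fps_eq_iff fps_mult_nth)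
    moreover have "finite {f \<in> PiE (insert a I) X. (\<Sum>i\<in>insert a I. \<kappa> i (f i)) = k}" for k
      unfolding eq using finE by blast
    ultimately show ?case using insert IH by simp
  qed
  then show "finite {f \<in> PiE I X. (\<Sum>i\<in>I. \<kappa> i (f i)) = k}"
    "gf (\<lambda>f. \<Sum>i\<in>I. \<kappa> i (f i)) (PiE I X) = (\<Prod>i\<in>I. gf (\<kappa> i) (X i))" by blast+
qed

lemma gf_nat: "gf (\<lambda>n. n) UNIV * (1 - fps_X) = 1"
  by (rule fps_ext) (simp add: gf_def right_diff_distrib)

text \<open>A list of length \<open>m\<close> spreads the value \<open>n\<close> over
  \<open>m\<close> copies of a vertex; the variable of the series marks the number of
  copies.\<close>

definition lists_gf :: "nat \<Rightarrow> real fps" where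
  "lists_gf n = gf length {l. sum_list l = n}"

lemma lists_gf_nth: "fps_nth (lists_gf n) m = real ((n + m - 1) choose n)"
proof -
  have "{l \<in> {l. sum_list l = n}. length l = m} = {l :: nat list. size l = m \<and> sum_list l = n}" by auto
  then show ?thesis by (simp add: lists_gf_def gf_def card_length_sum_list)
qed

lemma lists_gf_0: "lists_gf 0 * (1 - fps_X) = 1"
  by (rule fps_ext) (simp add: lists_gf_nth right_diff_distrib)

text \<open>Pascal's rule. The case \<open>n = 0\<close> is exceptional because the empty list has
  sum 0, while no list of length 0 has a positive sum.\<close>

lemma lists_gf_Suc: "lists_gf (Suc n) * (1 - fps_X) = (if n = 0 then fps_X * lists_gf 0 else lists_gf n)"
proof (rule fps_ext)
  fix m
  show "fps_nth (lists_gf (Suc n) * (1 - fps_X)) m = fps_nth (if n = 0 then fps_X * lists_gf 0 else lists_gf n) m"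
    by (cases m; cases n) (auto simp: right_diff_distrib lists_gf_nth)
qed

text \<open>A positive value needs at least one copy, hence the numerator \<open>fps_X\<close> for
  \<open>n > 0\<close>. This is how the size of the support enters the numerator of the packing
  series.\<close>

lemma lists_gf_mult: "lists_gf n * (1 - fps_X) ^ (n + 1) = (if n = 0 then 1 else fps_X)"
proof (induction n)
  case 0
  then show ?case by (simp add: lists_gf_0)
next
  case (Suc n)
  have "lists_gf (Suc n) * (1 - fps_X) ^ (Suc n + 1) = (lists_gf (Suc n) * (1 - fps_X)) * (1 - fps_X) ^ (n + 1)"
    by (simp add: algebra_simps)
  also have "\<dots> = fps_X"
    unfolding lists_gf_Suc using Suc by (auto simp: mult.assoc lists_gf_0)
  finally show ?case by simp
qed

text \<open>The next term supplies exactly the missing part, since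
  \<open>(1 - x) + x = 1\<close>.\<close>

lemma sum_lists_gf: "(\<Sum>h\<le>n. lists_gf h) * (1 - fps_X) ^ (n + 1) = 1"
proof (induction n)
  case 0
  then show ?case by (simp add: lists_gf_0)
next
  case (Suc n)
  have "(\<Sum>h\<le>Suc n. lists_gf h) * (1 - fps_X) ^ (Suc n + 1) =
     ((\<Sum>h\<le>n. lists_gf h) * (1 - fps_X) ^ (n + 1)) * (1 - fps_X) + lists_gf (Suc n) * (1 - fps_X) ^ (Suc n + 1)"
    by (simp add: algebra_simps)
  also have "\<dots> = 1" unfolding Suc lists_gf_mult by simp
  finally show ?case .
qed


subsection \<open>Counting packings by blowing up vertices\<close>

definition supplies :: "'a set \<Rightarrow> nat \<Rightarrow> ('a \<Rightarrow> nat) set" where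
  "supplies P k = {y. (\<forall>i. i \<notin> P \<longrightarrow> y i = 0) \<and> sum y P = k}"

text \<open>Hall's condition: by \<open>supply_demand\<close> these are the vectors on
  \<open>B\<close> that the supply \<open>y\<close> can serve along \<open>C\<close>.\<close>

definition demands :: "'b set \<Rightarrow> ('a \<times> 'b) set \<Rightarrow> ('a \<Rightarrow> nat) \<Rightarrow> ('b \<Rightarrow> nat) set" where
  "demands B C y = {b. (\<forall>j. j \<notin> B \<longrightarrow> b j = 0) \<and> (\<forall>T\<subseteq>B. sum b T \<le> sum y (C\<inverse> `` T))}"

definition copies :: "'a set \<Rightarrow> ('a \<Rightarrow> nat) \<Rightarrow> ('a \<times> nat) set" where
  "copies S y = (SIGMA i:S. {..<y i})"

definition blowup :: "('a \<times> 'b) set \<Rightarrow> ('a \<Rightarrow> nat) \<Rightarrow> (('a \<times> nat) \<times> 'b) set" where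
  "blowup C y = {((i, r), j) |i r j. (i, j) \<in> C \<and> r < y i}"

lemma sum_copies: "finite S \<Longrightarrow> sum g (copies S y) = (\<Sum>i\<in>S. \<Sum>r<y i. g (i, r))"
  by (simp add: copies_def sum.Sigma)

lemma finite_supplies:
  assumes "finite P"
  shows "finite (supplies P k)"
proof (rule finite_subset)
  show "supplies P k \<subseteq> {y. \<forall>i. (i \<in> P \<longrightarrow> y i \<in> {..k}) \<and> (i \<notin> P \<longrightarrow> y i = 0)}"
    using assms by (auto simp: supplies_def intro: member_le_sum)
qed (use assms in \<open>intro finite_set_of_finite_funs; simp\<close>)

text \<open>With \<open>y i\<close> twins in place of vertex \<open>i\<close>, the supply available
  to \<open>T\<close> is the number of neighbours of \<open>T\<close>. Supplies thus reduce to the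
  unweighted setting in which duality holds.\<close>

lemma demands_eq_indep:
  assumes "finite P" "finite B" "C \<subseteq> P \<times> B"
  shows "demands B C y = indep B ((blowup C y)\<inverse>)"
proof -
  have "card ((blowup C y)\<inverse> `` T) = sum y (C\<inverse> `` T)" for T
  proof -
    have "(blowup C y)\<inverse> `` T = copies (C\<inverse> `` T) y" by (auto simp: blowup_def copies_def)
    moreover have "finite (C\<inverse> `` T)" using assms finite_subset[of "C\<inverse> `` T" P] by blast
    ultimately show ?thesis by (simp add: copies_def)
  qed
  then show ?thesis by (simp add: demands_def indep_def)
qed

lemma blowup_subset: "C \<subseteq> P \<times> B \<Longrightarrow> blowup C y \<subseteq> copies P y \<times> B"
  by (auto simp: blowup_def copies_def)

lemma sum_list_map_upt: "sum_list (map f [0..<n]) = (\<Sum>r<n. f r :: nat)"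
  by (simp add: interv_sum_list_conv_sum_set_nat atLeast0LessThan)

text \<open>Twins have the same neighbours, so only the total over the twins of each vertex is
  constrained. A vector on the twins is therefore a family of lists: \<open>y\<close> gives the
  lengths, and the list sums form an independent vector of \<open>C\<close>.\<close>

lemma indep_blowup_bij:
  assumes "finite P" "finite B" "C \<subseteq> P \<times> B"
  shows "bij_betw (\<lambda>(y, g). \<lambda>i\<in>P. map (\<lambda>r. g (i, r)) [0..<y i])
     (SIGMA y:supplies P k. indep (copies P y) (blowup C y))
     {L \<in> extensional P. (\<Sum>i\<in>P. length (L i)) = k \<and> (\<lambda>i. if i \<in> P then sum_list (L i) else 0) \<in> indep P C}"
    (is "bij_betw ?f ?X ?Y")
proof -
  define f' where "f' L = (\<lambda>i. if i \<in> P then length (L i) else 0,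
      \<lambda>(i, r). if i \<in> P \<and> r < length (L i) then L i ! r else 0)" for L :: "'a \<Rightarrow> nat list"
  show ?thesis
  proof (rule bij_betw_byWitness[where f' = f'], goal_cases)
    case 1
    have "f' (?f (y, g)) = (y, g)" if y: "y \<in> supplies P k" and g: "g \<in> indep (copies P y) (blowup C y)" for y g
    proof -
      have "y i = 0" if "i \<notin> P" for i using y that by (simp add: supplies_def)
      moreover have "g (i, r) = 0" if "\<not> (i \<in> P \<and> r < y i)" for i r
        using g that by (auto simp: indep_def copies_def)
      ultimately show ?thesis by (auto simp: f'_def fun_eq_iff)
    qed
    then show ?case by blast
  next
    case 2
    show ?case
    proof
      fix L :: "'a \<Rightarrow> nat list" assume "L \<in> ?Y"
      then have "L \<in> extensional P" by blast
      then show "?f (f' L) = L"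
        by (intro ext) (auto simp: f'_def extensional_def intro!: nth_equalityI)
    qed
  next
    case 3
    show ?case
    proof (intro image_subsetI)
      fix t assume "t \<in> ?X"
      then obtain y g where t: "t = (y, g)" and y: "y \<in> supplies P k"
        and g: "g \<in> indep (copies P y) (blowup C y)" by blast
      let ?L = "\<lambda>i\<in>P. map (\<lambda>r. g (i, r)) [0..<y i]"
      have "sum (\<lambda>i. if i \<in> P then sum_list (?L i) else 0) S \<le> card (C `` S)" if S: "S \<subseteq> P" for S
      proof -
        have finS: "finite S" using S assms(1) finite_subset by blast
        have "sum (\<lambda>i. if i \<in> P then sum_list (?L i) else 0) S = (\<Sum>i\<in>S. \<Sum>r<y i. g (i, r))"
          using S by (intro sum.cong) (auto simp: sum_list_map_upt)
        also have "\<dots> = sum g (copies S y)" using sum_copies[OF finS, of g y] by simp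
        also have "\<dots> \<le> card (blowup C y `` (copies S y))"
          by (rule indepD[OF g]) (use S in \<open>auto simp: copies_def\<close>)
        also have "\<dots> \<le> card (C `` S)"
        proof (rule card_mono)
          show "finite (C `` S)" using assms finite_subset[of "C `` S" B] by blast
        qed (auto simp: blowup_def copies_def)
        finally show ?thesis .
      qed
      moreover have "(\<Sum>i\<in>P. length (?L i)) = k" using y by (simp add: supplies_def)
      ultimately show "?f t \<in> ?Y" unfolding t by (simp add: indep_def)
    qed
  next
    case 4
    show ?case
    proof (intro image_subsetI)
      fix L :: "'a \<Rightarrow> nat list" assume L: "L \<in> ?Y"
      let ?y = "\<lambda>i. if i \<in> P then length (L i) else 0"
      let ?g = "\<lambda>(i, r). if i \<in> P \<and> r < length (L i) then L i ! r else 0"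
      have "sum ?g S \<le> card (blowup C ?y `` S)" if S: "S \<subseteq> copies P ?y" for S
      proof -
        have fP: "fst ` S \<subseteq> P" using S by (auto simp: copies_def)
        have finP: "finite (fst ` S)" using fP assms(1) finite_subset by blast
        \<comment> \<open>Passing from \<open>S\<close> to all twins of its vertices keeps the
          neighbourhood and can only increase the sum.\<close>
        have SS: "S \<subseteq> copies (fst ` S) ?y" using S by (force simp: copies_def)
        have fin: "finite (copies (fst ` S) ?y)" using finP by (auto simp: copies_def)
        have "sum ?g S \<le> sum ?g (copies (fst ` S) ?y)" using SS fin by (intro sum_mono2) auto
        also have "\<dots> = (\<Sum>i\<in>fst ` S. \<Sum>r<?y i. ?g (i, r))"
          by (rule sum_copies[OF finP])
        also have "\<dots> = (\<Sum>i\<in>fst ` S. if i \<in> P then sum_list (L i) else 0)"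
          using fP by (intro sum.cong refl) (auto simp: sum_list_sum_nth atLeast0LessThan)
        also have "\<dots> \<le> card (C `` (fst ` S))" by (rule indepD[OF _ fP]) (use L in blast)
        also have "C `` (fst ` S) = blowup C ?y `` S"
          using S by (force simp: blowup_def copies_def Image_iff)
        finally show ?thesis .
      qed
      then have "?g \<in> indep (copies P ?y) (blowup C ?y)" by (auto simp: indep_def copies_def)
      moreover have "?y \<in> supplies P k" using L by (simp add: supplies_def)
      ultimately show "f' L \<in> ?X" by (simp add: f'_def)
    qed
  qed
qed

lemma finite_lists_sum_length: "finite {l :: nat list. sum_list l = n \<and> length l = k}"
proof (rule finite_subset)
  show "{l. sum_list l = n \<and> length l = k} \<subseteq> {xs. set xs \<subseteq> {..n} \<and> length xs = k}"
    by (auto simp: member_le_sum_list)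
qed (rule finite_lists_length_eq, simp)

lemma finite_blowup_indep:
  assumes "finite P" "finite B" "C \<subseteq> P \<times> B"
  shows "finite (indep (copies P y) (blowup C y))" "finite (demands B C y)"
proof -
  have fin: "finite (copies P y)" using assms by (auto simp: copies_def)
  show "finite (indep (copies P y) (blowup C y))"
    by (rule finite_indep[OF fin assms(2) blowup_subset[OF assms(3)]])
  have "(blowup C y)\<inverse> \<subseteq> B \<times> copies P y" using blowup_subset[OF assms(3)] by blast
  from finite_indep[OF assms(2) fin this] show "finite (demands B C y)"
    by (simp add: demands_eq_indep[OF assms])
qed

text \<open>Duality is applied to the blow-up of each supply \<open>y\<close> separately. On the
  other side the sum over \<open>y\<close> is free of side conditions: once the list sums
  \<open>h\<close> are fixed, the lengths are arbitrary, which yields the product.\<close>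

theorem gf_demands:
  assumes "finite P" "finite B" "C \<subseteq> P \<times> B"
  shows "Abs_fps (\<lambda>k. real (card (SIGMA y:supplies P k. demands B C y))) =
    (\<Sum>h\<in>indep P C. \<Prod>i\<in>P. lists_gf (h i))"
proof (rule fps_ext)
  fix k
  let ?W = "\<lambda>h :: 'a \<Rightarrow> nat. {L \<in> PiE P (\<lambda>i. {l. sum_list l = h i}). (\<Sum>i\<in>P. length (L i)) = k}"
  let ?L = "{L \<in> extensional P. (\<Sum>i\<in>P. length (L i)) = k \<and>
      (\<lambda>i. if i \<in> P then sum_list (L i) else 0) \<in> indep P C}"
  have fin: "finite (copies P y)" for y using assms by (auto simp: copies_def)
  have finI: "finite (indep P C)" by (rule finite_indep[OF assms])
  have "card (SIGMA y:supplies P k. demands B C y) = (\<Sum>y\<in>supplies P k. card (demands B C y))"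
    using finite_supplies[OF assms(1)] finite_blowup_indep[OF assms] by (intro card_SigmaI) auto
  also have "\<dots> = (\<Sum>y\<in>supplies P k. card (indep (copies P y) (blowup C y)))"
    using card_indep_converse[OF fin assms(2) blowup_subset[OF assms(3)]]
    by (simp add: demands_eq_indep[OF assms])
  also have "\<dots> = card (SIGMA y:supplies P k. indep (copies P y) (blowup C y))"
    using finite_supplies[OF assms(1)] finite_blowup_indep[OF assms] by (intro card_SigmaI[symmetric]) auto
  also have "\<dots> = card ?L"
    by (rule bij_betw_same_card[OF indep_blowup_bij[OF assms]])
  also have "?L =
    (\<Union>h\<in>indep P C. (?W h))" (is "_ = ?R")
  proof
    show "?L \<subseteq> ?R" by (auto simp: PiE_def)
    have "(\<lambda>i. if i \<in> P then sum_list (L i) else 0) = h"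
      if "h \<in> indep P C" "L \<in> PiE P (\<lambda>i. {l. sum_list l = h i})" for h L
      using that by (auto simp: indep_def PiE_def Pi_def)
    then show "?R \<subseteq> ?L" by (auto simp: PiE_def)
  qed
  also have "card \<dots> = (\<Sum>h\<in>indep P C. card (?W h))"
  proof (rule card_UN_disjoint[OF finI])
    show "\<forall>h\<in>indep P C. finite (?W h)"
      using gf_PiE(1)[OF assms(1), of "\<lambda>i. {l. sum_list l = _ i}" "\<lambda>_. length"] finite_lists_sum_length by auto
    show "\<forall>h\<in>indep P C. \<forall>h'\<in>indep P C. h \<noteq> h' \<longrightarrow>
      (?W h) \<inter>
      (?W h') = {}"
    proof (intro ballI impI)
      fix h h' assume h: "h \<in> indep P C" "h' \<in> indep P C" "h \<noteq> h'"
      then obtain i where "h i \<noteq> h' i" by auto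
      moreover from this have "i \<in> P" using h by (auto simp: indep_def)
      ultimately show "(?W h) \<inter>
      (?W h') = {}"
        by (auto simp: PiE_def Pi_def)
    qed
  qed
  finally have c: "card (SIGMA y:supplies P k. demands B C y) =
    (\<Sum>h\<in>indep P C. card (?W h))" .
  have "real (card (?W h)) =
     fps_nth (\<Prod>i\<in>P. lists_gf (h i)) k" for h :: "'a \<Rightarrow> nat"
  proof -
    have "gf (\<lambda>f. \<Sum>i\<in>P. length (f i)) (PiE P (\<lambda>i. {l. sum_list l = h i})) = (\<Prod>i\<in>P. lists_gf (h i))"
      unfolding lists_gf_def using finite_lists_sum_length
      by (intro gf_PiE(2)[OF assms(1), of "\<lambda>i. {l. sum_list l = h i}" "\<lambda>_. length"]) auto
    then show ?thesis by (simp add: gf_def fps_eq_iff)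
  qed
  then show "fps_nth (Abs_fps (\<lambda>k. real (card (SIGMA y:supplies P k. demands B C y)))) k =
    fps_nth (\<Sum>h\<in>indep P C. \<Prod>i\<in>P. lists_gf (h i)) k"
    by (simp add: c fps_sum_nth)
qed

text \<open>The new vertex \<open>None\<close> supplies the part of the dilation factor that is not used up by \<open>A\<close>.\<close>

definition cone_rel :: "'b set \<Rightarrow> ('a \<times> 'b) set \<Rightarrow> ('a option \<times> 'b) set" where
  "cone_rel B R = (\<lambda>(i, j). (Some i, j)) ` R \<union> {None} \<times> B"

lemma cone_iff: "(Some i, j) \<in> cone_rel B R \<longleftrightarrow> (i, j) \<in> R" "(None, j) \<in> cone_rel B R \<longleftrightarrow> j \<in> B"
  by (auto simp: cone_rel_def)

lemma cone_Image: "cone_rel B R `` (Some ` S) = R `` S"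
  by (auto simp: cone_iff Image_iff)

lemma cone_Image_None: "R \<subseteq> A \<times> B \<Longrightarrow> cone_rel B R `` (insert None S) = B"
  by (auto simp: cone_rel_def)

lemma cone_converse_Image:
  assumes "T \<subseteq> B" "T \<noteq> {}"
  shows "(cone_rel B R)\<inverse> `` T = insert None (Some ` (R\<inverse> `` T))"
proof (rule set_eqI)
  fix x show "x \<in> (cone_rel B R)\<inverse> `` T \<longleftrightarrow> x \<in> insert None (Some ` (R\<inverse> `` T))"
    by (cases x) (use assms in \<open>auto simp: Image_iff cone_iff\<close>)
qed

text \<open>A vertex joined to all of \<open>B\<close> is constrained only through the total
  capacity \<open>card B\<close>, so its value ranges over whatever \<open>g\<close> leaves.\<close>

lemma indep_cone_bij:
  assumes "finite A" "finite B" "R \<subseteq> A \<times> B"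
  shows "bij_betw (\<lambda>(g, n). case_option n g) (SIGMA g:indep A R. {..card B - sum g A})
     (indep (insert None (Some ` A)) (cone_rel B R))"
    (is "bij_betw ?f ?X ?Y")
proof (rule bij_betw_byWitness[where f' = "\<lambda>h. (h \<circ> Some, h None)"], goal_cases)
  case 1
  show ?case by auto
next
  case 2
  show ?case by (auto simp: fun_eq_iff split: option.split)
next
  case 3
  show ?case
  proof (intro image_subsetI, clarify)
    fix g n assume g: "g \<in> indep A R" and n: "n \<le> card B - sum g A"
    have "sum g A \<le> card (R `` A)" using g by (simp add: indep_def)
    also have "\<dots> \<le> card B" using assms by (intro card_mono) auto
    finally have gA: "sum g A \<le> card B" .
    have "sum (case_option n g) S \<le> card (cone_rel B R `` S)" if S: "S \<subseteq> insert None (Some ` A)" for S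
      using S
    proof (cases rule: subset_option_cases)
      case (1 S')
      then show ?thesis using g by (simp add: sum.reindex cone_Image indep_def)
    next
      case (2 S')
      have "finite S'" using 2 assms(1) finite_subset by blast
      then have "sum (case_option n g) S = n + sum g S'" by (simp add: 2 sum.reindex)
      also have "\<dots> \<le> n + sum g A" using 2 assms(1) by (simp add: sum_mono2)
      finally show ?thesis using n gA 2 cone_Image_None[OF assms(3)] by simp
    qed
    moreover have "case_option n g i = 0" if "i \<notin> insert None (Some ` A)" for i
      using that g by (cases i) (auto simp: indep_def)
    ultimately show "case_option n g \<in> ?Y" by (simp add: indep_def)
  qed
next
  case 4
  show ?case
  proof (intro image_subsetI)
    fix h assume "h \<in> ?Y"
    then have h0: "\<And>i. i \<notin> insert None (Some ` A) \<Longrightarrow> h i = 0"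
      and hS: "\<And>S. S \<subseteq> insert None (Some ` A) \<Longrightarrow> sum h S \<le> card (cone_rel B R `` S)"
      unfolding indep_def by blast+
    have "sum (h \<circ> Some) S \<le> card (R `` S)" if "S \<subseteq> A" for S
      using hS[of "Some ` S"] that by (simp add: sum.reindex cone_Image subset_insertI2 image_mono)
    moreover have "(h \<circ> Some) i = 0" if "i \<notin> A" for i using h0[of "Some i"] that by auto
    moreover have "h None + sum (h \<circ> Some) A \<le> card B"
      using hS[of "insert None (Some ` A)"] sum_option[OF assms(1), of h] cone_Image_None[OF assms(3)] by simp
    ultimately show "(h \<circ> Some, h None) \<in> ?X" by (simp add: indep_def)
  qed
qed

text \<open>For fixed \<open>T\<close>, the left vertices without a neighbour in \<open>T\<close>
  form the largest left set that is stable together with \<open>T\<close>. The inequalities thus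
  bound the weight of stable sets by \<open>k\<close>.\<close>

definition packings :: "'a set \<Rightarrow> 'b set \<Rightarrow> ('a \<times> 'b) set \<Rightarrow> nat \<Rightarrow> (('a \<Rightarrow> nat) \<times> ('b \<Rightarrow> nat)) set" where
  "packings A B R k = {(a, b). (\<forall>i. i \<notin> A \<longrightarrow> a i = 0) \<and> (\<forall>j. j \<notin> B \<longrightarrow> b j = 0) \<and>
     (\<forall>T\<subseteq>B. sum a (A - R\<inverse> `` T) + sum b T \<le> k)}"

text \<open>With \<open>k - sum a A\<close> as the supply of \<open>None\<close>, the packing
  inequality for nonempty \<open>T\<close> is Hall's condition for the demands \<open>b\<close>
  against the supplies \<open>a\<close>. The inequality for empty \<open>T\<close> keeps the
  subtraction from truncating.\<close>

lemma packings_bij: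
  assumes "finite A" "finite B" "R \<subseteq> A \<times> B"
  shows "bij_betw (\<lambda>(a, b). (case_option (k - sum a A) a, b)) (packings A B R k)
    (SIGMA y:supplies (insert None (Some ` A)) k. demands B (cone_rel B R) y)"
    (is "bij_betw ?f ?X ?Y")
proof -
  have key: "sum (case_option n a) ((cone_rel B R)\<inverse> `` T) + sum a (A - R\<inverse> `` T) = n + sum a A"
    if "T \<subseteq> B" "T \<noteq> {}" for a :: "'a \<Rightarrow> nat" and n T
  proof -
    have sub: "R\<inverse> `` T \<subseteq> A" using assms(3) by auto
    then have "finite (R\<inverse> `` T)" using assms(1) finite_subset by blast
    then have "sum (case_option n a) ((cone_rel B R)\<inverse> `` T) = n + sum a (R\<inverse> `` T)"
      by (simp add: cone_converse_Image[OF that] sum.reindex)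
    then show ?thesis using sum.subset_diff[OF sub assms(1), of a] by simp
  qed
  show ?thesis
  proof (rule bij_betw_byWitness[where f' = "\<lambda>(y, b). (y \<circ> Some, b)"], goal_cases)
    case 1
    show ?case by auto
  next
    case 2
    have "case_option (k - sum (y \<circ> Some) A) (y \<circ> Some) = y" if "y \<in> supplies (insert None (Some ` A)) k" for y
      using that sum_option[OF assms(1), of y] by (auto simp: supplies_def fun_eq_iff split: option.split)
    then show ?case by auto
  next
    case 3
    show ?case
    proof (intro image_subsetI, clarify, intro conjI SigmaI)
      fix a b assume ab: "(a, b) \<in> packings A B R k"
      then have a0: "\<And>i. i \<notin> A \<Longrightarrow> a i = 0" and b0: "\<And>j. j \<notin> B \<Longrightarrow> b j = 0"
        and T: "\<And>T. T \<subseteq> B \<Longrightarrow> sum a (A - R\<inverse> `` T) + sum b T \<le> k"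
        unfolding packings_def by blast+
      have ak: "sum a A \<le> k" using T[of "{}"] by simp
      have "case_option (k - sum a A) a i = 0" if "i \<notin> insert None (Some ` A)" for i
        using that a0 by (cases i) auto
      then show "case_option (k - sum a A) a \<in> supplies (insert None (Some ` A)) k"
        using ak sum_option[OF assms(1), of "case_option (k - sum a A) a"] by (simp add: supplies_def)
      have "sum b T \<le> sum (case_option (k - sum a A) a) ((cone_rel B R)\<inverse> `` T)" if "T \<subseteq> B" for T
        using key[of T "k - sum a A" a] T[OF that] ak that by (cases "T = {}") auto
      then show "b \<in> demands B (cone_rel B R) (case_option (k - sum a A) a)" using b0 by (simp add: demands_def)
    qed
  next
    case 4
    show ?case
    proof (intro image_subsetI, clarify)
      fix y b assume y: "y \<in> supplies (insert None (Some ` A)) k" and b: "b \<in> demands B (cone_rel B R) y"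
      have tot: "y None + sum (y \<circ> Some) A = k" using y sum_option[OF assms(1), of y] by (simp add: supplies_def)
      have yy: "case_option (y None) (y \<circ> Some) = y" by (auto simp: fun_eq_iff split: option.split)
      have "sum (y \<circ> Some) (A - R\<inverse> `` T) + sum b T \<le> k" if "T \<subseteq> B" for T
      proof (cases "T = {}")
        case False
        have "sum b T \<le> sum y ((cone_rel B R)\<inverse> `` T)" using b that by (simp add: demands_def)
        then show ?thesis using key[OF that False, of "y None" "y \<circ> Some"] tot yy by simp
      qed (use tot in simp)
      moreover have "(y \<circ> Some) i = 0" if "i \<notin> A" for i using y that by (auto simp: supplies_def)
      ultimately show "(y \<circ> Some, b) \<in> packings A B R k" using b by (simp add: packings_def demands_def)
    qed
  qed
qed

lemma finite_packings:
  assumes "finite A" "finite B" "R \<subseteq> A \<times> B"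
  shows "finite (packings A B R k)"
proof -
  have "cone_rel B R \<subseteq> insert None (Some ` A) \<times> B" using assms(3) by (auto simp: cone_rel_def)
  then have "finite (SIGMA y:supplies (insert None (Some ` A)) k. demands B (cone_rel B R) y)"
    using finite_supplies[of "insert None (Some ` A)" k]
      finite_blowup_indep(2)[of "insert None (Some ` A)" B "cone_rel B R"] assms(1,2)
    by (intro finite_SigmaI) auto
  then show ?thesis using packings_bij[OF assms] bij_betw_finite by blast
qed

text \<open>Vertex \<open>i\<close> brings the denominator exponent \<open>g i + 1\<close>, and the
  sum over the values at \<open>None\<close> brings \<open>card B - sum g A + 1\<close>. For every
  \<open>g\<close> these add up to \<open>card A + card B + 1\<close>, and each positive
  \<open>g i\<close> leaves one factor \<open>fps_X\<close>.\<close>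

theorem gf_packings:
  assumes "finite A" "finite B" "R \<subseteq> A \<times> B"
  shows "Abs_fps (\<lambda>k. real (card (packings A B R k))) * (1 - fps_X) ^ (card A + card B + 1) =
    (\<Sum>g\<in>indep A R. fps_X ^ card {i \<in> A. g i \<noteq> 0})"
proof -
  let ?P = "insert None (Some ` A)"
  have C: "cone_rel B R \<subseteq> ?P \<times> B" using assms(3) by (auto simp: cone_rel_def)
  have finP: "finite ?P" using assms(1) by simp
  have "Abs_fps (\<lambda>k. real (card (packings A B R k))) =
      Abs_fps (\<lambda>k. real (card (SIGMA y:supplies ?P k. demands B (cone_rel B R) y)))"
    using bij_betw_same_card[OF packings_bij[OF assms]] by simp
  also have "\<dots> = (\<Sum>h\<in>indep ?P (cone_rel B R). \<Prod>i\<in>?P. lists_gf (h i))"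
    by (rule gf_demands[OF finP assms(2) C])
  also have "\<dots> = (\<Sum>(g, n)\<in>(SIGMA g:indep A R. {..card B - sum g A}). \<Prod>i\<in>?P. lists_gf (case_option n g i))"
    by (subst sum.reindex_bij_betw[OF indep_cone_bij[OF assms], symmetric]) (simp add: case_prod_unfold)
  also have "\<dots> = (\<Sum>g\<in>indep A R. \<Sum>n\<le>card B - sum g A. \<Prod>i\<in>?P. lists_gf (case_option n g i))"
    using finite_indep[OF assms] by (simp add: sum.Sigma)
  also have "\<dots> = (\<Sum>g\<in>indep A R. (\<Prod>i\<in>A. lists_gf (g i)) * (\<Sum>n\<le>card B - sum g A. lists_gf n))"
  proof (intro sum.cong refl)
    fix g :: "'a \<Rightarrow> nat"
    have "(\<Prod>i\<in>?P. lists_gf (case_option n g i)) = (\<Prod>i\<in>A. lists_gf (g i)) * lists_gf n" for n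
      using assms(1) by (simp add: prod.reindex mult.commute)
    then show "(\<Sum>n\<le>card B - sum g A. \<Prod>i\<in>?P. lists_gf (case_option n g i)) =
      (\<Prod>i\<in>A. lists_gf (g i)) * (\<Sum>n\<le>card B - sum g A. lists_gf n)"
      by (simp add: sum_distrib_left)
  qed
  finally have "Abs_fps (\<lambda>k. real (card (packings A B R k))) * (1 - fps_X) ^ (card A + card B + 1) =
    (\<Sum>g\<in>indep A R. (\<Prod>i\<in>A. lists_gf (g i)) * (\<Sum>n\<le>card B - sum g A. lists_gf n) *
       (1 - fps_X) ^ (card A + card B + 1))"
    by (simp add: sum_distrib_right)
  also have "\<dots> = (\<Sum>g\<in>indep A R. fps_X ^ card {i \<in> A. g i \<noteq> 0})"
  proof (intro sum.cong refl)
    fix g assume g: "g \<in> indep A R"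
    have "sum g A \<le> card (R `` A)" using g by (simp add: indep_def)
    also have "\<dots> \<le> card B" using assms by (intro card_mono) auto
    finally have "sum g A \<le> card B" .
    then have "card A + card B + 1 = (\<Sum>i\<in>A. g i + 1) + (card B - sum g A + 1)"
      by (simp only: sum.distrib) simp
    then have "(1 - fps_X :: real fps) ^ (card A + card B + 1) =
       (\<Prod>i\<in>A. (1 - fps_X) ^ (g i + 1)) * (1 - fps_X) ^ (card B - sum g A + 1)"
      by (simp only: power_add power_sum)
    then have "(\<Prod>i\<in>A. lists_gf (g i)) * (\<Sum>n\<le>card B - sum g A. lists_gf n) * (1 - fps_X) ^ (card A + card B + 1) =
      (\<Prod>i\<in>A. lists_gf (g i) * (1 - fps_X) ^ (g i + 1)) *
      ((\<Sum>n\<le>card B - sum g A. lists_gf n) * (1 - fps_X) ^ (card B - sum g A + 1))"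
      by (simp only: prod.distrib mult_ac)
    also have "\<dots> = (\<Prod>i\<in>A. if g i = 0 then 1 else fps_X)"
      unfolding sum_lists_gf lists_gf_mult by simp
    also have "\<dots> = fps_X ^ card {i \<in> A. g i \<noteq> 0}"
    proof -
      have "A \<inter> - {i. g i = 0} = {i \<in> A. g i \<noteq> 0}" by auto
      then show ?thesis using assms(1) by (simp add: prod.If_cases)
    qed
    finally show "(\<Prod>i\<in>A. lists_gf (g i)) * (\<Sum>n\<le>card B - sum g A. lists_gf n) *
       (1 - fps_X) ^ (card A + card B + 1) = fps_X ^ card {i \<in> A. g i \<noteq> 0}" .
  qed
  finally show ?thesis .
qed


subsection \<open>Stable packings of a bipartite graph\<close>

definition bip_rel :: "'n set \<Rightarrow> 'n set \<Rightarrow> 'n set set \<Rightarrow> ('n \<times> 'n) set" where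
  "bip_rel A B E = {(i, j). i \<in> A \<and> j \<in> B \<and> {i, j} \<in> E}"

definition support_poly :: "'a set \<Rightarrow> ('a \<times> 'b) set \<Rightarrow> real poly" where
  "support_poly A R = (\<Sum>g\<in>indep A R. monom 1 (card {i \<in> A. g i \<noteq> 0}))"

text \<open>Neither side of the bipartition is mentioned, which later makes the two support
  polynomials equal. \<open>Y\<close> restricts the support and so passes to an induced
  subgraph.\<close>

definition stable_packings :: "'n set set \<Rightarrow> 'n set \<Rightarrow> nat \<Rightarrow> ('n \<Rightarrow> nat) set" where
  "stable_packings E Y k = {v. (\<forall>i. i \<notin> Y \<longrightarrow> v i = 0) \<and> (\<forall>X. (\<forall>e\<in>E. \<not> e \<subseteq> X) \<longrightarrow> sum v X \<le> k)}"

text \<open>A stable set whose right part is \<open>T\<close> has its left part among the vertices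
  without a neighbour in \<open>T\<close>, so the inequalities of \<open>packings\<close> imply all
  others.\<close>

lemma stable_packings_bij:
  fixes V1 V2 :: "'n::finite set"
  assumes "bipartite_graph V1 V2 E" "V1 \<union> V2 = UNIV"
  shows "bij_betw (\<lambda>v. (\<lambda>i. if i \<in> V1 then v i else 0, \<lambda>i. if i \<in> V2 then v i else 0))
    (stable_packings E Y k) (packings (V1 \<inter> Y) (V2 \<inter> Y) (bip_rel (V1 \<inter> Y) (V2 \<inter> Y) E) k)"
    (is "bij_betw ?f ?X ?Z")
proof -
  have disj: "V1 \<inter> V2 = {}" and edge: "\<And>e. e \<in> E \<Longrightarrow> \<exists>i\<in>V1. \<exists>j\<in>V2. e = {i, j}"
    using assms(1) by (auto simp: bipartite_graph_def)
  let ?A = "V1 \<inter> Y" and ?B = "V2 \<inter> Y" and ?R = "bip_rel (V1 \<inter> Y) (V2 \<inter> Y) E"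
  show ?thesis
  proof (rule bij_betw_byWitness[where f' = "\<lambda>(a, b) i. a i + b i"], goal_cases)
    case 1
    have "i \<in> V1 \<longleftrightarrow> i \<notin> V2" for i using disj assms(2) by auto
    then show ?case by (auto simp: fun_eq_iff)
  next
    case 2
    show ?case
    proof
      fix t assume "t \<in> ?Z"
      then obtain a b where t: "t = (a, b)" and a0: "\<And>i. i \<notin> ?A \<Longrightarrow> a i = 0" and b0: "\<And>i. i \<notin> ?B \<Longrightarrow> b i = 0"
        unfolding packings_def by blast
      have "a i = 0" if "i \<in> V2" for i using a0[of i] that disj by auto
      moreover have "b i = 0" if "i \<in> V1" for i using b0[of i] that disj by auto
      ultimately show "?f ((\<lambda>(a, b) i. a i + b i) t) = t"
        using a0 b0 by (auto simp: t fun_eq_iff)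
    qed
  next
    case 3
    show ?case
    proof (rule image_subsetI)
      fix v assume v: "v \<in> ?X"
      let ?a = "\<lambda>i. if i \<in> V1 then v i else 0" and ?b = "\<lambda>i. if i \<in> V2 then v i else 0"
      have "sum ?a (?A - ?R\<inverse> `` T) + sum ?b T \<le> k" if T: "T \<subseteq> ?B" for T
      proof -
        let ?X = "(?A - ?R\<inverse> `` T) \<union> T"
        have "\<not> e \<subseteq> ?X" if eE: "e \<in> E" for e
        proof
          assume e: "e \<subseteq> ?X"
          obtain i j where ij: "i \<in> V1" "j \<in> V2" "e = {i, j}" using edge[OF eE] by blast
          then have "j \<in> T" "i \<in> ?A - ?R\<inverse> `` T" using e T disj by auto
          moreover have "(i, j) \<in> ?R" using calculation T ij eE by (auto simp: bip_rel_def)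
          ultimately show False by blast
        qed
        then have "sum v ?X \<le> k" using v by (simp add: stable_packings_def)
        also have "sum v ?X = sum v (?A - ?R\<inverse> `` T) + sum v T"
          using T disj by (intro sum.union_disjoint) auto
        also have "sum v (?A - ?R\<inverse> `` T) = sum ?a (?A - ?R\<inverse> `` T)" by (intro sum.cong) auto
        also have "sum v T = sum ?b T" using T by (intro sum.cong) auto
        finally show ?thesis .
      qed
      moreover have "v i = 0" if "i \<notin> Y" for i using v that by (simp add: stable_packings_def)
      ultimately show "?f v \<in> ?Z" by (auto simp: packings_def)
    qed
  next
    case 4
    show ?case
    proof (rule image_subsetI)
      fix t assume "t \<in> ?Z"
      then obtain a b where t: "t = (a, b)" and a0: "\<And>i. i \<notin> ?A \<Longrightarrow> a i = 0" and b0: "\<And>i. i \<notin> ?B \<Longrightarrow> b i = 0"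
        and T: "\<And>T. T \<subseteq> ?B \<Longrightarrow> sum a (?A - ?R\<inverse> `` T) + sum b T \<le> k"
        unfolding packings_def by blast
      have "(\<Sum>i\<in>X. a i + b i) \<le> k" if X: "\<forall>e\<in>E. \<not> e \<subseteq> X" for X
      proof -
        have "sum a X = sum a (X \<inter> ?A)" using a0 by (intro sum.mono_neutral_right) auto
        also have "\<dots> \<le> sum a (?A - ?R\<inverse> `` (X \<inter> ?B))"
          using X by (intro sum_mono2) (auto simp: bip_rel_def)
        finally have "sum a X \<le> sum a (?A - ?R\<inverse> `` (X \<inter> ?B))" .
        moreover have "sum b X = sum b (X \<inter> ?B)" using b0 by (intro sum.mono_neutral_right) auto
        ultimately show ?thesis unfolding sum.distrib using T[OF Int_lower2[of X ?B]] by linarith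
      qed
      moreover have "a i + b i = 0" if "i \<notin> Y" for i using a0[of i] b0[of i] that by auto
      ultimately show "(\<lambda>(a, b) i. a i + b i) t \<in> ?X" by (auto simp: t stable_packings_def)
    qed
  qed
qed

lemma finite_stable_packings:
  fixes V1 V2 :: "'n::finite set"
  assumes "bipartite_graph V1 V2 E" "V1 \<union> V2 = UNIV"
  shows "finite (stable_packings E Y k)"
proof -
  have "finite (packings (V1 \<inter> Y) (V2 \<inter> Y) (bip_rel (V1 \<inter> Y) (V2 \<inter> Y) E) k)"
    by (rule finite_packings) (auto simp: bip_rel_def)
  then show ?thesis using stable_packings_bij[OF assms] bij_betw_finite by blast
qed

theorem gf_stable_packings:
  fixes V1 V2 :: "'n::finite set"
  assumes "bipartite_graph V1 V2 E" "V1 \<union> V2 = UNIV"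
  shows "Abs_fps (\<lambda>k. real (card (stable_packings E Y k))) * (1 - fps_X) ^ (card Y + 1) =
    fps_of_poly (support_poly (V1 \<inter> Y) (bip_rel (V1 \<inter> Y) (V2 \<inter> Y) E))"
proof -
  let ?A = "V1 \<inter> Y" and ?B = "V2 \<inter> Y" and ?R = "bip_rel (V1 \<inter> Y) (V2 \<inter> Y) E"
  have "card Y = card (?A \<union> ?B)" using assms(2) by (intro arg_cong[of _ _ card]) auto
  also have "\<dots> = card ?A + card ?B"
    using assms(1) by (intro card_Un_disjoint) (auto simp: bipartite_graph_def)
  finally have cY: "card Y = card ?A + card ?B" .
  have "?R \<subseteq> ?A \<times> ?B" by (auto simp: bip_rel_def)
  from gf_packings[OF _ _ this] have "Abs_fps (\<lambda>k. real (card (packings ?A ?B ?R k))) * (1 - fps_X) ^ (card Y + 1) =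
    (\<Sum>g\<in>indep ?A ?R. fps_X ^ card {i \<in> ?A. g i \<noteq> 0})" using cY by simp
  moreover have "card (packings ?A ?B ?R k) = card (stable_packings E Y k)" for k
    using bij_betw_same_card[OF stable_packings_bij[OF assms]] by simp
  ultimately show ?thesis
    by (simp add: support_poly_def fps_of_poly_sum fps_of_poly_monom')
qed

text \<open>The two orders of the sides give \<open>gf_stable_packings\<close> the same left-hand
  side.\<close>

lemma support_poly_swap:
  fixes V1 V2 :: "'n::finite set"
  assumes "bipartite_graph V1 V2 E" "V1 \<union> V2 = UNIV"
  shows "support_poly (V1 \<inter> Y) (bip_rel (V1 \<inter> Y) (V2 \<inter> Y) E) = support_poly (V2 \<inter> Y) (bip_rel (V2 \<inter> Y) (V1 \<inter> Y) E)"
proof -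
  have "bipartite_graph V2 V1 E" using assms(1) by (fastforce simp: bipartite_graph_def)
  moreover have "V2 \<union> V1 = UNIV" using assms(2) by auto
  ultimately show ?thesis
    using gf_stable_packings[OF assms, of Y] gf_stable_packings[of V2 V1 E Y] by (simp add: fps_of_poly_eq_iff)
qed

section \<open>Moebius expansion over induced subgraphs\<close>

lemma subset_sum_moebius:
  fixes n :: "'a::finite set \<Rightarrow> real"
  obtains m where "\<And>W. n W = sum m (Pow W)"
proof -
  define g where "g S = (\<Sum>T \<in> Pow S. (-1) ^ card T * n T)" for S
  have "n W = (\<Sum>T \<in> Pow W. (-1) ^ card T * g T)" for W
    by (rule inclusion_exclusion_symmetric) (simp_all add: g_def)
  then show thesis by (rule that)
qed

lemma subset_sum_unique:
  fixes p q :: "'a::finite set \<Rightarrow> 'b::ring_1"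
  assumes "\<And>Y. sum p (Pow Y) = sum q (Pow Y)"
  shows "p T = q T"
  using inclusion_exclusion_mobius[of "\<lambda>S. sum p (Pow S)" p T]
    inclusion_exclusion_mobius[of "\<lambda>S. sum p (Pow S)" q T] assms by simp

text \<open>Coordinates outside the support add nothing to a sum and only enlarge neighbourhoods, so
  the inequalities over subsets of the support suffice.\<close>

lemma indep_full_support:
  assumes "U \<subseteq> A" "finite A" "finite B" "R \<subseteq> A \<times> B"
  shows "{g \<in> indep A R. {i \<in> A. g i \<noteq> 0} = U} = {g \<in> indep U (R \<inter> U \<times> UNIV). \<forall>i\<in>U. g i \<noteq> 0}"
proof (intro equalityI subsetI)
  fix g assume g: "g \<in> {g \<in> indep A R. {i \<in> A. g i \<noteq> 0} = U}"
  have "sum g S \<le> card ((R \<inter> U \<times> UNIV) `` S)" if "S \<subseteq> U" for S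
  proof -
    have "(R \<inter> U \<times> UNIV) `` S = R `` S" using that by auto
    then show ?thesis using g that assms(1) indepD[of g A R S] by auto
  qed
  moreover have "g i = 0" if "i \<notin> U" for i using g that by (auto simp: indep_def)
  moreover have "\<forall>i\<in>U. g i \<noteq> 0" using g by auto
  ultimately show "g \<in> {g \<in> indep U (R \<inter> U \<times> UNIV). \<forall>i\<in>U. g i \<noteq> 0}" by (simp add: indep_def)
next
  fix g assume "g \<in> {g \<in> indep U (R \<inter> U \<times> UNIV). \<forall>i\<in>U. g i \<noteq> 0}"
  then have g: "g \<in> indep U (R \<inter> U \<times> UNIV)" "\<forall>i\<in>U. g i \<noteq> 0" by auto
  have g0: "g i = 0" if "i \<notin> U" for i using g that by (simp add: indep_def)
  have iff: "g i \<noteq> 0 \<longleftrightarrow> i \<in> U" for i using g(2) g0[of i] by (cases "i \<in> U") auto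
  have "sum g S \<le> card (R `` S)" if "S \<subseteq> A" for S
  proof -
    have finS: "finite S" using that assms(2) finite_subset by blast
    have "sum g S = sum g (S \<inter> U)" using g0 finS by (intro sum.mono_neutral_right) auto
    also have "\<dots> \<le> card ((R \<inter> U \<times> UNIV) `` (S \<inter> U))" by (rule indepD[OF g(1)]) auto
    also have "\<dots> \<le> card (R `` S)"
      using assms(4) finite_subset[of "R `` S" B] assms(3) by (intro card_mono) blast+
    finally show ?thesis .
  qed
  moreover have "{i \<in> A. g i \<noteq> 0} = U" unfolding iff using assms(1) by blast
  moreover have "g i = 0" if "i \<notin> A" for i using iff[of i] that assms(1) by blast
  ultimately show "g \<in> {g \<in> indep A R. {i \<in> A. g i \<noteq> 0} = U}" unfolding indep_def by blast
qed

text \<open>For a fixed support \<open>U\<close> the count depends on \<open>Y\<close> only through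
  the right part of \<open>Y\<close>. Moebius inversion there gives coefficients indexed by a left
  and a right set, that is by \<open>T\<close>, and independent of \<open>Y\<close>; the exponent is
  the size of the left set.\<close>

lemma support_poly_expansion:
  fixes V1 V2 :: "'n::finite set"
  assumes "bipartite_graph V1 V2 E" "V1 \<union> V2 = UNIV"
  obtains m where "\<And>Y. support_poly (V1 \<inter> Y) (bip_rel (V1 \<inter> Y) (V2 \<inter> Y) E) =
    (\<Sum>T\<in>Pow Y. smult (m T) (monom 1 (card (T \<inter> V1))))"
proof -
  have disj: "V1 \<inter> V2 = {}" using assms(1) by (auto simp: bipartite_graph_def)
  define n where "n U W = real (card {g \<in> indep U (bip_rel U W E). \<forall>i\<in>U. g i \<noteq> 0})" for U W
  have "\<exists>m. \<forall>W. n U W = sum m (Pow W)" for U using subset_sum_moebius[of "n U"] by metis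
  then obtain M where M: "\<And>U W. n U W = sum (M U) (Pow W)" by metis
  have "support_poly (V1 \<inter> Y) (bip_rel (V1 \<inter> Y) (V2 \<inter> Y) E) =
    (\<Sum>T\<in>Pow Y. smult (M (T \<inter> V1) (T \<inter> V2)) (monom 1 (card (T \<inter> V1))))" for Y
  proof -
    let ?A = "V1 \<inter> Y" and ?B = "V2 \<inter> Y" and ?R = "bip_rel (V1 \<inter> Y) (V2 \<inter> Y) E"
    let ?S = "\<lambda>U. {g \<in> indep ?A ?R. {i \<in> ?A. g i \<noteq> 0} = U}"
    have RAB: "?R \<subseteq> ?A \<times> ?B" by (auto simp: bip_rel_def)
    have finI: "finite (indep ?A ?R)" by (rule finite_indep[OF _ _ RAB]) auto
    have "support_poly ?A ?R = (\<Sum>U\<in>Pow ?A. \<Sum>g\<in>(?S U). monom 1 (card {i \<in> ?A. g i \<noteq> 0}))"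
      unfolding support_poly_def by (rule sum.group[symmetric]) (use finI in auto)
    also have "\<dots> = (\<Sum>U\<in>Pow ?A. smult (n U ?B) (monom 1 (card U)))"
    proof (rule sum.cong[OF refl])
      fix U assume U: "U \<in> Pow ?A"
      have "(?S U) = {g \<in> indep U (?R \<inter> U \<times> UNIV). \<forall>i\<in>U. g i \<noteq> 0}"
        using U by (intro indep_full_support[OF _ _ _ RAB]) auto
      also have "?R \<inter> U \<times> UNIV = bip_rel U ?B E" using U by (auto simp: bip_rel_def)
      finally have sets: "(?S U) =
        {g \<in> indep U (bip_rel U ?B E). \<forall>i\<in>U. g i \<noteq> 0}" .
      have "(\<Sum>g\<in>(?S U). monom 1 (card {i \<in> ?A. g i \<noteq> 0})) =
        (\<Sum>g\<in>(?S U). monom (1::real) (card U))"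
        by (rule sum.cong) auto
      also have "\<dots> = smult (real (card (?S U))) (monom 1 (card U))"
        by (simp add: of_nat_poly)
      finally show "(\<Sum>g\<in>(?S U). monom 1 (card {i \<in> ?A. g i \<noteq> 0})) =
        smult (n U ?B) (monom 1 (card U))" by (simp only: n_def sets)
    qed
    also have "\<dots> = (\<Sum>U\<in>Pow ?A. \<Sum>W\<in>Pow ?B. smult (M U W) (monom 1 (card U)))"
      unfolding M by (simp add: smult_sum)
    also have "\<dots> = (\<Sum>(U, W)\<in>Pow ?A \<times> Pow ?B. smult (M U W) (monom 1 (card U)))"
      by (rule sum.cartesian_product)
    also have "\<dots> = (\<Sum>T\<in>Pow Y. smult (M (T \<inter> V1) (T \<inter> V2)) (monom 1 (card (T \<inter> V1))))"
    proof (rule sum.reindex_bij_witness[where i = "\<lambda>T. (T \<inter> V1, T \<inter> V2)" and j = "\<lambda>(U, W). U \<union> W"], goal_cases)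
      case (1 t)
      then obtain U W where "t = (U, W)" "U \<subseteq> V1" "W \<subseteq> V2" by auto
      moreover from this have "(U \<union> W) \<inter> V1 = U" "(U \<union> W) \<inter> V2 = W" using disj by auto
      ultimately show ?case by simp
    next
      case (5 t)
      then obtain U W where "t = (U, W)" "U \<subseteq> V1" "W \<subseteq> V2" by auto
      moreover from this have "(U \<union> W) \<inter> V1 = U" "(U \<union> W) \<inter> V2 = W" using disj by auto
      ultimately show ?case by simp
    qed (use assms(2) in auto)
    finally show ?thesis .
  qed
  then show thesis by (rule that)
qed

theorem support_poly_balanced_expansion:
  fixes V1 V2 :: "'n::finite set"
  assumes "bipartite_graph V1 V2 E" "V1 \<union> V2 = UNIV"
  obtains m where "\<And>Y. support_poly (V1 \<inter> Y) (bip_rel (V1 \<inter> Y) (V2 \<inter> Y) E) =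
      (\<Sum>T\<in>Pow Y. smult (m T) (monom 1 (card T div 2)))"
    "\<And>T. m T \<noteq> 0 \<Longrightarrow> even (card T)"
proof -
  have 2: "bipartite_graph V2 V1 E" "V2 \<union> V1 = UNIV"
    using assms by (fastforce simp: bipartite_graph_def)+
  obtain m where m: "\<And>Y. support_poly (V1 \<inter> Y) (bip_rel (V1 \<inter> Y) (V2 \<inter> Y) E) =
    (\<Sum>T\<in>Pow Y. smult (m T) (monom 1 (card (T \<inter> V1))))"
    using support_poly_expansion[OF assms] by metis
  obtain m' where m': "\<And>Y. support_poly (V2 \<inter> Y) (bip_rel (V2 \<inter> Y) (V1 \<inter> Y) E) =
    (\<Sum>T\<in>Pow Y. smult (m' T) (monom 1 (card (T \<inter> V2))))"
    using support_poly_expansion[OF 2] by metis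
  \<comment> \<open>The two expansions agree for every \<open>Y\<close>, so by uniqueness of Moebius
    coefficients they agree term by term. A nonzero term then has equally many vertices on both
    sides.\<close>
  have eq: "smult (m T) (monom 1 (card (T \<inter> V1))) = smult (m' T) (monom 1 (card (T \<inter> V2)))" for T
    using subset_sum_unique[of "\<lambda>T. smult (m T) (monom 1 (card (T \<inter> V1)))"
        "\<lambda>T. smult (m' T) (monom 1 (card (T \<inter> V2)))" T] m m' support_poly_swap[OF assms] by simp
  have bal: "card T = 2 * card (T \<inter> V1)" if "m T \<noteq> 0" for T
  proof -
    have "coeff (smult (m' T) (monom 1 (card (T \<inter> V2)))) (card (T \<inter> V1)) \<noteq> 0"
      unfolding eq[symmetric] using that by simp
    then have "card (T \<inter> V1) = card (T \<inter> V2)" by (simp split: if_splits)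
    moreover have "card T = card (T \<inter> V1 \<union> T \<inter> V2)" using assms(2) by (intro arg_cong[of _ _ card]) auto
    moreover have "\<dots> = card (T \<inter> V1) + card (T \<inter> V2)"
      using assms(1) by (intro card_Un_disjoint) (auto simp: bipartite_graph_def)
    ultimately show ?thesis by simp
  qed
  have "smult (m T) (monom 1 (card (T \<inter> V1))) = smult (m T) (monom 1 (card T div 2))" for T
    using bal[of T] by (cases "m T = 0") auto
  then have "support_poly (V1 \<inter> Y) (bip_rel (V1 \<inter> Y) (V2 \<inter> Y) E) =
      (\<Sum>T\<in>Pow Y. smult (m T) (monom 1 (card T div 2)))" for Y
    using m[of Y] by simp
  moreover have "\<And>T. m T \<noteq> 0 \<Longrightarrow> even (card T)" using bal by simp
  ultimately show thesis by (rule that)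
qed


subsection \<open>Lattice points of the polytope\<close>

text \<open>Dilations are written as images rather than by dividing, so that the factor 0 is
  included.\<close>

lemma convex_scale_add:
  fixes B :: "'a::real_vector set"
  assumes "convex B" "0 \<le> m" "0 \<le> m'" "x \<in> (*\<^sub>R) m ` B" "y \<in> (*\<^sub>R) m' ` B"
  shows "x + y \<in> (*\<^sub>R) (m + m') ` B"
proof -
  obtain x' y' where x: "x = m *\<^sub>R x'" "x' \<in> B" and y: "y = m' *\<^sub>R y'" "y' \<in> B" using assms(4,5) by blast
  show ?thesis
  proof (cases "m + m' = 0")
    case True
    then have "m = 0" "m' = 0" using assms(2,3) by auto
    then show ?thesis using x y by force
  next
    case False
    then have pos: "m + m' > 0" using assms(2,3) by auto
    let ?z = "(m / (m + m')) *\<^sub>R x' + (m' / (m + m')) *\<^sub>R y'"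
    have "m / (m + m') + m' / (m + m') = 1" using False by (simp flip: add_divide_distrib)
    then have "?z \<in> B" using assms(1-3) x(2) y(2) pos by (intro convexD) auto
    moreover have "x + y = (m + m') *\<^sub>R ?z" using False by (simp add: x y scaleR_right_distrib)
    ultimately show ?thesis by blast
  qed
qed

lemma convex_scale_sum:
  fixes B :: "'a::real_vector set"
  assumes "convex B" "0 \<in> B" "finite I" "\<And>t. t \<in> I \<Longrightarrow> 0 \<le> c t" "\<And>t. t \<in> I \<Longrightarrow> c t \<noteq> 0 \<Longrightarrow> p t \<in> B"
  shows "(\<Sum>t\<in>I. c t *\<^sub>R p t) \<in> (*\<^sub>R) (sum c I) ` B"
  using assms(3-5)
proof (induction rule: finite_induct)
  case empty
  then show ?case using assms(2) by auto
next
  case (insert t I)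
  have "c t *\<^sub>R p t \<in> (*\<^sub>R) (c t) ` B"
    using insert.prems(2)[of t] assms(2) by (cases "c t = 0") auto
  then show ?case using insert by (auto intro!: convex_scale_add[OF assms(1)] sum_nonneg)
qed

lemma convex_scale_mono:
  fixes B :: "'a::real_vector set"
  assumes "convex B" "0 \<in> B" "0 \<le> m" "m \<le> m'" "x \<in> (*\<^sub>R) m ` B"
  shows "x \<in> (*\<^sub>R) m' ` B"
proof -
  have "0 \<in> (*\<^sub>R) (m' - m) ` B" using assms(2) by (auto intro!: image_eqI[of _ _ 0])
  from convex_scale_add[OF assms(1,3) _ assms(5) this] show ?thesis using assms(4) by simp
qed

lemma B_polytope_generators:
  "0 \<in> B_polytope E" "s \<in> {-1, 1} \<Longrightarrow> s *\<^sub>R axis i 1 \<in> B_polytope E"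
  "s \<in> {-1, 1} \<Longrightarrow> t \<in> {-1, 1} \<Longrightarrow> {i, j} \<in> E \<Longrightarrow> s *\<^sub>R axis i 1 + t *\<^sub>R axis j 1 \<in> B_polytope E"
  unfolding B_polytope_def by (rule hull_inc, blast)+

text \<open>The inequality cuts out a convex set and holds at every generator, since an edge has at
  most one end in a stable set.\<close>

lemma B_polytope_stable_bound:
  fixes x :: "real ^ 'n"
  assumes "bipartite_graph V1 V2 E" "x \<in> B_polytope E" "\<forall>e\<in>E. \<not> e \<subseteq> X"
  shows "(\<Sum>i\<in>X. \<bar>x $ i\<bar>) \<le> 1"
proof -
  let ?S = "{x :: real ^ 'n. (\<Sum>i\<in>X. \<bar>x $ i\<bar>) \<le> 1}"
  have ne: "i \<noteq> j" if "{i, j} \<in> E" for i j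
    using assms(1) that by (fastforce simp: bipartite_graph_def doubleton_eq_iff)
  have cv: "convex ?S"
  proof (rule convexI, clarify)
    fix x y :: "real ^ 'n" and u v :: real
    assume x: "(\<Sum>i\<in>X. \<bar>x $ i\<bar>) \<le> 1" and y: "(\<Sum>i\<in>X. \<bar>y $ i\<bar>) \<le> 1" and uv: "0 \<le> u" "0 \<le> v" "u + v = 1"
    have "(\<Sum>i\<in>X. \<bar>(u *\<^sub>R x + v *\<^sub>R y) $ i\<bar>) \<le> (\<Sum>i\<in>X. u * \<bar>x $ i\<bar> + v * \<bar>y $ i\<bar>)"
    proof (rule sum_mono)
      fix i
      have "\<bar>u * x $ i + v * y $ i\<bar> \<le> \<bar>u * x $ i\<bar> + \<bar>v * y $ i\<bar>" by (rule abs_triangle_ineq)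
      then show "\<bar>(u *\<^sub>R x + v *\<^sub>R y) $ i\<bar> \<le> u * \<bar>x $ i\<bar> + v * \<bar>y $ i\<bar>" using uv by (simp add: abs_mult)
    qed
    also have "\<dots> = u * (\<Sum>i\<in>X. \<bar>x $ i\<bar>) + v * (\<Sum>i\<in>X. \<bar>y $ i\<bar>)"
      by (simp add: sum.distrib sum_distrib_left)
    also have "\<dots> \<le> u * 1 + v * 1" using x y uv by (intro add_mono mult_left_mono) auto
    finally show "(\<Sum>i\<in>X. \<bar>(u *\<^sub>R x + v *\<^sub>R y) $ i\<bar>) \<le> 1" using uv by simp
  qed
  have ax: "(\<Sum>k\<in>X. \<bar>(s *\<^sub>R axis i 1 :: real ^ 'n) $ k\<bar>) = (if i \<in> X then 1 else 0)"
    if "s \<in> {-1, 1}" for s i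
  proof -
    have "\<bar>(s *\<^sub>R axis i 1 :: real ^ 'n) $ k\<bar> = (if k = i then 1 else 0)" for k using that by (auto simp: axis_def)
    then show ?thesis by simp
  qed
  have single: "s *\<^sub>R axis i 1 \<in> ?S" if "s \<in> {-1, 1}" for s i
    using ax[OF that, of i] by (simp only: mem_Collect_eq) simp
  have pair: "s *\<^sub>R axis i 1 + t *\<^sub>R axis j 1 \<in> ?S" if st: "s \<in> {-1, 1}" "t \<in> {-1, 1}" "{i, j} \<in> E" for s t i j
  proof -
    have "(\<Sum>k\<in>X. \<bar>(s *\<^sub>R axis i 1 + t *\<^sub>R axis j 1 :: real ^ 'n) $ k\<bar>) \<le>
      (\<Sum>k\<in>X. \<bar>(s *\<^sub>R axis i 1 :: real ^ 'n) $ k\<bar> + \<bar>(t *\<^sub>R axis j 1 :: real ^ 'n) $ k\<bar>)"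
      by (rule sum_mono) (simp add: abs_triangle_ineq)
    also have "\<dots> = (if i \<in> X then 1 else 0) + (if j \<in> X then 1 else 0)"
      by (simp only: sum.distrib ax[OF st(1)] ax[OF st(2)])
    also have "\<dots> \<le> 1" using assms(3) st(3) by fastforce
    finally show ?thesis by simp
  qed
  have "B_polytope E \<subseteq> ?S"
    unfolding B_polytope_def
  proof (rule hull_minimal)
    show "convex ?S" by (rule cv)
    show "{0} \<union> {s *\<^sub>R axis i 1 |s i. s \<in> {- 1, 1}} \<union>
      {s *\<^sub>R axis i 1 + t *\<^sub>R axis j 1 |s t i j. s \<in> {- 1, 1} \<and> t \<in> {- 1, 1} \<and> {i, j} \<in> E} \<subseteq> ?S"
    proof (intro Un_least subsetI)
      fix x :: "real ^ 'n" assume "x \<in> {0}"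
      then show "x \<in> ?S" by simp
    next
      fix x :: "real ^ 'n" assume "x \<in> {s *\<^sub>R axis i 1 |s i. s \<in> {- 1, 1}}"
      then show "x \<in> ?S" using single by blast
    next
      fix x :: "real ^ 'n"
      assume "x \<in> {s *\<^sub>R axis i 1 + t *\<^sub>R axis j 1 |s t i j. s \<in> {- 1, 1} \<and> t \<in> {- 1, 1} \<and> {i, j} \<in> E}"
      then show "x \<in> ?S" using pair by blast
    qed
  qed
  then show ?thesis using assms(2) by auto
qed

section \<open>Integer decomposition of lattice points\<close>

definition abs_nat :: "real ^ 'n \<Rightarrow> 'n \<Rightarrow> nat" where
  "abs_nat w i = nat \<lfloor>\<bar>w $ i\<bar>\<rfloor>"

lemma real_abs_nat: "w $ i \<in> \<int> \<Longrightarrow> real (abs_nat w i) = \<bar>w $ i\<bar>"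
  by (auto simp: abs_nat_def elim!: Ints_cases)

text \<open>The right coordinates are served from the left ones. A unit sent from
  \<open>Some i\<close> to \<open>j\<close> uses the generator of the edge, a unit from
  \<open>None\<close> the signed unit vector at \<open>j\<close>, and a left unit that is not sent
  the signed unit vector at \<open>i\<close>. At most \<open>k\<close> generators are used in
  all.\<close>

lemma stable_packing_in_scaled_B_polytope:
  fixes w :: "real ^ 'n"
  assumes "bipartite_graph V1 V2 E" "V1 \<union> V2 = UNIV" "\<forall>i. w $ i \<in> \<int>"
    "abs_nat w \<in> stable_packings E UNIV k"
  shows "w \<in> (*\<^sub>R) (real k) ` B_polytope E"
proof -
  have disj: "V1 \<inter> V2 = {}" using assms(1) by (auto simp: bipartite_graph_def)
  define s where "s i = (if w $ i < 0 then -1 else 1 :: real)" for i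
  have s: "s i \<in> {-1, 1}" "s i * real (abs_nat w i) = w $ i" for i
    using real_abs_nat[of w i] assms(3) by (auto simp: s_def)
  let ?R = "bip_rel V1 V2 E"
  let ?a = "\<lambda>i. if i \<in> V1 then abs_nat w i else 0" and ?b = "\<lambda>i. if i \<in> V2 then abs_nat w i else 0"
  have "(?a, ?b) \<in> packings V1 V2 ?R k"
    using bij_betwE[OF stable_packings_bij[OF assms(1,2), of UNIV k]] assms(4) by auto
  moreover have RAB: "?R \<subseteq> V1 \<times> V2" by (auto simp: bip_rel_def)
  ultimately have "(case_option (k - sum ?a V1) ?a, ?b) \<in>
     (SIGMA y:supplies (insert None (Some ` V1)) k. demands V2 (cone_rel V2 ?R) y)"
    using bij_betwE[OF packings_bij[of V1 V2 ?R k]] by auto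
  moreover define y where "y = case_option (k - sum ?a V1) ?a"
  ultimately have y: "y \<in> supplies (insert None (Some ` V1)) k" and b: "?b \<in> demands V2 (cone_rel V2 ?R) y" by auto
  have C: "cone_rel V2 ?R \<subseteq> insert None (Some ` V1) \<times> V2" using RAB by (auto simp: cone_rel_def)
  have "\<And>T. T \<subseteq> V2 \<Longrightarrow> sum ?b T \<le> sum y ((cone_rel V2 ?R)\<inverse> `` T)" using b by (simp add: demands_def)
  from supply_demand[OF finite finite C this] obtain x :: "'n option \<Rightarrow> 'n \<Rightarrow> nat"
    where x0: "\<And>i j. (i, j) \<notin> cone_rel V2 ?R \<Longrightarrow> x i j = 0"
    and xc: "\<And>j. j \<in> V2 \<Longrightarrow> (\<Sum>i\<in>insert None (Some ` V1). x i j) = ?b j"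
    and xr: "\<And>i. i \<in> insert None (Some ` V1) \<Longrightarrow> (\<Sum>j\<in>V2. x i j) \<le> y i" by blast
  define e where "e i = s i *\<^sub>R (axis i 1 :: real ^ 'n)" for i
  have eB: "e i \<in> B_polytope E" "{i, j} \<in> E \<Longrightarrow> e i + e j \<in> B_polytope E" for i j
    unfolding e_def using B_polytope_generators(2,3)[where E = E] s(1) by blast+
  let ?w1 = "\<Sum>(i, j)\<in>V1 \<times> V2. real (x (Some i) j) *\<^sub>R (e i + e j)"
  let ?r = "\<lambda>i. abs_nat w i - (\<Sum>j\<in>V2. x (Some i) j)"
  let ?w2 = "\<Sum>i\<in>V1. real (?r i) *\<^sub>R e i"
  let ?w3 = "\<Sum>j\<in>V2. real (x None j) *\<^sub>R e j"
  have rle: "(\<Sum>j\<in>V2. x (Some i) j) \<le> abs_nat w i" if "i \<in> V1" for i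
    using xr[of "Some i"] that by (simp add: y_def)
  have cvx: "convex (B_polytope E)" by (simp add: B_polytope_def convex_convex_hull)
  note gen = B_polytope_generators[where E = E] and sumI = convex_scale_sum[OF cvx B_polytope_generators(1)]
  have "?w1 \<in> (*\<^sub>R) (\<Sum>(i, j)\<in>V1 \<times> V2. real (x (Some i) j)) ` B_polytope E"
  proof -
    have "(\<Sum>t\<in>V1 \<times> V2. real (x (Some (fst t)) (snd t)) *\<^sub>R (e (fst t) + e (snd t))) \<in>
      (*\<^sub>R) (\<Sum>t\<in>V1 \<times> V2. real (x (Some (fst t)) (snd t))) ` B_polytope E"
    proof (rule sumI)
      fix t assume "real (x (Some (fst t)) (snd t)) \<noteq> 0"
      then have "(Some (fst t), snd t) \<in> cone_rel V2 ?R" using x0 by fastforce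
      then have "{fst t, snd t} \<in> E" by (simp add: cone_iff bip_rel_def case_prod_unfold)
      then show "e (fst t) + e (snd t) \<in> B_polytope E" by (rule eB(2))
    qed auto
    then show ?thesis by (simp add: case_prod_unfold)
  qed
  moreover have "?w2 \<in> (*\<^sub>R) (\<Sum>i\<in>V1. real (?r i)) ` B_polytope E"
    by (rule sumI) (use eB(1) in auto)
  moreover have "?w3 \<in> (*\<^sub>R) (\<Sum>j\<in>V2. real (x None j)) ` B_polytope E"
    by (rule sumI) (use eB(1) in auto)
  ultimately have w_in: "?w1 + ?w2 + ?w3 \<in> (*\<^sub>R) ((\<Sum>(i, j)\<in>V1 \<times> V2. real (x (Some i) j)) +
      (\<Sum>i\<in>V1. real (?r i)) + (\<Sum>j\<in>V2. real (x None j))) ` B_polytope E"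
    by (intro convex_scale_add[OF cvx]) (auto intro!: sum_nonneg add_nonneg_nonneg)
  have w_eq: "w = ?w1 + ?w2 + ?w3"
  proof -
    have comb: "a + b + c + d = q + r" if "a + c = q" "b + d = r" for a b c d q r :: "real ^ 'n"
      unfolding that[symmetric] by (simp add: algebra_simps)
    have w1: "?w1 = (\<Sum>i\<in>V1. real (\<Sum>j\<in>V2. x (Some i) j) *\<^sub>R e i) + (\<Sum>j\<in>V2. real (\<Sum>i\<in>V1. x (Some i) j) *\<^sub>R e j)"
    proof -
      have "?w1 = (\<Sum>i\<in>V1. \<Sum>j\<in>V2. real (x (Some i) j) *\<^sub>R e i) + (\<Sum>i\<in>V1. \<Sum>j\<in>V2. real (x (Some i) j) *\<^sub>R e j)"
        by (simp add: sum.cartesian_product[symmetric] scaleR_right_distrib sum.distrib)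
      also have "(\<Sum>i\<in>V1. \<Sum>j\<in>V2. real (x (Some i) j) *\<^sub>R e j) = (\<Sum>j\<in>V2. \<Sum>i\<in>V1. real (x (Some i) j) *\<^sub>R e j)"
        by (rule sum.swap)
      finally show ?thesis by (simp only: of_nat_sum scaleR_sum_left)
    qed
    have "(\<Sum>i\<in>V1. real (\<Sum>j\<in>V2. x (Some i) j) *\<^sub>R e i) + ?w2 = (\<Sum>i\<in>V1. real (abs_nat w i) *\<^sub>R e i)"
    proof -
      have "real (\<Sum>j\<in>V2. x (Some i) j) *\<^sub>R e i + real (?r i) *\<^sub>R e i = real (abs_nat w i) *\<^sub>R e i"
        if "i \<in> V1" for i
        using rle[OF that] by (simp only: flip: scaleR_left_distrib of_nat_add) simp
      then show ?thesis by (simp only: sum.distrib[symmetric] cong: sum.cong)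
    qed
    moreover have "(\<Sum>j\<in>V2. real (\<Sum>i\<in>V1. x (Some i) j) *\<^sub>R e j) + ?w3 = (\<Sum>j\<in>V2. real (abs_nat w j) *\<^sub>R e j)"
    proof -
      have "(\<Sum>i\<in>V1. x (Some i) j) + x None j = abs_nat w j" if "j \<in> V2" for j
        using xc[OF that] that by (simp add: sum.reindex)
      then have "real (\<Sum>i\<in>V1. x (Some i) j) *\<^sub>R e j + real (x None j) *\<^sub>R e j = real (abs_nat w j) *\<^sub>R e j"
        if "j \<in> V2" for j
        using that by (simp only: flip: scaleR_left_distrib of_nat_add)
      then show ?thesis by (simp only: sum.distrib[symmetric] cong: sum.cong)
    qed
    ultimately have "?w1 + ?w2 + ?w3 = (\<Sum>i\<in>V1. real (abs_nat w i) *\<^sub>R e i) + (\<Sum>j\<in>V2. real (abs_nat w j) *\<^sub>R e j)"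
      unfolding w1 by (rule comb)
    also have "\<dots> = (\<Sum>i\<in>V1 \<union> V2. real (abs_nat w i) *\<^sub>R e i)"
      using disj by (intro sum.union_disjoint[symmetric]) auto
    also have "\<dots> = (\<Sum>i\<in>UNIV. (w $ i) *\<^sub>R axis i 1)"
      using s(2) by (simp add: assms(2) e_def mult.commute)
    also have "\<dots> = w" by (simp add: vec_eq_iff axis_def if_distrib cong: if_cong)
    finally show ?thesis ..
  qed
  \<comment> \<open>The first two sums together exhaust the left coordinates. The third is at most
    the supply of \<open>None\<close>, which is what the left coordinates leave of
    \<open>k\<close>.\<close>
  have le: "(\<Sum>(i, j)\<in>V1 \<times> V2. real (x (Some i) j)) + (\<Sum>i\<in>V1. real (?r i)) + (\<Sum>j\<in>V2. real (x None j)) \<le> real k"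
  proof -
    have "(\<Sum>(i, j)\<in>V1 \<times> V2. x (Some i) j) + (\<Sum>i\<in>V1. ?r i) = (\<Sum>i\<in>V1. (\<Sum>j\<in>V2. x (Some i) j) + ?r i)"
      by (simp add: sum.cartesian_product[symmetric] sum.distrib)
    also have "\<dots> = sum ?a V1" using rle by (intro sum.cong) auto
    finally have "(\<Sum>(i, j)\<in>V1 \<times> V2. x (Some i) j) + (\<Sum>i\<in>V1. ?r i) + (\<Sum>j\<in>V2. x None j) \<le> sum ?a V1 + y None"
      using xr[of None] by simp
    also have "\<dots> = k"
    proof -
      have "sum ?a (V1 - ?R\<inverse> `` {}) + sum ?b {} \<le> k"
        using \<open>(?a, ?b) \<in> packings V1 V2 ?R k\<close> unfolding packings_def by blast
      then have "sum ?a V1 \<le> k" by simp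
      then show ?thesis by (simp add: y_def)
    qed
    finally have "real ((\<Sum>(i, j)\<in>V1 \<times> V2. x (Some i) j) + (\<Sum>i\<in>V1. ?r i) + (\<Sum>j\<in>V2. x None j)) \<le> real k"
      by (simp only: of_nat_le_iff)
    then show ?thesis by (simp add: case_prod_unfold)
  qed
  have "0 \<le> (\<Sum>(i, j)\<in>V1 \<times> V2. real (x (Some i) j)) + (\<Sum>i\<in>V1. real (?r i)) + (\<Sum>j\<in>V2. real (x None j))"
    by (intro add_nonneg_nonneg sum_nonneg) auto
  from convex_scale_mono[OF cvx gen(1) this le w_in] show ?thesis by (simp only: w_eq[symmetric])
qed

lemma lattice_points_B_polytope:
  fixes E :: "'n::finite set set"
  assumes "bipartite_graph V1 V2 E" "V1 \<union> V2 = UNIV"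
  shows "((*\<^sub>R) (real k) ` B_polytope E) \<inter> {v. \<forall>i. v $ i \<in> \<int>} =
    {w. (\<forall>i. w $ i \<in> \<int>) \<and> abs_nat w \<in> stable_packings E UNIV k}"
proof (intro equalityI subsetI)
  fix w assume w: "w \<in> ((*\<^sub>R) (real k) ` B_polytope E) \<inter> {v. \<forall>i. v $ i \<in> \<int>}"
  then obtain x where x: "w = real k *\<^sub>R x" "x \<in> B_polytope E" by blast
  have "sum (abs_nat w) X \<le> k" if X: "\<forall>e\<in>E. \<not> e \<subseteq> X" for X
  proof -
    have "real (sum (abs_nat w) X) = (\<Sum>i\<in>X. \<bar>w $ i\<bar>)" using w by (simp add: real_abs_nat)
    also have "\<dots> = real k * (\<Sum>i\<in>X. \<bar>x $ i\<bar>)" by (simp add: x abs_mult sum_distrib_left)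
    also have "\<dots> \<le> real k * 1"
      by (intro mult_left_mono B_polytope_stable_bound[OF assms(1) x(2) X]) auto
    finally show ?thesis by (simp del: of_nat_sum)
  qed
  then show "w \<in> {w. (\<forall>i. w $ i \<in> \<int>) \<and> abs_nat w \<in> stable_packings E UNIV k}"
    using w by (simp add: stable_packings_def)
qed (use stable_packing_in_scaled_B_polytope[OF assms] in auto)

text \<open>A preimage is determined by the set of its negative coordinates, an arbitrary part of
  the support.\<close>

lemma card_sign_patterns:
  fixes v :: "'n::finite \<Rightarrow> nat"
  shows "card {w :: real ^ 'n. (\<forall>i. w $ i \<in> \<int>) \<and> abs_nat w = v} = 2 ^ card {i. v i \<noteq> 0}"
    and "finite {w :: real ^ 'n. (\<forall>i. w $ i \<in> \<int>) \<and> abs_nat w = v}"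
proof -
  let ?f = "\<lambda>S. \<chi> i. if i \<in> S then - real (v i) else real (v i)"
  let ?W = "{w :: real ^ 'n. (\<forall>i. w $ i \<in> \<int>) \<and> abs_nat w = v}"
  have "?W = ?f ` Pow {i. v i \<noteq> 0}"
  proof (intro equalityI subsetI)
    fix w assume w: "w \<in> ?W"
    have a: "\<bar>w $ i\<bar> = real (v i)" for i using w real_abs_nat[of w i] by auto
    have "w = ?f {i. w $ i < 0}"
    proof (rule vec_eq_iff[THEN iffD2], rule allI)
      fix i show "w $ i = ?f {i. w $ i < 0} $ i" using a[of i] by auto
    qed
    moreover have "{i. w $ i < 0} \<in> Pow {i. v i \<noteq> 0}" 
    proof -
      have "v i \<noteq> 0" if "w $ i < 0" for i using a[of i] that by auto
      then show ?thesis by blast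
    qed
    ultimately show "w \<in> ?f ` Pow {i. v i \<noteq> 0}" by blast
  next
    fix w assume "w \<in> ?f ` Pow {i. v i \<noteq> 0}"
    then show "w \<in> ?W" by (auto simp: abs_nat_def fun_eq_iff)
  qed
  moreover have "inj_on ?f (Pow {i. v i \<noteq> 0})"
  proof (rule inj_onI)
    fix S T assume S: "S \<in> Pow {i. v i \<noteq> 0}" and T: "T \<in> Pow {i. v i \<noteq> 0}" and eq: "?f S = ?f T"
    have "i \<in> S \<longleftrightarrow> i \<in> T" for i
    proof (cases "v i = 0")
      case False
      have "?f S $ i = ?f T $ i" using eq by simp
      then show ?thesis using False by (auto split: if_splits)
    qed (use S T in auto)
    then show "S = T" by blast
  qed
  ultimately show "card ?W = 2 ^ card {i. v i \<noteq> 0}" "finite ?W" by (simp_all add: card_image card_Pow)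
qed

theorem lattice_count_B_polytope:
  fixes E :: "'n::finite set set"
  assumes "bipartite_graph V1 V2 E" "V1 \<union> V2 = UNIV"
  shows "lattice_count (B_polytope E) k = (\<Sum>v\<in>stable_packings E UNIV k. 2 ^ card {i. v i \<noteq> 0})"
proof -
  let ?W = "\<lambda>v. {w :: real ^ 'n. (\<forall>i. w $ i \<in> \<int>) \<and> abs_nat w = v}"
  have "{w :: real ^ 'n. (\<forall>i. w $ i \<in> \<int>) \<and> abs_nat w \<in> stable_packings E UNIV k} =
      (\<Union>v\<in>stable_packings E UNIV k. ?W v)" by auto
  moreover have "card (\<Union>v\<in>stable_packings E UNIV k. ?W v) = (\<Sum>v\<in>stable_packings E UNIV k. card (?W v))"
    using finite_stable_packings[OF assms] card_sign_patterns(2) by (intro card_UN_disjoint) auto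
  ultimately show ?thesis
    by (simp add: lattice_count_def lattice_points_B_polytope[OF assms] card_sign_patterns(1))
qed


subsection \<open>The h*-polynomial\<close>

text \<open>Binomial theorem on the complement of \<open>U\<close>. It is used with
  \<open>a = 2\<close>, \<open>b = -1\<close>, where \<open>a + b = 1\<close> and only
  \<open>2 ^ card U\<close> remains, and with \<open>a = 2\<close>, \<open>b = [:-1, 1:]\<close>,
  where \<open>a + b\<close> is the polynomial \<open>x + 1\<close>.\<close>

lemma sum_supersets:
  fixes a b :: "'b::comm_semiring_1" and U :: "'n::finite set"
  shows "(\<Sum>S | U \<subseteq> S. a ^ card S * b ^ card (- S)) = a ^ card U * (a + b) ^ card (- U)"
proof -
  have "(\<Sum>S | U \<subseteq> S. a ^ card S * b ^ card (- S)) =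
    (\<Sum>S\<in>Pow (- U). a ^ card U * (a ^ card S * b ^ card (- U - S)))"
  proof (rule sum.reindex_bij_witness[where i = "\<lambda>S. U \<union> S" and j = "\<lambda>S. S - U"])
    fix S assume "S \<in> {S. U \<subseteq> S}"
    then have "- U - (S - U) = - S" "card S = card U + card (S - U)"
      by (auto simp: card_Diff_subset card_mono)
    then show "a ^ card U * (a ^ card (S - U) * b ^ card (- U - (S - U))) = a ^ card S * b ^ card (- S)"
      by (simp add: power_add mult.assoc)
  qed auto
  also have "\<dots> = a ^ card U * (\<Prod>x\<in>- U. a + b)"
  proof -
    have "(\<Prod>x\<in>- U. a + b) = (\<Sum>S\<in>Pow (- U). a ^ card S * b ^ card (- U - S))"
      using prod_add[of "- U" "\<lambda>_. a" "\<lambda>_. b"] by simp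
    then show ?thesis by (simp only: sum_distrib_left)
  qed
  finally show ?thesis by simp
qed

lemma stable_packings_restrict:
  "stable_packings E S k = {v \<in> stable_packings E UNIV k. {i. v i \<noteq> 0} \<subseteq> S}"
  by (auto simp: stable_packings_def)

text \<open>The weight of a vector becomes a signed sum over the coordinate sets that contain its
  support. What remains are unweighted counts, whose series is known for each
  \<open>S\<close>.\<close>

lemma lattice_count_alternating:
  fixes E :: "'n::finite set set"
  assumes "bipartite_graph V1 V2 E" "V1 \<union> V2 = UNIV"
  shows "real (lattice_count (B_polytope E) k) =
    (\<Sum>S\<in>UNIV. 2 ^ card S * (- 1) ^ card (- S) * real (card (stable_packings E S k)))"
proof -
  let ?P = "stable_packings E UNIV k"
  have fin: "finite ?P" by (rule finite_stable_packings[OF assms])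
  have "real (lattice_count (B_polytope E) k) = (\<Sum>v\<in>?P. 2 ^ card {i. v i \<noteq> 0})"
    by (simp add: lattice_count_B_polytope[OF assms])
  also have "\<dots> = (\<Sum>v\<in>?P. \<Sum>S | {i. v i \<noteq> 0} \<subseteq> S. 2 ^ card S * (- 1) ^ card (- S))"
    by (simp only: sum_supersets) simp
  also have "\<dots> = (\<Sum>v\<in>?P. \<Sum>S\<in>UNIV. if {i. v i \<noteq> 0} \<subseteq> S then 2 ^ card S * (- 1) ^ card (- S) else 0)"
    by (rule sum.cong[OF refl]) (simp add: sum.If_cases)
  also have "\<dots> = (\<Sum>S\<in>UNIV. \<Sum>v\<in>?P. if {i. v i \<noteq> 0} \<subseteq> S then 2 ^ card S * (- 1) ^ card (- S) else 0)"
    by (rule sum.swap)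
  also have "\<dots> = (\<Sum>S\<in>UNIV. 2 ^ card S * (- 1) ^ card (- S) * real (card (stable_packings E S k)))"
  proof (intro sum.cong refl)
    fix S :: "'n set"
    have "(\<Sum>v\<in>?P. if {i. v i \<noteq> 0} \<subseteq> S then 2 ^ card S * (- 1) ^ card (- S) else 0) =
      (\<Sum>v\<in>stable_packings E S k. 2 ^ card S * (- 1 :: real) ^ card (- S))"
      unfolding stable_packings_restrict[of E S] by (rule sum.inter_filter[OF fin, symmetric])
    then show "(\<Sum>v\<in>?P. if {i. v i \<noteq> 0} \<subseteq> S then 2 ^ card S * (- 1) ^ card (- S) else 0) =
      2 ^ card S * (- 1) ^ card (- S) * real (card (stable_packings E S k))" by simp
  qed
  finally show ?thesis .
qed

lemma lattice_count_0: "lattice_count (B_polytope E) 0 = 1"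
proof -
  have "(*\<^sub>R) (real 0) ` B_polytope E = {0}" using B_polytope_generators(1) by force
  then show ?thesis by (simp add: lattice_count_def)
qed

text \<open>The series of \<open>S\<close> uses up only the exponent \<open>card S + 1\<close>. The
  other factors \<open>1 - x\<close>, one for each element outside \<open>S\<close>, absorb the sign
  and become powers of \<open>x - 1\<close>.\<close>

lemma ehrhart_series_B_polytope:
  fixes E :: "'n::finite set set"
  assumes "bipartite_graph V1 V2 E" "V1 \<union> V2 = UNIV"
  shows "ehrhart_series (B_polytope E) * (1 - fps_X) ^ (CARD('n) + 1) =
    fps_of_poly (\<Sum>S\<in>UNIV. 2 ^ card S * [:-1, 1:] ^ card (- S) *
      support_poly (V1 \<inter> S) (bip_rel (V1 \<inter> S) (V2 \<inter> S) E))"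
proof -
  let ?F = "\<lambda>S. Abs_fps (\<lambda>k. real (card (stable_packings E S k)))"
  have "ehrhart_series (B_polytope E) = (\<Sum>S\<in>UNIV. fps_const (2 ^ card S * (- 1) ^ card (- S)) * ?F S)"
  proof (rule fps_ext)
    fix k
    have "fps_nth (ehrhart_series (B_polytope E)) k = real (lattice_count (B_polytope E) k)"
      by (simp add: ehrhart_series_def lattice_count_0)
    then show "fps_nth (ehrhart_series (B_polytope E)) k =
      fps_nth (\<Sum>S\<in>UNIV. fps_const (2 ^ card S * (- 1) ^ card (- S)) * ?F S) k"
      by (simp add: lattice_count_alternating[OF assms] fps_sum_nth)
  qed
  then have "ehrhart_series (B_polytope E) * (1 - fps_X) ^ (CARD('n) + 1) =
    (\<Sum>S\<in>UNIV. fps_const (2 ^ card S * (- 1) ^ card (- S)) * ?F S * (1 - fps_X) ^ (CARD('n) + 1))"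
    by (simp add: sum_distrib_right)
  also have "\<dots> = (\<Sum>S\<in>UNIV. fps_of_poly (2 ^ card S * [:-1, 1:] ^ card (- S) *
      support_poly (V1 \<inter> S) (bip_rel (V1 \<inter> S) (V2 \<inter> S) E)))"
  proof (intro sum.cong refl)
    fix S :: "'n set"
    have c: "CARD('n) + 1 = (card S + 1) + card (- S)"
      using card_Un_disjoint[of S "- S"] by simp
    have X: "fps_of_poly [:-1, 1:] = (- 1) * (1 - fps_X :: real fps)"
      by (simp add: fps_of_poly_pCons)
    have "fps_const (2 ^ card S * (- 1) ^ card (- S)) * ?F S * (1 - fps_X) ^ (CARD('n) + 1) =
      (fps_const (2 ^ card S) * (fps_const ((- 1) ^ card (- S)) * (1 - fps_X) ^ card (- S))) * (?F S * (1 - fps_X) ^ (card S + 1))"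
      unfolding c power_add by (simp add: mult_ac flip: fps_const_mult)
    also have "fps_const ((- 1 :: real) ^ card (- S)) * (1 - fps_X) ^ card (- S) = fps_of_poly ([:-1, 1:] ^ card (- S))"
    proof -
      have "fps_const ((- 1) ^ n) = (- 1 :: real fps) ^ n" for n
        by (metis fps_const_power fps_const_neg fps_const_1_eq_1)
      then show ?thesis by (simp only: fps_of_poly_power X power_mult_distrib)
    qed
    also have "fps_const (2 ^ card S) = fps_of_poly (2 ^ card S :: real poly)"
      by (simp add: fps_of_poly_power flip: fps_const_power)
    finally show "fps_const (2 ^ card S * (- 1) ^ card (- S)) * ?F S * (1 - fps_X) ^ (CARD('n) + 1) =
      fps_of_poly (2 ^ card S * [:-1, 1:] ^ card (- S) * support_poly (V1 \<inter> S) (bip_rel (V1 \<inter> S) (V2 \<inter> S) E))"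
      by (simp only: gf_stable_packings[OF assms] fps_of_poly_mult)
  qed
  finally show ?thesis by (simp only: fps_of_poly_sum)
qed

text \<open>The denominator has constant term 1 and is invertible, so the numerator in the definite
  description is unique.\<close>

lemma h_star_eqI:
  fixes P :: "(real ^ 'n) set"
  assumes "ehrhart_series P * (1 - fps_X) ^ (CARD('n) + 1) = fps_of_poly p"
  shows "h_star P = p"
proof -
  let ?D = "(1 - fps_X :: real fps) ^ (CARD('n) + 1)"
  have D0: "fps_nth ?D 0 \<noteq> 0" by (simp add: fps_power_zeroth)
  have inv: "inverse ?D * ?D = 1" by (rule inverse_mult_eq_1[OF D0])
  have "(ehrhart_series P = fps_of_poly q / ?D) \<longleftrightarrow> q = p" for q
  proof
    assume "ehrhart_series P = fps_of_poly q / ?D"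
    then have "ehrhart_series P * ?D = fps_of_poly q * (inverse ?D * ?D)"
      by (simp only: fps_divide_unit[OF D0] mult.assoc)
    then show "q = p" using assms inv by (simp only: mult_1_right fps_of_poly_eq_iff)
  next
    assume "q = p"
    then have "fps_of_poly q / ?D = ehrhart_series P * (inverse ?D * ?D)"
      by (simp only: fps_divide_unit[OF D0] assms[symmetric] mult_ac)
    then show "ehrhart_series P = fps_of_poly q / ?D" using inv by (simp only: mult_1_right)
  qed
  then show ?thesis unfolding h_star_def by (intro the_equality) blast+
qed

theorem h_star_B_polytope:
  fixes E :: "'n::finite set set"
  assumes "bipartite_graph V1 V2 E" "V1 \<union> V2 = UNIV"
  defines "I \<equiv> support_poly V1 (bip_rel V1 V2 E)"
  shows "h_star (B_polytope E) =
      (\<Sum>i\<le>CARD('n) div 2. smult (4 ^ i * coeff I i) (monom 1 i * [:1, 1:] ^ (CARD('n) - 2 * i)))"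
    and "degree I \<le> CARD('n) div 2"
proof -
  let ?d = "CARD('n)"
  let ?p = "\<lambda>S. 2 ^ card S * [:-1, 1:] ^ card (- S) * support_poly (V1 \<inter> S) (bip_rel (V1 \<inter> S) (V2 \<inter> S) E)"
  obtain m where m: "\<And>Y. support_poly (V1 \<inter> Y) (bip_rel (V1 \<inter> Y) (V2 \<inter> Y) E) =
      (\<Sum>T\<in>Pow Y. smult (m T) (monom 1 (card T div 2)))"
    and ev: "\<And>T. m T \<noteq> 0 \<Longrightarrow> even (card T)"
    using support_poly_balanced_expansion[OF assms(1,2)] by metis
  let ?t = "\<lambda>T S. smult (m T) (monom 1 (card T div 2)) * (2 ^ card S * [:-1, 1:] ^ card (- S))"
  let ?q = "\<lambda>T. smult (m T * 4 ^ (card T div 2)) (monom 1 (card T div 2) * [:1, 1:] ^ (?d - 2 * (card T div 2)))"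
  have I: "I = (\<Sum>T\<in>UNIV. smult (m T) (monom 1 (card T div 2)))"
    using m[of UNIV] by (simp add: I_def)
  have cd: "card T div 2 \<le> ?d div 2" for T :: "'n set" by (intro div_le_mono card_mono) auto
  show "degree I \<le> ?d div 2"
    unfolding I by (intro degree_sum_le) (auto intro: order.trans[OF degree_smult_le] order.trans[OF degree_monom_le] cd)
  have "(\<Sum>S\<in>UNIV. ?p S) =
    (\<Sum>S\<in>UNIV. \<Sum>T\<in>UNIV. if T \<subseteq> S then ?t T S else 0)"
  proof (intro sum.cong refl)
    fix S :: "'n set"
    have "?p S =
      (\<Sum>T\<in>Pow S. ?t T S)"
      unfolding m by (subst mult.commute) (simp only: sum_distrib_right)
    also have "\<dots> = (\<Sum>T\<in>UNIV. if T \<subseteq> S then ?t T S else 0)"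
      by (intro sum.mono_neutral_cong_left) auto
    finally show "?p S = \<dots>" .
  qed
  also have "\<dots> = (\<Sum>T\<in>UNIV. \<Sum>S\<in>UNIV. if T \<subseteq> S then ?t T S else 0)"
    by (rule sum.swap)
  also have "\<dots> = (\<Sum>T\<in>UNIV. ?q T)"
  proof (intro sum.cong refl)
    fix T :: "'n set"
    have "(\<Sum>S\<in>UNIV. if T \<subseteq> S then ?t T S else 0) =
      (\<Sum>S | T \<subseteq> S. ?t T S)"
      by (intro sum.mono_neutral_cong_right) auto
    also have "\<dots> = smult (m T) (monom 1 (card T div 2)) * (\<Sum>S | T \<subseteq> S. 2 ^ card S * [:-1, 1:] ^ card (- S))"
      by (simp only: sum_distrib_left)
    also have "(\<Sum>S | T \<subseteq> S. 2 ^ card S * [:-1, 1:] ^ card (- S)) = 2 ^ card T * (2 + [:-1, 1:]) ^ card (- T)"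
      by (rule sum_supersets)
    also have "2 + [:-1, 1 :: real:] = [:1, 1:]" by (simp add: numeral_poly)
    \<comment> \<open>A nonzero \<open>m T\<close> forces \<open>card T = 2 * r\<close>; hence
      \<open>2 ^ card T\<close> is \<open>4 ^ r\<close> and \<open>card (- T)\<close> is
      \<open>d - 2 * r\<close>.\<close>
    also have "smult (m T) (monom 1 (card T div 2)) * (2 ^ card T * [:1, 1:] ^ card (- T)) =
      ?q T"
    proof (cases "m T = 0")
      case False
      then obtain r where r: "card T = 2 * r" using ev by blast
      have "card (- T) = ?d - 2 * r" by (simp add: Compl_eq_Diff_UNIV card_Diff_subset r)
      moreover have "(2 :: real poly) ^ (2 * r) = [:4 ^ r:]"
        by (simp add: power_mult power2_eq_square numeral_poly poly_const_pow)
      ultimately show ?thesis by (simp add: r mult.commute)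
    qed simp
    finally show "(\<Sum>S\<in>UNIV. if T \<subseteq> S then ?t T S else 0) =
      ?q T" .
  qed
  also have "\<dots> = (\<Sum>i\<le>?d div 2. \<Sum>T | T \<in> UNIV \<and> card T div 2 = i.
      ?q T)"
    using cd by (intro sum.group[symmetric]) auto
  also have "\<dots> = (\<Sum>i\<le>?d div 2. smult (4 ^ i * coeff I i) (monom 1 i * [:1, 1:] ^ (?d - 2 * i)))"
  proof (intro sum.cong refl)
    fix i
    have "coeff I i = (\<Sum>T\<in>UNIV. if card T div 2 = i then m T else 0)"
      unfolding I coeff_sum by (intro sum.cong) auto
    also have "\<dots> = (\<Sum>T | T \<in> UNIV \<and> card T div 2 = i. m T)"
      by (rule sum.inter_filter[symmetric]) simp
    finally have "4 ^ i * coeff I i = (\<Sum>T | T \<in> UNIV \<and> card T div 2 = i. m T * 4 ^ (card T div 2))"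
      by (simp add: sum_distrib_left mult.commute)
    then show "(\<Sum>T | T \<in> UNIV \<and> card T div 2 = i.
      ?q T) =
      smult (4 ^ i * coeff I i) (monom 1 i * [:1, 1:] ^ (?d - 2 * i))"
      by (simp add: smult_sum)
  qed
  finally show "h_star (B_polytope E) =
      (\<Sum>i\<le>?d div 2. smult (4 ^ i * coeff I i) (monom 1 i * [:1, 1:] ^ (?d - 2 * i)))"
    using ehrhart_series_B_polytope[OF assms(1,2)] by (intro h_star_eqI) simp
qed


subsection \<open>Real-rootedness\<close>

lemma map_poly_of_real_mult:
  "map_poly (of_real :: real \<Rightarrow> 'a::real_field) (p * q) = map_poly of_real p * map_poly of_real q"
  by (rule poly_eqI) (simp add: coeff_map_poly coeff_mult)

lemma map_poly_of_real_sum: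
  "map_poly (of_real :: real \<Rightarrow> 'a::real_field) (\<Sum>i\<in>A. f i) = (\<Sum>i\<in>A. map_poly of_real (f i))"
  by (rule poly_eqI) (simp add: coeff_map_poly coeff_sum)

lemma map_poly_of_real_smult:
  "map_poly (of_real :: real \<Rightarrow> 'a::real_field) (smult c p) = smult (of_real c) (map_poly of_real p)"
  by (rule poly_eqI) (simp add: coeff_map_poly)

lemma map_poly_of_real_power:
  "map_poly (of_real :: real \<Rightarrow> 'a::real_field) (p ^ n) = map_poly of_real p ^ n"
  by (induction n) (simp_all add: map_poly_of_real_mult)

lemma poly_map_of_real_eq_sum:
  fixes z :: "'a::real_field"
  assumes "degree p \<le> n"
  shows "poly (map_poly of_real p) z = (\<Sum>i\<le>n. of_real (coeff p i) * z ^ i)"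
proof -
  have "degree (map_poly (of_real :: real \<Rightarrow> 'a) p) \<le> n" 
    using assms by (intro degree_le) (simp add: coeff_map_poly coeff_eq_0)
  then have "poly (map_poly of_real p) z = (\<Sum>i\<le>n. coeff (map_poly of_real p) i * z ^ i)"
    unfolding poly_altdef by (intro sum.mono_neutral_left) (auto simp: coeff_eq_0)
  then show ?thesis by (simp add: coeff_map_poly)
qed

definition gamma_transform :: "nat \<Rightarrow> real poly \<Rightarrow> real poly" where
  "gamma_transform d q = (\<Sum>i\<le>d div 2. smult (4 ^ i * coeff q i) (monom 1 i * [:1, 1:] ^ (d - 2 * i)))"

text \<open>Stated over any \<open>real_field\<close>: the reals give the formula for the
  h*-polynomial, the complex numbers the correspondence of roots. For \<open>i \<le> d div 2\<close>
  the exponent \<open>d - 2 * i\<close> does not truncate, so \<open>(z + 1) ^ d\<close> clears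
  every denominator.\<close>

lemma poly_gamma_transform:
  fixes z :: "'a::real_field"
  assumes "degree q \<le> d div 2" "z \<noteq> - 1"
  shows "poly (map_poly of_real (gamma_transform d q)) z =
    (z + 1) ^ d * poly (map_poly of_real q) (4 * z / (z + 1)\<^sup>2)"
proof -
  have z1: "z + 1 \<noteq> 0" using assms(2) by (simp add: add_eq_0_iff2)
  have lin: "map_poly (of_real :: real \<Rightarrow> 'a) [:1, 1:] = [:1, 1:]" by (simp add: map_poly_pCons)
  have "poly (map_poly of_real (gamma_transform d q)) z =
    (\<Sum>i\<le>d div 2. of_real (4 ^ i * coeff q i) * (z ^ i * (z + 1) ^ (d - 2 * i)))"
    unfolding gamma_transform_def map_poly_of_real_sum poly_sum
    by (intro sum.cong refl)
      (simp add: map_poly_of_real_smult map_poly_of_real_mult map_poly_of_real_power map_poly_monom lin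
        poly_monom add.commute)
  also have "\<dots> = (\<Sum>i\<le>d div 2. (z + 1) ^ d * (of_real (coeff q i) * (4 * z / (z + 1)\<^sup>2) ^ i))"
  proof (intro sum.cong refl)
    fix i assume "i \<in> {..d div 2}"
    then have "d = 2 * i + (d - 2 * i)" by auto
    then have "(z + 1) ^ d = ((z + 1)\<^sup>2) ^ i * (z + 1) ^ (d - 2 * i)" by (metis power_add power_mult)
    moreover define u v where "u = ((z + 1)\<^sup>2) ^ i" and "v = (z + 1) ^ (d - 2 * i)"
    moreover have "u \<noteq> 0" using z1 by (simp add: u_def)
    moreover have "(4 * z / (z + 1)\<^sup>2) ^ i = 4 ^ i * z ^ i / u"
      by (simp only: u_def power_divide power_mult_distrib)
    ultimately have "(z + 1) ^ d = u * v" "(4 * z / (z + 1)\<^sup>2) ^ i = 4 ^ i * z ^ i / u" "u \<noteq> 0" by simp_all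
    then show "of_real (4 ^ i * coeff q i) * (z ^ i * (z + 1) ^ (d - 2 * i)) =
      (z + 1) ^ d * (of_real (coeff q i) * (4 * z / (z + 1)\<^sup>2) ^ i)"
      by (simp add: v_def)
  qed
  also have "\<dots> = (z + 1) ^ d * poly (map_poly of_real q) (4 * z / (z + 1)\<^sup>2)"
    by (simp only: poly_map_of_real_eq_sum[OF assms(1)] sum_distrib_left)
  finally show ?thesis .
qed

text \<open>The roots correspond under \<open>z \<mapsto> 4 * z / (z + 1)\<^sup>2\<close>. Every
  nonzero \<open>w\<close> has a preimage, and a real preimage makes \<open>w\<close> real.
  Conversely a real root of \<open>q\<close> is negative by the signs of the coefficients, and a
  negative number has only real preimages. The exceptional point -1 is real itself.\<close>

lemma real_rooted_gamma_transform:
  assumes "degree q \<le> d div 2" "\<And>i. 0 \<le> coeff q i" "0 < coeff q 0"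
  shows "real_rooted (gamma_transform d q) \<longleftrightarrow> real_rooted q"
proof
  assume r: "real_rooted (gamma_transform d q)"
  show "real_rooted q"
    unfolding real_rooted_def
  proof (intro allI impI)
    fix w :: complex assume w: "poly (map_poly of_real q) w = 0"
    show "w \<in> \<real>"
    proof (cases "w = 0")
      case False
      \<comment> \<open>One solution of the quadratic equation
        \<open>w * (z + 1)\<^sup>2 = 4 * z\<close>.\<close>
      define z where "z = (2 - w + 2 * csqrt (1 - w)) / w"
      have sq: "(csqrt (1 - w))\<^sup>2 = 1 - w" by simp
      have "w * (z + 1) = 2 + 2 * csqrt (1 - w)" using False by (simp add: z_def field_simps)
      moreover have "w * (w * (z + 1)\<^sup>2) = (w * (z + 1))\<^sup>2" by (simp add: power2_eq_square mult_ac)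
      ultimately have "w * (w * (z + 1)\<^sup>2) = (2 + 2 * csqrt (1 - w))\<^sup>2" by metis
      also have "\<dots> = 4 * (2 - w + 2 * csqrt (1 - w))" 
      proof -
        have "(2 + 2 * c)\<^sup>2 = 4 + 8 * c + 4 * c\<^sup>2" for c :: complex
          by (simp add: power2_eq_square algebra_simps)
        from this[of "csqrt (1 - w)", unfolded sq] show ?thesis by (simp only:) (simp add: algebra_simps)
      qed
      also have "\<dots> = w * (4 * z)" using False by (simp add: z_def)
      finally have e: "w * (z + 1)\<^sup>2 = 4 * z" using False by simp
      then have z1: "z \<noteq> - 1" by auto
      then have "(z + 1)\<^sup>2 \<noteq> 0" by (simp add: add_eq_0_iff2)
      then have "4 * z / (z + 1)\<^sup>2 = w" using e by (simp add: field_simps)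
      then have "poly (map_poly of_real (gamma_transform d q)) z = 0"
        using poly_gamma_transform[OF assms(1) z1] w by simp
      then have "z \<in> \<real>" using r by (auto simp: real_rooted_def)
      then have "4 * z / (z + 1)\<^sup>2 \<in> \<real>" by simp
      then show ?thesis using \<open>4 * z / (z + 1)\<^sup>2 = w\<close> by simp
    qed simp
  qed
next
  assume r: "real_rooted q"
  show "real_rooted (gamma_transform d q)"
    unfolding real_rooted_def
  proof (intro allI impI)
    fix z :: complex assume z: "poly (map_poly of_real (gamma_transform d q)) z = 0"
    show "z \<in> \<real>"
    proof (cases "z = - 1")
      case False
      then have z1: "z + 1 \<noteq> 0" by (simp add: add_eq_0_iff2)
      define w where "w = 4 * z / (z + 1)\<^sup>2"
      have "poly (map_poly of_real q) w = 0"
        using poly_gamma_transform[OF assms(1) False] z z1 by (simp add: w_def)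
      moreover from this have "w \<in> \<real>" using r by (auto simp: real_rooted_def)
      then obtain t where t: "w = of_real t" by (auto elim: Reals_cases)
      moreover have "poly (map_poly of_real q) (of_real t :: complex) = of_real (poly q t)"
        using poly_map_of_real_eq_sum[OF assms(1), of "of_real t :: complex"] poly_map_of_real_eq_sum[OF assms(1), of t]
        by (simp add: of_real_eq_id)
      ultimately have qt: "poly q t = 0" by simp
      have t0: "t < 0"
      proof (rule ccontr)
        assume "\<not> t < 0"
        then have "coeff q 0 * t ^ 0 \<le> (\<Sum>i\<le>d div 2. coeff q i * t ^ i)"
          using assms(2) by (intro member_le_sum) auto
        also have "\<dots> = poly q t" using poly_map_of_real_eq_sum[OF assms(1), of t] by (simp add: of_real_eq_id)
        finally show False using qt assms(3) by simp
      qed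
      \<comment> \<open>Completing the square in \<open>t * (z + 1)\<^sup>2 = 4 * z\<close> gives
        \<open>(z + b)\<^sup>2 = b\<^sup>2 - 1\<close>, and \<open>t < 0\<close> means
        \<open>b > 1\<close>.\<close>
      define b where "b = 1 - 2 / t"
      have "b > 1" using t0 by (simp add: b_def field_simps)
      then have s: "b\<^sup>2 - 1 > 0" by (simp add: one_less_power)
      have "of_real t * (z + 1)\<^sup>2 = 4 * z" using z1 t by (simp add: w_def field_simps)
      moreover have "t * b = t - 2" using t0 by (simp add: b_def field_simps)
      then have "of_real t * of_real b = (of_real t - 2 :: complex)" by (simp flip: of_real_mult)
      moreover have "\<tau> * (z + \<beta>)\<^sup>2 - \<tau> * (\<beta>\<^sup>2 - 1) = (\<tau> * (z + 1)\<^sup>2 - 4 * z) + 2 * z * (\<tau> * \<beta> - (\<tau> - 2))"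
        for \<tau> \<beta> :: complex by (simp add: power2_eq_square algebra_simps)
      ultimately have "of_real t * (z + of_real b)\<^sup>2 - of_real t * ((of_real b)\<^sup>2 - 1) = 0" by simp
      then have "of_real t * (z + of_real b)\<^sup>2 = of_real t * of_real (b\<^sup>2 - 1)" by simp
      then have "(z + of_real b)\<^sup>2 = of_real (b\<^sup>2 - 1)" using t0 by simp
      also have "\<dots> = (of_real (sqrt (b\<^sup>2 - 1)))\<^sup>2" using s by (simp flip: of_real_power)
      finally have "z + of_real b = of_real (sqrt (b\<^sup>2 - 1)) \<or> z + of_real b = - of_real (sqrt (b\<^sup>2 - 1))"
        by (simp only: power2_eq_iff)
      then have "z = of_real (sqrt (b\<^sup>2 - 1) - b) \<or> z = of_real (- sqrt (b\<^sup>2 - 1) - b)"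
        by (auto simp: algebra_simps add_eq_0_iff)
      then show ?thesis by (metis Reals_of_real)
    qed simp
  qed
qed


subsection \<open>Independence of the ordering of the hyperedges\<close>

text \<open>Bases of the integral polymatroid whose rank function counts the neighbours of a
  set.\<close>

definition bases :: "'a set \<Rightarrow> ('a \<times> 'b) set \<Rightarrow> ('a \<Rightarrow> nat) set" where
  "bases A R = {f \<in> indep A R. sum f A = card (R `` A)}"

definition transfer :: "('a \<Rightarrow> nat) \<Rightarrow> 'a \<Rightarrow> 'a \<Rightarrow> 'a \<Rightarrow> nat" where
  "transfer f j j' = f(j := f j - 1, j' := f j' + 1)"

lemma sum_transfer:
  assumes "finite S" "0 < f j" "j \<noteq> j'"
  shows "sum (transfer f j j') S + (if j \<in> S then 1 else 0) = sum f S + (if j' \<in> S then 1 else 0)"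
  using assms
proof (induction S rule: finite_induct)
  case (insert x S)
  then show ?case by (auto simp: transfer_def)
qed simp

lemma card_Image_submodular:
  assumes "finite B" "R \<subseteq> A \<times> B"
  shows "card (R `` (S \<union> T)) + card (R `` (S \<inter> T)) \<le> card (R `` S) + card (R `` T)"
proof -
  have fin: "finite (R `` X)" for X using assms finite_subset[of "R `` X" B] by blast
  have "card (R `` (S \<inter> T)) \<le> card (R `` S \<inter> R `` T)" using fin by (intro card_mono) auto
  moreover have "card (R `` S \<union> R `` T) + card (R `` S \<inter> R `` T) = card (R `` S) + card (R `` T)"
    using card_Un_Int[OF fin fin] by metis
  ultimately show ?thesis by (simp add: Image_Un)
qed

text \<open>By submodularity of the number of neighbours, two tight sets leave no slack for their
  union.\<close>

lemma indep_tight_UN: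
  assumes "finite A" "finite B" "R \<subseteq> A \<times> B" "f \<in> indep A R" "finite \<F>"
    "\<And>S. S \<in> \<F> \<Longrightarrow> S \<subseteq> A \<and> sum f S = card (R `` S)"
  shows "sum f (\<Union>\<F>) = card (R `` \<Union>\<F>)"
  using assms(5,6)
proof (induction rule: finite_induct)
  case (insert S \<F>)
  let ?T = "\<Union>\<F>"
  have ST: "S \<subseteq> A" "?T \<subseteq> A" "finite S" "finite ?T"
    using insert.prems assms(1) finite_subset[of S A] finite_subset[of ?T A] by blast+
  have "sum f (S \<union> ?T) + sum f (S \<inter> ?T) = sum f S + sum f ?T"
    using ST by (intro sum_Un_Int_nat)
  moreover have "sum f S = card (R `` S)" "sum f ?T = card (R `` ?T)" using insert by auto
  moreover have "sum f (S \<union> ?T) \<le> card (R `` (S \<union> ?T))" "sum f (S \<inter> ?T) \<le> card (R `` (S \<inter> ?T))"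
    using indepD[OF assms(4)] ST by blast+
  ultimately have "sum f (S \<union> ?T) = card (R `` (S \<union> ?T))"
    using card_Image_submodular[OF assms(2,3), of S ?T] by linarith
  then show ?case by simp
qed simp

text \<open>If no exchange were possible, each \<open>j'\<close> with \<open>f j' < f' j'\<close>
  would lie in a tight set of \<open>f\<close> that avoids \<open>j\<close>. On the tight union of
  these sets \<open>f'\<close> has no larger sum than \<open>f\<close>; outside it \<open>f'\<close>
  is at most \<open>f\<close>, and smaller at \<open>j\<close>. This contradicts the equal
  totals.\<close>

lemma bases_exchange:
  assumes "finite A" "finite B" "R \<subseteq> A \<times> B" "f \<in> bases A R" "f' \<in> bases A R" "f' j < f j"
  obtains j' where "j' \<in> A" "f j' < f' j'" "transfer f j j' \<in> bases A R"
proof -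
  have f: "f \<in> indep A R" "sum f A = card (R `` A)" and f': "f' \<in> indep A R" "sum f' A = card (R `` A)"
    using assms(4,5) by (auto simp: bases_def)
  have jA: "j \<in> A" using f(1) assms(6) by (auto simp: indep_def)
  have fin: "finite S" if "S \<subseteq> A" for S using that assms(1) finite_subset by blast
  show thesis
  proof (cases "\<exists>j'\<in>A. f j' < f' j' \<and> transfer f j j' \<in> bases A R")
    case False
    define \<F> where "\<F> = {S. S \<subseteq> A \<and> j \<notin> S \<and> sum f S = card (R `` S)}"
    have tight: "\<exists>S\<in>\<F>. j' \<in> S" if j': "j' \<in> A" "f j' < f' j'" for j'
    proof -
      have ne: "j \<noteq> j'" using assms(6) j' by auto
      have "sum (transfer f j j') A = card (R `` A)"
        using sum_transfer[OF assms(1), of f j j'] ne assms(6) jA j' f by simp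
      moreover have "transfer f j j' i = 0" if "i \<notin> A" for i
        using that f(1) jA j' by (auto simp: transfer_def indep_def)
      moreover have "transfer f j j' \<notin> bases A R" using False j' by blast
      ultimately obtain S where S: "S \<subseteq> A" "\<not> sum (transfer f j j') S \<le> card (R `` S)"
        by (auto simp: bases_def indep_def)
      moreover have "sum f S \<le> card (R `` S)" using indepD[OF f(1) S(1)] .
      ultimately have "j' \<in> S" "j \<notin> S" "sum f S = card (R `` S)"
        using sum_transfer[OF fin[OF S(1)], of f j j'] ne assms(6) by (auto split: if_splits)
      then show ?thesis using S(1) by (auto simp: \<F>_def)
    qed
    have "finite \<F>" using assms(1) by (simp add: \<F>_def)
    then have U: "sum f (\<Union>\<F>) = card (R `` \<Union>\<F>)"
      by (intro indep_tight_UN[OF assms(1-3) f(1)]) (auto simp: \<F>_def)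
    have UA: "\<Union>\<F> \<subseteq> A" and jU: "j \<notin> \<Union>\<F>" by (auto simp: \<F>_def)
    have "sum f' (\<Union>\<F>) \<le> sum f (\<Union>\<F>)" using indepD[OF f'(1) UA] U by simp
    moreover have "sum f' (A - \<Union>\<F>) < sum f (A - \<Union>\<F>)"
    proof (rule sum_strict_mono_ex1)
      show "\<forall>i\<in>A - \<Union>\<F>. f' i \<le> f i" using tight by (auto simp: not_less[symmetric])
      show "\<exists>i\<in>A - \<Union>\<F>. f' i < f i" using jA jU assms(6) by blast
    qed (use assms(1) in simp)
    ultimately have "sum f' A < sum f A"
      using sum.subset_diff[OF UA assms(1), of f] sum.subset_diff[OF UA assms(1), of f'] by linarith
    then show thesis using f f' by simp
  qed (use that in blast)
qed

text \<open>The order of the hyperedges is carried by a ranking \<open>r\<close>, so that a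
  reordering changes \<open>r\<close> and leaves the bases alone.\<close>

definition inactive :: "'a set \<Rightarrow> ('a \<times> 'b) set \<Rightarrow> ('a \<Rightarrow> nat) \<Rightarrow> ('a \<Rightarrow> nat) \<Rightarrow> 'a set" where
  "inactive A R r f = {j \<in> A. \<exists>j'\<in>A. r j' < r j \<and> 0 < f j \<and> transfer f j j' \<in> bases A R}"

text \<open>Since \<open>u\<close> may be negative, the number of these vectors has generating function
  \<open>1 / (1 - x)\<close> to the number of active coordinates, summed over the bases.\<close>

definition below :: "'a set \<Rightarrow> ('a \<times> 'b) set \<Rightarrow> nat \<Rightarrow> ('a \<Rightarrow> int) set" where
  "below A R k = {u. (\<exists>f\<in>bases A R. \<forall>i. u i \<le> int (f i)) \<and> (\<forall>i. i \<notin> A \<longrightarrow> u i = 0) \<and>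
     sum u A + int k = int (card (R `` A))}"

text \<open>For injectivity, consider the coordinate of highest rank where two bases over the same
  \<open>u\<close> differ. The exchanged unit goes to a coordinate of lower rank, so the larger
  basis is inactive there and hence equal to \<open>u\<close>, while the smaller one would drop
  below \<open>u\<close>.\<close>

lemma below_bij:
  assumes "finite A" "finite B" "R \<subseteq> A \<times> B" "inj_on r A"
  shows "bij_betw (\<lambda>(f, m) i. int (f i) - int (m i))
    (SIGMA f:bases A R. supplies (A - inactive A R r f) k) (below A R k)"
    (is "bij_betw ?h ?X ?Y")
proof (rule bij_betw_imageI)
  have uniq: "f' j \<ge> f j"
    if f: "f \<in> bases A R" "f' \<in> bases A R" and m: "m \<in> supplies (A - inactive A R r f) k"
      and eq: "\<forall>i. int (f i) - int (m i) = int (f' i) - int (m' i)"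
      and max: "\<forall>i\<in>A. f i \<noteq> f' i \<longrightarrow> r i \<le> r j" for f f' m m' j
  proof (rule ccontr)
    assume "\<not> f' j \<ge> f j"
    then have lt: "f' j < f j" by simp
    obtain j' where j': "j' \<in> A" "f j' < f' j'" "transfer f j j' \<in> bases A R"
      using bases_exchange[OF assms(1-3) f lt] by blast
    have jA: "j \<in> A" using f(1) lt by (auto simp: bases_def indep_def)
    have "j' \<noteq> j" using lt j' by auto
    then have "r j' \<noteq> r j" using assms(4) j'(1) jA by (auto dest: inj_onD)
    moreover have "r j' \<le> r j" using max j' by auto
    ultimately have "r j' < r j" by simp
    then have "j \<in> inactive A R r f"
      unfolding inactive_def using j' jA lt by (intro CollectI conjI bexI[of _ j']) auto
    then have "m j = 0" using m by (auto simp: supplies_def)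
    moreover have "int (f j) - int (m j) = int (f' j) - int (m' j)" using eq by blast
    ultimately show False using lt by linarith
  qed
  show "inj_on ?h ?X"
  proof (rule inj_onI)
    fix s t assume s: "s \<in> ?X" and t: "t \<in> ?X" and eq: "?h s = ?h t"
    obtain f m f' m' where st: "s = (f, m)" "t = (f', m')" by (cases s, cases t)
    have eq': "\<forall>i. int (f i) - int (m i) = int (f' i) - int (m' i)"
      using eq by (simp add: st fun_eq_iff)
    have F: "f \<in> bases A R" "f' \<in> bases A R" "m \<in> supplies (A - inactive A R r f) k"
      "m' \<in> supplies (A - inactive A R r f') k" using s t by (auto simp: st)
    have "f = f'"
    proof (rule ccontr)
      assume ne: "f \<noteq> f'"
      let ?D = "{i \<in> A. f i \<noteq> f' i}"
      have "f i = f' i" if "i \<notin> A" for i using F(1,2) that by (simp add: bases_def indep_def)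
      then have D: "?D \<noteq> {}" "finite ?D" using ne assms(1) by (auto simp: fun_eq_iff)
      then have "Max (r ` ?D) \<in> r ` ?D" by (intro Max_in) auto
      then obtain j where j: "j \<in> ?D" "r j = Max (r ` ?D)" by force
      have "\<forall>i\<in>?D. r i \<le> r j" unfolding j(2) using D(2) by (intro ballI Max_ge) auto
      then have max: "\<forall>i\<in>A. f i \<noteq> f' i \<longrightarrow> r i \<le> r j" "\<forall>i\<in>A. f' i \<noteq> f i \<longrightarrow> r i \<le> r j" by auto
      have "f' j \<ge> f j" by (rule uniq[OF F(1,2,3) eq' max(1)])
      moreover have "\<forall>i. int (f' i) - int (m' i) = int (f i) - int (m i)" using eq' by simp
      then have "f j \<ge> f' j" by (rule uniq[OF F(2,1,4) _ max(2)])
      ultimately show False using j by simp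
    qed
    moreover from this have "m = m'" using eq' by (auto simp: fun_eq_iff)
    ultimately show "s = t" by (simp add: st)
  qed
  show "?h ` ?X = ?Y"
  proof (intro equalityI subsetI)
    fix u assume "u \<in> ?h ` ?X"
    then obtain f m where u: "u = (\<lambda>i. int (f i) - int (m i))" and f: "f \<in> bases A R"
      and m: "m \<in> supplies (A - inactive A R r f) k" by auto
    have m0: "m i = 0" if "i \<notin> A" for i using m that by (simp add: supplies_def)
    have "sum m A = sum m (A - inactive A R r f)"
      using m assms(1) by (intro sum.mono_neutral_right) (auto simp: supplies_def)
    then have "sum m A = k" using m by (simp add: supplies_def)
    then have "sum u A + int k = int (sum f A)" by (simp add: u sum_subtractf flip: of_nat_sum)
    then have "sum u A + int k = int (card (R `` A))" using f by (simp add: bases_def del: of_nat_sum)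
    moreover have "u i = 0" if "i \<notin> A" for i using f m0 that by (simp add: u bases_def indep_def)
    moreover have "\<forall>i. u i \<le> int (f i)" by (simp add: u)
    ultimately show "u \<in> ?Y" using f by (auto simp: below_def)
  next
    fix u assume u: "u \<in> ?Y"
    txt \<open>Minimality of \<open>?w\<close> rules out moving a unit to an earlier coordinate.\<close>
    let ?ok = "\<lambda>f. f \<in> bases A R \<and> (\<forall>i. u i \<le> int (f i))"
    let ?w = "\<lambda>f. \<Sum>i\<in>A. f i * r i"
    obtain f0 where "?ok f0" using u by (auto simp: below_def)
    then obtain f where f: "?ok f" "\<And>f'. ?ok f' \<Longrightarrow> ?w f \<le> ?w f'"
      using ex_has_least_nat[of ?ok f0 ?w] by blast
    define m where "m i = nat (int (f i) - u i)" for i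
    have m: "int (m i) = int (f i) - u i" for i using f(1) by (simp add: m_def)
    have u0: "u i = 0" if "i \<notin> A" for i using u that by (simp add: below_def)
    have m0: "m i = 0" if "i \<notin> A" for i using u0[OF that] f(1) that by (simp add: m_def bases_def indep_def)
    have act: "m j = 0" if j: "j \<in> inactive A R r f" for j
    proof (rule ccontr)
      assume "m j \<noteq> 0"
      then have lt: "u j < int (f j)" using m[of j] by linarith
      obtain j' where j': "j' \<in> A" "r j' < r j" "0 < f j" "transfer f j j' \<in> bases A R" and jA: "j \<in> A"
        using j by (auto simp: inactive_def)
      have ne: "j \<noteq> j'" using j' by auto
      have "u i \<le> int (transfer f j j' i)" for i
      proof -
        have "u i \<le> int (f i)" using f(1) by blast
        then show ?thesis using lt j' by (auto simp: transfer_def)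
      qed
      then have "?w f \<le> ?w (transfer f j j')" using j'(4) by (intro f(2)) blast
      moreover have "?w (transfer f j j') + r j = ?w f + r j'"
      proof -
        have A: "A = insert j (insert j' (A - {j, j'}))" using j' jA by auto
        have rest: "(\<Sum>i\<in>A - {j, j'}. transfer f j j' i * r i) = (\<Sum>i\<in>A - {j, j'}. f i * r i)"
          by (intro sum.cong) (auto simp: transfer_def)
        have split: "?w g = g j * r j + (g j' * r j' + (\<Sum>i\<in>A - {j, j'}. g i * r i))" for g
          by (subst A) (use assms(1) ne in simp)
        have "(f j - 1) * r j + r j = f j * r j" using j'(3) by (cases "f j") auto
        moreover have "transfer f j j' j = f j - 1" "transfer f j j' j' = f j' + 1"
          using ne by (auto simp: transfer_def)
        ultimately show ?thesis unfolding split[of f] split[of "transfer f j j'"] rest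
          by (simp only:) (simp add: algebra_simps)
      qed
      ultimately show False using j'(2) by linarith
    qed
    have "int (sum m A) = int (sum f A) - sum u A" by (simp add: m sum_subtractf)
    then have "sum m A = k" using u f(1) by (simp add: below_def bases_def del: of_nat_sum)
    moreover have "sum m A = sum m (A - inactive A R r f)"
      using act assms(1) by (intro sum.mono_neutral_right) auto
    ultimately have "m \<in> supplies (A - inactive A R r f) k" using m0 act by (auto simp: supplies_def)
    then have "(f, m) \<in> ?X" using f(1) by blast
    moreover have "?h (f, m) = u" by (simp add: m)
    ultimately show "u \<in> ?h ` ?X" by force
  qed
qed

section \<open>The series of the vectors below bases\<close>

lemma gf_supplies:
  assumes "finite S"
  shows "Abs_fps (\<lambda>k. real (card (supplies S k))) * (1 - fps_X) ^ card S = 1"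
proof -
  have bij: "bij_betw (\<lambda>f i. if i \<in> S then f i else 0) {f \<in> PiE S (\<lambda>_. UNIV). (\<Sum>i\<in>S. f i) = k} (supplies S k)" for k
    by (rule bij_betw_byWitness[where f' = "\<lambda>f. restrict f S"])
      (auto simp: supplies_def fun_eq_iff PiE_def extensional_def)
  have "card (supplies S k) = card {f \<in> PiE S (\<lambda>_. UNIV). (\<Sum>i\<in>S. f i) = k}" for k
    using bij_betw_same_card[OF bij[of k]] by simp
  then have "Abs_fps (\<lambda>k. real (card (supplies S k))) = gf (\<lambda>f. \<Sum>i\<in>S. f i) (PiE S (\<lambda>_. UNIV))"
    by (simp add: gf_def)
  also have "\<dots> = (\<Prod>i\<in>S. gf (\<lambda>n. n) UNIV)"
    by (rule gf_PiE(2)[OF assms, of "\<lambda>_. UNIV" "\<lambda>_ n. n"]) auto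
  finally have "Abs_fps (\<lambda>k. real (card (supplies S k))) = gf (\<lambda>n. n) UNIV ^ card S" by simp
  then show ?thesis by (simp only: power_mult_distrib[symmetric] gf_nat power_one)
qed

definition inactivity_poly :: "'a set \<Rightarrow> ('a \<times> 'b) set \<Rightarrow> ('a \<Rightarrow> nat) \<Rightarrow> real poly" where
  "inactivity_poly A R r = (\<Sum>f\<in>bases A R. monom 1 (card (inactive A R r f)))"

text \<open>The left-hand side does not involve \<open>r\<close>. A basis with \<open>a\<close>
  active coordinates contributes \<open>1 / (1 - x) ^ a\<close>, so the full power of
  \<open>1 - x\<close> leaves one factor for each inactive coordinate.\<close>

lemma gf_below:
  assumes "finite A" "finite B" "R \<subseteq> A \<times> B" "inj_on r A"
  shows "Abs_fps (\<lambda>k. real (card (below A R k))) * (1 - fps_X) ^ card A =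
    fps_of_poly (pcompose (inactivity_poly A R r) [:1, - 1:])"
proof -
  have finb: "finite (bases A R)"
    using finite_indep[OF assms(1-3)] by (simp add: bases_def)
  have fin: "finite (A - inactive A R r f)" for f using assms(1) by simp
  have "card (below A R k) = (\<Sum>f\<in>bases A R. card (supplies (A - inactive A R r f) k))" for k
    using bij_betw_same_card[OF below_bij[OF assms, of k]] finb finite_supplies[OF fin]
    by (simp add: card_SigmaI)
  then have "Abs_fps (\<lambda>k. real (card (below A R k))) =
     (\<Sum>f\<in>bases A R. Abs_fps (\<lambda>k. real (card (supplies (A - inactive A R r f) k))))"
    by (intro fps_ext) (simp add: fps_sum_nth)
  then have "Abs_fps (\<lambda>k. real (card (below A R k))) * (1 - fps_X) ^ card A =
     (\<Sum>f\<in>bases A R. Abs_fps (\<lambda>k. real (card (supplies (A - inactive A R r f) k))) * (1 - fps_X) ^ card A)"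
    by (simp add: sum_distrib_right)
  also have "\<dots> = (\<Sum>f\<in>bases A R. (1 - fps_X) ^ card (inactive A R r f))"
  proof (intro sum.cong refl)
    fix f
    have "inactive A R r f \<subseteq> A" by (auto simp: inactive_def)
    then have "card A = card (A - inactive A R r f) + card (inactive A R r f)"
      using assms(1) by (simp add: card_Diff_subset finite_subset card_mono)
    then show "Abs_fps (\<lambda>k. real (card (supplies (A - inactive A R r f) k))) * (1 - fps_X) ^ card A =
      (1 - fps_X) ^ card (inactive A R r f)"
      using gf_supplies[OF fin, of f] by (simp add: power_add flip: mult.assoc)
  qed
  also have "\<dots> = fps_of_poly (\<Sum>f\<in>bases A R. [:1, - 1:] ^ card (inactive A R r f))"
  proof -
    have "fps_of_poly [:1, - 1:] = (1 - fps_X :: real fps)"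
      by (rule fps_ext) (auto simp: coeff_pCons split: nat.split)
    then show ?thesis by (simp only: fps_of_poly_sum fps_of_poly_power)
  qed
  also have "(\<Sum>f\<in>bases A R. [:1, - 1 :: real:] ^ card (inactive A R r f)) = pcompose (inactivity_poly A R r) [:1, - 1:]"
  proof -
    have "pcompose (monom 1 n) q = q ^ n" for n and q :: "real poly"
      by (induction n) (simp_all add: monom_Suc pcompose_pCons pcompose_1)
    then show ?thesis by (simp add: inactivity_poly_def pcompose_sum)
  qed
  finally show ?thesis .
qed

theorem inactivity_poly_order_independent:
  assumes "finite A" "finite B" "R \<subseteq> A \<times> B" "inj_on r A" "inj_on r' A"
  shows "inactivity_poly A R r = inactivity_poly A R r'"
proof -
  have "pcompose (inactivity_poly A R r) [:1, - 1:] = pcompose (inactivity_poly A R r') [:1, - 1:]"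
    using gf_below[OF assms(1-4)] gf_below[OF assms(1-3,5)] by (simp add: fps_of_poly_eq_iff)
  then have "pcompose (pcompose (inactivity_poly A R r) [:1, - 1:]) [:1, - 1:] =
     pcompose (pcompose (inactivity_poly A R r') [:1, - 1:]) [:1, - 1:]" by simp
  \<comment> \<open>Substituting \<open>1 - x\<close> twice is the identity, so the polynomial is
    recovered from its composition.\<close>
  moreover have "pcompose (pcompose p [:1, - 1:]) [:1, - 1:] = p" for p :: "real poly"
    by (simp add: pcompose_assoc[symmetric] pcompose_pCons pcompose_idR)
  ultimately show ?thesis by simp
qed

section \<open>A hyperedge that contains every vertex\<close>

text \<open>The coordinate at \<open>j\<close> is the slack that completes the total. A set
  containing \<open>j\<close> has all neighbours, so its inequality follows from the total, and only
  sets avoiding \<open>j\<close> impose conditions.\<close>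

lemma bases_full_bij:
  assumes "finite A" "finite B" "R \<subseteq> A \<times> B" "j \<in> A" "R `` {j} = R `` A"
  shows "bij_betw (\<lambda>f. f(j := 0)) (bases A R) (indep (A - {j}) (R \<inter> (A - {j}) \<times> UNIV))"
    (is "bij_betw ?h _ (indep ?A ?R)")
proof (rule bij_betw_byWitness[where f' = "\<lambda>g. g(j := card (R `` A) - sum g (A - {j}))"], goal_cases)
  have fin: "finite (R `` S)" for S using assms finite_subset[of "R `` S" B] by blast
  have img: "?R `` S = R `` S" if "S \<subseteq> ?A" for S using that by auto
  have sumA: "sum f A = f j + sum f ?A" for f :: "'a \<Rightarrow> nat" using assms(1,4) by (simp add: sum.remove)
  have upd: "sum (f(j := n)) S = sum f S" if "S \<subseteq> ?A" for f :: "'a \<Rightarrow> nat" and n S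
    using that by (intro sum.cong) auto
  {
    case 1
    show ?case
    proof
      fix f assume "f \<in> bases A R"
      then have "f j + sum f ?A = card (R `` A)" using sumA[of f] by (simp add: bases_def)
      then show "(?h f)(j := card (R `` A) - sum (?h f) ?A) = f" by (auto simp: upd fun_eq_iff)
    qed
  next
    case 2
    show ?case using assms(4) by (auto simp: indep_def)
  next
    case 3
    show ?case
    proof (rule image_subsetI)
      fix f assume f: "f \<in> bases A R"
      then have fi: "f \<in> indep A R" by (simp add: bases_def)
      have "sum (?h f) S \<le> card (?R `` S)" if S: "S \<subseteq> ?A" for S
        using indepD[OF fi, of S] S img[OF S] upd[OF S, of f 0] by auto
      then show "?h f \<in> indep ?A ?R" using fi by (auto simp: indep_def)
    qed
  next
    case 4
    show ?case
    proof (rule image_subsetI)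
      fix g assume g: "g \<in> indep ?A ?R"
      let ?g = "g(j := card (R `` A) - sum g ?A)"
      have "sum g ?A \<le> card (R `` ?A)" using indepD[OF g, of ?A] img[of ?A] by simp
      also have "\<dots> \<le> card (R `` A)" using fin by (intro card_mono) auto
      finally have tot: "sum ?g A = card (R `` A)" using sumA[of ?g] upd[of ?A g] by simp
      have "sum ?g S \<le> card (R `` S)" if S: "S \<subseteq> A" for S
      proof (cases "j \<in> S")
        case True
        have "sum ?g S \<le> sum ?g A" using S assms(1) by (intro sum_mono2) auto
        moreover have "R `` S = R `` A" using True S assms(5) by blast
        ultimately show ?thesis using tot by simp
      next
        case False
        then have S': "S \<subseteq> ?A" using S by auto
        show ?thesis using indepD[OF g S'] img[OF S'] upd[OF S', of g] by simp
      qed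
      moreover have "?g i = 0" if "i \<notin> A" for i using g that assms(4) by (auto simp: indep_def)
      ultimately show "?g \<in> bases A R" using tot by (simp add: bases_def indep_def)
    qed
  }
qed

lemma inactive_full_first:
  assumes "finite A" "finite B" "R \<subseteq> A \<times> B" "j \<in> A" "R `` {j} = R `` A" "f \<in> bases A R"
    "\<And>i. i \<in> A - {j} \<Longrightarrow> r j < r i"
  shows "inactive A R r f = {i \<in> A - {j}. f i \<noteq> 0}"
proof (intro equalityI subsetI)
  fix i assume "i \<in> inactive A R r f"
  then obtain j' where i: "i \<in> A" "0 < f i" "j' \<in> A" "r j' < r i" by (auto simp: inactive_def)
  have "i \<noteq> j"
  proof
    assume "i = j"
    then have "j' \<noteq> j" using i by auto
    then have "r j < r j'" using assms(7) i by blast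
    then show False using i \<open>i = j\<close> by simp
  qed
  then show "i \<in> {i \<in> A - {j}. f i \<noteq> 0}" using i by simp
next
  fix i assume "i \<in> {i \<in> A - {j}. f i \<noteq> 0}"
  then have i: "i \<in> A" "i \<noteq> j" "0 < f i" by auto
  have f: "f \<in> indep A R" "sum f A = card (R `` A)" using assms(6) by (auto simp: bases_def)
  have fin: "finite S" if "S \<subseteq> A" for S using that assms(1) finite_subset by blast
  have tot: "sum (transfer f i j) A = card (R `` A)"
    using sum_transfer[OF assms(1), of f i j] i assms(4) f(2) by simp
  have "sum (transfer f i j) S \<le> card (R `` S)" if S: "S \<subseteq> A" for S
  proof (cases "j \<in> S")
    case True
    have "sum (transfer f i j) S \<le> sum (transfer f i j) A" using S assms(1) by (intro sum_mono2) auto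
    moreover have "R `` S = R `` A" using True S assms(5) by blast
    ultimately show ?thesis using tot by simp
  next
    case False
    then show ?thesis using sum_transfer[OF fin[OF S], of f i j] i indepD[OF f(1) S] by (simp split: if_splits)
  qed
  moreover have "transfer f i j k = 0" if "k \<notin> A" for k
    using that f(1) i(1) assms(4) by (auto simp: transfer_def indep_def)
  ultimately have "transfer f i j \<in> bases A R" using tot by (simp add: bases_def indep_def)
  then show "i \<in> inactive A R r f" using i assms(4,7) by (auto simp: inactive_def)
qed

theorem inactivity_poly_eq_support_poly:
  fixes A :: "nat set"
  assumes "finite A" "finite B" "R \<subseteq> A \<times> B" "j \<in> A" "R `` {j} = R `` A"
  shows "inactivity_poly A R id = support_poly (A - {j}) (R \<inter> (A - {j}) \<times> UNIV)"
proof -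
  \<comment> \<open>This ranking moves \<open>j\<close> to the front, whereas \<open>id\<close> may
    place it anywhere.\<close>
  define r where "r i = (if i = j then 0 else Suc i)" for i :: nat
  have inj: "inj_on r A" by (auto simp: inj_on_def r_def)
  have first: "\<And>i. i \<in> A - {j} \<Longrightarrow> r j < r i" by (simp add: r_def)
  have "inactivity_poly A R id = inactivity_poly A R r"
    by (rule inactivity_poly_order_independent[OF assms(1-3) _ inj]) simp
  also have "\<dots> = (\<Sum>f\<in>bases A R. monom 1 (card {i \<in> A - {j}. (f(j := 0)) i \<noteq> 0}))"
    unfolding inactivity_poly_def
  proof (intro sum.cong refl)
    fix f assume "f \<in> bases A R"
    from inactive_full_first[of A B R j f r, OF assms this first]
    have "inactive A R r f = {i \<in> A - {j}. (f(j := 0)) i \<noteq> 0}" by auto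
    then show "monom 1 (card (inactive A R r f)) = (monom 1 (card {i \<in> A - {j}. (f(j := 0)) i \<noteq> 0}) :: real poly)"
      by simp
  qed
  also have "\<dots> = (\<Sum>g\<in>indep (A - {j}) (R \<inter> (A - {j}) \<times> UNIV). monom 1 (card {i \<in> A - {j}. g i \<noteq> 0}))"
    by (rule sum.reindex_bij_betw[OF bases_full_bij[OF assms]])
  finally show ?thesis by (simp add: support_poly_def)
qed


subsection \<open>Hypertrees of hypergraphs with a hub\<close>

text \<open>The flow built from the degrees of a spanning tree yields the inequalities. A generic
  cost is chosen merely to enter the locale in which this is available.\<close>

lemma leaf_tree_degrees_ht:
  assumes "finite P" "finite Q" "P \<noteq> {}" "Q \<noteq> {}" "R \<subseteq> P \<times> Q" "leaf_tree P Q F" "F \<subseteq> R"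
    "\<And>i. i \<in> P \<Longrightarrow> card (F `` {i}) = g i + 1" "\<And>i. i \<notin> P \<Longrightarrow> g i = 0"
  shows "g \<in> ht P Q R"
proof -
  obtain c where "generic_bipartite P Q R c" using generic_bipartite_exists[OF assms(1-5)] .
  then interpret generic_bipartite P Q R c .
  have "deg1 F = g" using assms(8,9) by (auto simp: deg1_def fun_eq_iff)
  then show ?thesis using deg1_in_ht[OF assms(6,7)] by simp
qed

text \<open>Pairs list the hyperedge before the vertex, so that the hyperedges form the left side of
  \<open>leaf_tree\<close>; in \<open>Bip\<close> they carry the tag \<open>Inr\<close>.\<close>

definition undirect :: "('b \<times> 'a) set \<Rightarrow> ('a + 'b) set set" where
  "undirect F = {{Inl v, Inr j} |v j. (j, v) \<in> F}"

lemma undirect_iff: "{Inl v, Inr j} \<in> undirect F \<longleftrightarrow> (j, v) \<in> F" "{Inr j, Inl v} \<in> undirect F \<longleftrightarrow> (j, v) \<in> F"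
  by (auto simp: undirect_def doubleton_eq_iff)

text \<open>A path to a new leaf is a path to its neighbour extended by one vertex. Together with an
  edge outside the tree such a path closes a cycle, which is how further edges are excluded from an
  acyclic graph.\<close>

lemma leaf_tree_path:
  assumes "leaf_tree S T F" "x \<in> Inr ` S \<union> Inl ` T" "y \<in> Inr ` S \<union> Inl ` T"
  shows "\<exists>p. p \<noteq> [] \<and> hd p = x \<and> last p = y \<and> distinct p \<and> set p \<subseteq> Inr ` S \<union> Inl ` T \<and>
    successively (\<lambda>a b. {a, b} \<in> undirect F) p"
proof -
  have leaf: "\<exists>p. p \<noteq> [] \<and> hd p = x \<and> last p = y \<and> distinct p \<and> set p \<subseteq> insert l X \<and>
      successively (\<lambda>a b. {a, b} \<in> G') p"
    if IH: "\<And>x y. x \<in> X \<Longrightarrow> y \<in> X \<Longrightarrow> \<exists>p. p \<noteq> [] \<and> hd p = x \<and> last p = y \<and> distinct p \<and> set p \<subseteq> X \<and>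
        successively (\<lambda>a b. {a, b} \<in> G) p"
      and a: "a \<in> X" "l \<notin> X" "G \<subseteq> G'" "{a, l} \<in> G'" and xy: "x \<in> insert l X" "y \<in> insert l X"
    for X :: "('b + 'a) set" and G G' a l x y
  proof -
    have mono: "successively (\<lambda>a b. {a, b} \<in> G') p" if "successively (\<lambda>a b. {a, b} \<in> G) p" for p
      using that a(3) by (auto elim: successively_mono)
    consider "x = l" "y = l" | "x \<in> X" "y = l" | "x = l" "y \<in> X" | "x \<in> X" "y \<in> X" using xy by blast
    then show ?thesis
    proof cases
      case 1
      then show ?thesis by (intro exI[of _ "[l]"]) auto
    next
      case 2
      obtain p where p: "p \<noteq> []" "hd p = x" "last p = a" "distinct p" "set p \<subseteq> X" "successively (\<lambda>a b. {a, b} \<in> G) p"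
        using IH[OF 2(1) a(1)] by blast
      have "successively (\<lambda>a b. {a, b} \<in> G') (p @ [l])"
        using mono[OF p(6)] p(3) a(4) by (simp add: successively_append_iff)
      then show ?thesis using p 2 a(2) by (intro exI[of _ "p @ [l]"]) auto
    next
      case 3
      obtain p where p: "p \<noteq> []" "hd p = a" "last p = y" "distinct p" "set p \<subseteq> X" "successively (\<lambda>a b. {a, b} \<in> G) p"
        using IH[OF a(1) 3(2)] by blast
      have "successively (\<lambda>a b. {a, b} \<in> G') (l # p)"
        using mono[OF p(6)] p(1,2) a(4) by (simp add: successively_Cons insert_commute)
      then show ?thesis using p 3 a(2) by (intro exI[of _ "l # p"]) auto
    next
      case 4
      obtain p where "p \<noteq> []" "hd p = x" "last p = y" "distinct p" "set p \<subseteq> X" "successively (\<lambda>a b. {a, b} \<in> G) p"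
        using IH[OF 4] by blast
      then show ?thesis using mono by (intro exI[of _ p]) auto
    qed
  qed
  show ?thesis
    using assms
  proof (induction arbitrary: x y rule: leaf_tree.induct)
    case (root i)
    then show ?case by (intro exI[of _ "[x]"]) auto
  next
    case (right_leaf S T F i j)
    have eq: "Inr ` S \<union> Inl ` insert j T = insert (Inl j) (Inr ` S \<union> Inl ` T)" by auto
    show ?case
      unfolding eq
      by (rule leaf[OF right_leaf.IH, where a = "Inr i"])
        (use right_leaf.hyps right_leaf.prems in \<open>auto simp: undirect_iff\<close>, auto simp: undirect_def)
  next
    case (left_leaf S T F j i)
    have eq: "Inr ` insert i S \<union> Inl ` T = insert (Inr i) (Inr ` S \<union> Inl ` T)" by auto
    show ?case
      unfolding eq
      by (rule leaf[OF left_leaf.IH, where a = "Inl j"])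
        (use left_leaf.hyps left_leaf.prems in \<open>auto simp: undirect_iff\<close>, auto simp: undirect_def)
  qed
qed

text \<open>The hypergraphs of the extended graph: some vertex lies in all hyperedges, and some hyperedge
  contains all vertices.\<close>

locale hub_hypergraph =
  fixes V :: "'v set" and Es :: "'v set list" and z :: 'v and j\<^sub>0 :: nat
  assumes finV: "finite V" and sub: "\<And>j. j < length Es \<Longrightarrow> Es ! j \<subseteq> V"
    and hub: "\<And>j. j < length Es \<Longrightarrow> z \<in> Es ! j" and j0: "j\<^sub>0 < length Es" "Es ! j\<^sub>0 = V"
begin

definition inc :: "(nat \<times> 'v) set" where
  "inc = {(j, v). j < length Es \<and> v \<in> Es ! j}"

text \<open>Without the hub, the neighbourhood of every nonempty set of hyperedges is smaller by
  one, so the strict bounds of \<open>ht\<close> become the weak bounds of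
  \<open>indep\<close>.\<close>

definition inc' :: "(nat \<times> 'v) set" where
  "inc' = {(j, v). j < length Es \<and> v \<in> Es ! j - {z}}"

lemma inc_sub: "inc \<subseteq> {..<length Es} \<times> V" using sub by (auto simp: inc_def)

lemma inc'_sub: "inc' \<subseteq> {..<length Es} \<times> (V - {z})" using sub by (auto simp: inc'_def)

lemma zV: "z \<in> V" using hub[OF j0(1)] j0(2) by simp

lemma Bip_edges: "snd (Bip V Es) = undirect inc"
  using sub by (fastforce simp: Bip_def undirect_def inc_def)

lemma Bip_vertices: "fst (Bip V Es) = Inr ` {..<length Es} \<union> Inl ` V"
  by (auto simp: Bip_def)

lemma card_inc: "S \<subseteq> {..<length Es} \<Longrightarrow> S \<noteq> {} \<Longrightarrow> card (inc `` S) = Suc (card (inc' `` S))"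
proof -
  assume S: "S \<subseteq> {..<length Es}" "S \<noteq> {}"
  have "inc `` S = insert z (inc' `` S)" using S hub by (auto simp: inc_def inc'_def)
  moreover have "finite (inc' `` S)" using inc'_sub finV finite_subset[of "inc' `` S" V] by blast
  moreover have "z \<notin> inc' `` S" by (auto simp: inc'_def)
  ultimately show ?thesis by simp
qed

lemma inc'_full: "inc' `` {j\<^sub>0} = V - {z}" "inc' `` {..<length Es} = V - {z}"
  using j0 sub by (auto simp: inc'_def)

lemma vertex_degree_undirect:
  "vertex_degree (undirect F) (Inr j) = card (F `` {j})"
proof -
  have "{e \<in> undirect F. Inr j \<in> e} = (\<lambda>v. {Inl v, Inr j}) ` (F `` {j})"
    by (auto simp: undirect_def)
  moreover have "inj_on (\<lambda>v. {Inl v, Inr j}) (F `` {j})" by (auto simp: inj_on_def doubleton_eq_iff)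
  ultimately show ?thesis by (simp add: vertex_degree_def card_image)
qed

lemma undirect_of_subset:
  assumes "T \<subseteq> undirect inc"
  obtains F where "F \<subseteq> inc" "T = undirect F"
proof -
  let ?F = "{(j, v). {Inl v, Inr j} \<in> T}"
  have "?F \<subseteq> inc" using assms by (auto simp: undirect_iff)
  moreover have "T = undirect ?F"
  proof (intro equalityI subsetI)
    fix e assume e: "e \<in> T"
    then obtain v j where "e = {Inl v, Inr j}" using assms by (auto simp: undirect_def)
    then show "e \<in> undirect ?F" using e by (simp add: undirect_iff)
  qed (auto simp: undirect_def)
  ultimately show thesis using that by blast
qed

text \<open>Connectedness makes the tree grown from \<open>j\<^sub>0\<close> spanning. An edge of
  \<open>F\<close> outside it would close the path between its ends to a cycle: the path has at
  least three vertices, as its ends are distinct and not adjacent in the grown tree.\<close>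

lemma spanning_tree_leaf_tree:
  assumes "F \<subseteq> inc" "tree_graph (fst (Bip V Es), undirect F)"
  shows "leaf_tree {..<length Es} V F"
proof -
  let ?P = "{..<length Es}"
  have F: "F \<subseteq> ?P \<times> V" using assms(1) inc_sub by auto
  have j0P: "j\<^sub>0 \<in> ?P" using j0 by simp
  obtain S T F' where G: "leaf_tree S T F'" "S \<subseteq> ?P" "T \<subseteq> V" "F' \<subseteq> F" "j\<^sub>0 \<in> S"
    "\<And>i j. (i, j) \<in> F \<Longrightarrow> i \<in> S \<longleftrightarrow> j \<in> T"
    using leaf_tree_grow[OF finite_lessThan finV F j0P] by metis
  let ?C = "Inr ` S \<union> Inl ` T :: ('v + nat) set"
  have reach: "y \<in> ?C" if "(Inr j\<^sub>0, y) \<in> {(a, b). {a, b} \<in> undirect F}\<^sup>*" for y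
    using that
  proof (induction rule: rtrancl_induct)
    case base
    then show ?case using G(5) by blast
  next
    case (step y w)
    then obtain v j where vj: "{y, w} = {Inl v, Inr j}" "(j, v) \<in> F" by (auto simp: undirect_def)
    then have "j \<in> S \<longleftrightarrow> v \<in> T" using G(6) by blast
    moreover have "y = Inl v \<and> w = Inr j \<or> y = Inr j \<and> w = Inl v" using vj by (auto simp: doubleton_eq_iff)
    ultimately show ?case using step.IH by auto
  qed
  have "y \<in> ?C" if "y \<in> fst (Bip V Es)" for y
    using assms(2) that j0P by (intro reach) (auto simp: tree_graph_def connected_graph_def Bip_vertices)
  then have "Inr ` ?P \<union> Inl ` V \<subseteq> ?C" by (auto simp: Bip_vertices)
  then have "?P \<subseteq> S" "V \<subseteq> T" by auto
  then have ST: "S = ?P" "T = V" using G by auto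
  have "F \<subseteq> F'"
  proof (rule ccontr)
    assume "\<not> F \<subseteq> F'"
    then obtain j v where jv: "(j, v) \<in> F" "(j, v) \<notin> F'" by auto
    then have "j \<in> S" "v \<in> T" using F ST by auto
    then obtain p where p: "p \<noteq> []" "hd p = Inr j" "last p = Inl v" "distinct p"
        "successively (\<lambda>a b. {a, b} \<in> undirect F') p"
      using leaf_tree_path[OF G(1), of "Inr j" "Inl v"] by blast
    have nth: "{p ! i, p ! Suc i} \<in> undirect F'" if "Suc i < length p" for i
      using p(5) that by (simp add: successively_conv_nth)
    have "length p \<noteq> 1" using p(1-3) by (cases p) auto
    moreover have "length p \<noteq> 2"
    proof
      assume l: "length p = 2"
      have "{p ! 0, p ! 1} \<in> undirect F'" using nth[of 0] l by simp
      moreover have "p ! 0 = Inr j" "p ! 1 = Inl v" using p(1-3) l by (simp_all add: hd_conv_nth last_conv_nth)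
      ultimately show False using jv by (simp add: undirect_iff)
    qed
    moreover have "length p \<noteq> 0" using p(1) by simp
    ultimately have l3: "3 \<le> length p" by linarith
    have FF': "undirect F' \<subseteq> undirect F" using G(4) by (auto simp: undirect_def)
    have "graph_cycle (undirect F) p"
      unfolding graph_cycle_def
    proof (intro conjI allI impI l3 p(4))
      fix i assume i: "i < length p"
      show "{p ! i, p ! (Suc i mod length p)} \<in> undirect F"
      proof (cases "Suc i < length p")
        case True
        then show ?thesis using nth[OF True] FF' by auto
      next
        case False
        then have "Suc i = length p" using i by simp
        then have "i = length p - 1" "Suc i mod length p = 0" by auto
        then have "p ! i = Inl v" "p ! (Suc i mod length p) = Inr j"
          using p(1-3) by (simp_all add: hd_conv_nth last_conv_nth)
        then show ?thesis using jv(1) by (simp add: undirect_iff)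
      qed
    qed
    then show False using assms(2) by (auto simp: tree_graph_def)
  qed
  then show ?thesis using G(1,4) ST by auto
qed

lemma hypertree_imp_bases:
  assumes "hypertree V Es f"
  shows "f \<in> bases {..<length Es} inc'"
proof -
  let ?P = "{..<length Es}"
  obtain T where T: "T \<subseteq> undirect inc" "tree_graph (fst (Bip V Es), T)"
      "\<And>j. j < length Es \<Longrightarrow> vertex_degree T (Inr j) = f j + 1" and f0: "\<And>j. j \<ge> length Es \<Longrightarrow> f j = 0"
    using assms by (auto simp: hypertree_def spanning_tree_def Bip_edges)
  obtain F where F: "F \<subseteq> inc" "T = undirect F" using undirect_of_subset[OF T(1)] by blast
  have "f \<in> ht ?P V inc"
  proof (rule leaf_tree_degrees_ht[OF _ finV _ _ inc_sub _ F(1)])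
    show "leaf_tree ?P V F" using spanning_tree_leaf_tree[OF F(1)] T(2) F(2) by simp
    show "card (F `` {i}) = f i + 1" if "i \<in> ?P" for i
      using T(3)[of i] that by (simp add: F(2) vertex_degree_undirect)
  qed (use f0 j0 zV in auto)
  then have tot: "sum f ?P + 1 = card V" and S: "\<And>S. S \<subseteq> ?P \<Longrightarrow> S \<noteq> {} \<Longrightarrow> sum f S < card (inc `` S)"
    unfolding ht_def by blast+
  have "sum f S \<le> card (inc' `` S)" if "S \<subseteq> ?P" for S
    using S[OF that] card_inc[OF that] by (cases "S = {}") auto
  moreover have "sum f ?P = card (inc' `` ?P)" using tot zV finV by (simp add: inc'_full)
  ultimately show ?thesis using f0 by (simp add: bases_def indep_def)
qed

text \<open>The tree consists of all edges at the hub and one edge for each other vertex, found by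
  transportation with unit demands in which hyperedge \<open>j\<close> serves \<open>f j\<close>
  vertices. Every vertex of the hypergraph except the hub is then a leaf.\<close>

lemma bases_imp_hypertree:
  assumes "f \<in> bases {..<length Es} inc'"
  shows "hypertree V Es f"
proof -
  let ?P = "{..<length Es}" and ?B = "V - {z}"
  have fi: "f \<in> indep ?P inc'" and tot: "sum f ?P = card ?B" using assms by (auto simp: bases_def inc'_full)
  have finB: "finite ?B" using finV by simp
  \<comment> \<open>Hall's condition is again checked on the complement: hyperedges that miss
    \<open>T\<close> reach only vertices outside \<open>T\<close>, and total supply equals total
    demand.\<close>
  have "sum (\<lambda>_. 1) T \<le> sum f (inc'\<inverse> `` T)" if T: "T \<subseteq> ?B" for T
  proof -
    let ?S = "?P - inc'\<inverse> `` T"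
    have "sum f ?S \<le> card (inc' `` ?S)" by (rule indepD[OF fi]) auto
    also have "\<dots> \<le> card (?B - T)" using inc'_sub finB by (intro card_mono) auto
    finally have "sum f ?S \<le> card (?B - T)" .
    moreover have "inc'\<inverse> `` T \<subseteq> ?P" using inc'_sub by auto
    then have "sum f ?P = sum f ?S + sum f (inc'\<inverse> `` T)" by (rule sum.subset_diff) simp
    moreover have "card (?B - T) + card T = card ?B"
      using T finB by (metis card_Diff_subset card_mono finite_subset le_add_diff_inverse2)
    ultimately show ?thesis using tot by simp
  qed
  from supply_demand_balanced[OF finite_lessThan finB inc'_sub this]
  obtain x where x: "flow_on inc' ?P ?B (int \<circ> f) (int \<circ> (\<lambda>_. 1)) x" "\<And>i j. 0 \<le> x i j" using tot by auto
  have x0: "x j b = 0" if "(j, b) \<notin> inc'" for j b using x(1) that by (simp add: flow_on_def)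
  have col: "(\<Sum>j\<in>?P. x j b) = 1" if "b \<in> ?B" for b using x(1) that by (simp add: flow_on_def)
  have uniq: "\<exists>!j. x j b \<noteq> 0" if b: "b \<in> ?B" for b
  proof -
    obtain j where j: "j \<in> ?P" "x j b \<noteq> 0" using col[OF b] by (metis sum.neutral zero_neq_one)
    moreover have "j' = j" if "x j' b \<noteq> 0" for j'
    proof (rule ccontr)
      assume ne: "j' \<noteq> j"
      have "j' \<in> ?P" using that x0 inc'_sub by blast
      then have "(\<Sum>j\<in>{j, j'}. x j b) \<le> (\<Sum>j\<in>?P. x j b)" using j x(2) by (intro sum_mono2) auto
      then have "x j b + x j' b \<le> 1" using ne col[OF b] by simp
      moreover have "1 \<le> x j b" "1 \<le> x j' b" using j that x(2)[of j b] x(2)[of j' b] by auto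
      ultimately show False by linarith
    qed
    ultimately show ?thesis by blast
  qed
  have x01: "x j b = 1" if "x j b \<noteq> 0" for j b
  proof -
    have "(j, b) \<in> inc'" using x0 that by blast
    then have jb: "j \<in> ?P" "b \<in> ?B" using inc'_sub by auto
    have "x j b \<le> (\<Sum>j\<in>?P. x j b)" using jb x(2) by (intro member_le_sum) auto
    then show ?thesis using col[OF jb(2)] that x(2)[of j b] by linarith
  qed
  define F where "F = {(j, b). x j b \<noteq> 0} \<union> ?P \<times> {z}"
  have Finc: "F \<subseteq> inc"
  proof -
    have "{(j, b). x j b \<noteq> 0} \<subseteq> inc'" using x0 by blast
    moreover have "inc' \<subseteq> inc" by (auto simp: inc_def inc'_def)
    moreover have "?P \<times> {z} \<subseteq> inc" using hub by (auto simp: inc_def)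
    ultimately show ?thesis by (auto simp: F_def)
  qed
  have Fb: "j' = j" if "(j, b) \<in> F" "(j', b) \<in> F" "b \<noteq> z" for j j' b
  proof -
    have "x j b \<noteq> 0" "x j' b \<noteq> 0" using that by (auto simp: F_def)
    moreover have "b \<in> ?B" using calculation(1) x0 inc'_sub by blast
    ultimately show ?thesis using uniq by blast
  qed
  have deg: "card (F `` {j}) = f j + 1" if j: "j < length Es" for j
  proof -
    let ?N = "{b \<in> ?B. x j b \<noteq> 0}"
    have "F `` {j} = insert z ?N"
    proof -
      have "b \<in> ?B" if "x j b \<noteq> 0" for b using that x0 inc'_sub by blast
      then show ?thesis using j by (auto simp: F_def)
    qed
    then have "card (F `` {j}) = Suc (card ?N)" using finB by simp
    moreover have "int (card ?N) = (\<Sum>b\<in>?N. x j b)" 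
    proof -
      have "(\<Sum>b\<in>?N. x j b) = (\<Sum>b\<in>?N. 1)" using x01 by (intro sum.cong) auto
      then show ?thesis by simp
    qed
    moreover have "(\<Sum>b\<in>?N. x j b) = (\<Sum>b\<in>?B. x j b)" using finB by (intro sum.mono_neutral_left) auto
    moreover have "(\<Sum>b\<in>?B. x j b) = int (f j)" using x(1) j by (simp add: flow_on_def)
    ultimately show ?thesis by simp
  qed
  let ?rel = "{(a, b). {a, b} \<in> undirect F}"
  have sym: "sym (?rel\<^sup>*)" by (rule sym_rtrancl) (auto simp: sym_def insert_commute)
  have toz: "(a, Inl z) \<in> ?rel\<^sup>*" if "a \<in> Inr ` ?P \<union> Inl ` V" for a
  proof -
    have r: "(Inr j, Inl z) \<in> ?rel" if "j \<in> ?P" for j using that by (auto simp: undirect_iff F_def)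
    show ?thesis
    proof (cases a)
      case (Inr j)
      then have "j \<in> ?P" using that by auto
      then show ?thesis using r Inr by blast
    next
      case (Inl b)
      show ?thesis
      proof (cases "b = z")
        case False
        then have "b \<in> ?B" using Inl that by auto
        then obtain j where j: "x j b \<noteq> 0" using uniq by blast
        then have "(Inl b, Inr j) \<in> ?rel" by (auto simp: undirect_iff F_def)
        moreover have "j \<in> ?P" using j x0 inc'_sub by blast
        ultimately show ?thesis using r Inl by (meson converse_rtrancl_into_rtrancl r_into_rtrancl)
      qed (simp add: Inl)
    qed
  qed
  have "connected_graph (fst (Bip V Es), undirect F)"
    unfolding connected_graph_def fst_conv snd_conv Bip_vertices
  proof (intro conjI ballI)
    show "Inr ` ?P \<union> Inl ` V \<noteq> {}" using zV by auto
    fix a b :: "'v + nat" assume "a \<in> Inr ` ?P \<union> Inl ` V" "b \<in> Inr ` ?P \<union> Inl ` V"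
    then show "(a, b) \<in> ?rel\<^sup>*" using toz sym by (meson rtrancl_trans symD)
  qed
  \<comment> \<open>In a cycle every element has two distinct neighbours. Among the vertices of the
    hypergraph only the hub can have two, but any hyperedge on the cycle needs two such vertices
    next to it.\<close>
  moreover have "\<not> graph_cycle (undirect F) c" for c
  proof
    assume c: "graph_cycle (undirect F) c"
    let ?n = "length c"
    have n3: "3 \<le> ?n" and dist: "distinct c" and edge: "\<And>i. i < ?n \<Longrightarrow> {c ! i, c ! (Suc i mod ?n)} \<in> undirect F"
      using c by (auto simp: graph_cycle_def)
    have n0: "0 < ?n" using n3 by linarith
    have two: "\<exists>a b. a \<noteq> b \<and> a \<in> set c \<and> b \<in> set c \<and> {a, c ! i} \<in> undirect F \<and> {b, c ! i} \<in> undirect F"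
      if i: "i < ?n" for i
    proof -
      define k where "k = (if i = 0 then ?n - 1 else i - 1)"
      have k: "k < ?n" "Suc k mod ?n = i" using i n3 by (auto simp: k_def)
      define l where "l = Suc i mod ?n"
      have l: "l < ?n" unfolding l_def using n0 by (rule mod_less_divisor)
      have "k \<noteq> l"
      proof (cases "Suc i < ?n")
        case True
        then show ?thesis using n3 by (auto simp: k_def l_def)
      next
        case False
        then have "Suc i = ?n" using i by simp
        then have "l = 0" "i = ?n - 1" by (auto simp: l_def)
        then show ?thesis using n3 by (auto simp: k_def)
      qed
      then have "c ! k \<noteq> c ! l" using dist k(1) l by (simp add: nth_eq_iff_index_eq)
      moreover have "{c ! k, c ! i} \<in> undirect F" using edge[OF k(1)] k(2) by simp
      moreover have "{c ! l, c ! i} \<in> undirect F" using edge[OF i] by (simp add: l_def insert_commute)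
      ultimately show ?thesis using k(1) l nth_mem by blast
    qed
    have onlyz: "b = z" if b: "Inl b \<in> set c" for b
    proof (rule ccontr)
      assume bz: "b \<noteq> z"
      obtain i where "i < ?n" "c ! i = Inl b" using b by (auto simp: in_set_conv_nth)
      then obtain a a' where aa: "a \<noteq> a'" "{a, Inl b} \<in> undirect F" "{a', Inl b} \<in> undirect F"
        using two by metis
      then obtain j j' where "a = Inr j" "a' = Inr j'" by (auto simp: undirect_def doubleton_eq_iff)
      then show False using aa Fb[of j b j'] bz by (auto simp: undirect_iff)
    qed
    obtain i j where i: "i < ?n" "c ! i = Inr j"
    proof -
      from edge[OF n0] obtain v j where "{c ! 0, c ! (Suc 0 mod ?n)} = {Inl v, Inr j}"
        by (auto simp: undirect_def)
      then have "c ! 0 = Inr j \<or> c ! (Suc 0 mod ?n) = Inr j" by (auto simp: doubleton_eq_iff)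
      moreover have "Suc 0 mod ?n < ?n" using n0 by (rule mod_less_divisor)
      ultimately show thesis using that n0 by blast
    qed
    obtain a a' where aa: "a \<noteq> a'" "a \<in> set c" "a' \<in> set c" "{a, Inr j} \<in> undirect F" "{a', Inr j} \<in> undirect F"
      using two[OF i(1)] i(2) by metis
    obtain b b' where "a = Inl b" "a' = Inl b'" using aa(4,5) by (auto simp: undirect_def doubleton_eq_iff)
    then show False using aa(1-3) onlyz by metis
  qed
  ultimately have "spanning_tree (Bip V Es) (undirect F)"
    using Finc by (auto simp: spanning_tree_def tree_graph_def Bip_edges undirect_def)
  moreover have "\<forall>j\<ge>length Es. f j = 0" using fi by (simp add: indep_def)
  moreover have "\<forall>j<length Es. vertex_degree (undirect F) (Inr j) = f j + 1"
    using deg by (simp add: vertex_degree_undirect)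
  ultimately show ?thesis unfolding hypertree_def by blast
qed

lemma hypertree_iff: "hypertree V Es f \<longleftrightarrow> f \<in> bases {..<length Es} inc'"
  using hypertree_imp_bases bases_imp_hypertree by blast

theorem hypergraph_interior_poly_eq:
  "hypergraph_interior_poly V Es =
    support_poly ({..<length Es} - {j\<^sub>0}) (inc' \<inter> ({..<length Es} - {j\<^sub>0}) \<times> UNIV)"
proof -
  let ?P = "{..<length Es}"
  have "internal_inactivity V Es f = card (inactive ?P inc' id f)" for f
  proof -
    have "{j. j < length Es \<and> \<not> internally_active V Es f j} = inactive ?P inc' id f"
      by (auto simp: internally_active_def inactive_def hypertree_iff transfer_def)
    then show ?thesis by (simp add: internal_inactivity_def)
  qed
  then have "hypergraph_interior_poly V Es = inactivity_poly ?P inc' id"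
    by (simp add: hypergraph_interior_poly_def inactivity_poly_def hypertree_iff)
  also have "\<dots> = support_poly (?P - {j\<^sub>0}) (inc' \<inter> (?P - {j\<^sub>0}) \<times> UNIV)"
    using inc'_full j0 finV by (intro inactivity_poly_eq_support_poly[OF _ _ inc'_sub]) auto
  finally show ?thesis .
qed

end


subsection \<open>The extended graph\<close>

lemma support_poly_iso:
  assumes "finite A" "bij_betw \<sigma> A A'" "R \<subseteq> A \<times> B" "inj_on \<tau> B" "R' = (\<lambda>(i, b). (\<sigma> i, \<tau> b)) ` R"
  shows "support_poly A R = support_poly A' R'"
proof -
  have inj: "inj_on \<sigma> A" and img: "\<sigma> ` A = A'" using assms(2) by (auto simp: bij_betw_def)
  have card: "card (R' `` (\<sigma> ` S)) = card (R `` S)" if "S \<subseteq> A" for S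
  proof -
    have "R' `` (\<sigma> ` S) = \<tau> ` (R `` S)"
    proof (intro equalityI subsetI)
      fix b' assume "b' \<in> R' `` (\<sigma> ` S)"
      then obtain i j b where "i \<in> S" "(j, b) \<in> R" "\<sigma> i = \<sigma> j" "b' = \<tau> b" by (auto simp: assms(5))
      moreover from this have "i = j" using inj that assms(3) by (auto dest: inj_onD)
      ultimately show "b' \<in> \<tau> ` (R `` S)" by blast
    qed (auto simp: assms(5))
    moreover have "inj_on \<tau> (R `` S)" using assms(3,4) by (auto intro: inj_on_subset)
    ultimately show ?thesis by (simp add: card_image)
  qed
  let ?h = "\<lambda>g i. if i \<in> A then g (\<sigma> i) else 0 :: nat"
  let ?k = "\<lambda>g i. if i \<in> A' then g (inv_into A \<sigma> i) else 0 :: nat"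
  have inv: "inv_into A \<sigma> (\<sigma> i) = i" if "i \<in> A" for i using inj that by simp
  have inv': "\<sigma> (inv_into A \<sigma> i) = i" "inv_into A \<sigma> i \<in> A" if "i \<in> A'" for i
    using img that by (auto simp: f_inv_into_f inv_into_into)
  have "bij_betw ?h (indep A' R') (indep A R)"
  proof (rule bij_betw_byWitness[where f' = ?k], goal_cases)
    case 1
    show ?case
    proof
      fix g assume "g \<in> indep A' R'"
      then have "g i = 0" if "i \<notin> A'" for i using that by (simp add: indep_def)
      then show "?k (?h g) = g" using inv' by (auto simp: fun_eq_iff)
    qed
  next
    case 2
    show ?case
    proof
      fix g assume "g \<in> indep A R"
      then have "g i = 0" if "i \<notin> A" for i using that by (simp add: indep_def)
      moreover have "\<sigma> i \<in> A'" if "i \<in> A" for i using img that by blast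
      ultimately show "?h (?k g) = g" using inv by (auto simp: fun_eq_iff)
    qed
  next
    case 3
    show ?case
    proof (rule image_subsetI)
      fix g assume g: "g \<in> indep A' R'"
      have "sum (?h g) S \<le> card (R `` S)" if S: "S \<subseteq> A" for S
      proof -
        have "sum (?h g) S = sum g (\<sigma> ` S)"
          using S inj by (subst sum.reindex) (auto intro: inj_on_subset intro!: sum.cong)
        also have "\<dots> \<le> card (R' `` (\<sigma> ` S))" using S img by (intro indepD[OF g]) auto
        finally show ?thesis using card[OF S] by simp
      qed
      then show "?h g \<in> indep A R" by (simp add: indep_def)
    qed
  next
    case 4
    show ?case
    proof (rule image_subsetI)
      fix g assume g: "g \<in> indep A R"
      have "sum (?k g) S' \<le> card (R' `` S')" if S': "S' \<subseteq> A'" for S'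
      proof -
        obtain S where S: "S \<subseteq> A" "S' = \<sigma> ` S" using S' img by (auto simp: subset_image_iff)
        have "sum (?k g) S' = sum g S"
          unfolding S(2) using S inj img inv
          by (subst sum.reindex) (auto intro: inj_on_subset intro!: sum.cong)
        also have "\<dots> \<le> card (R `` S)" using S by (intro indepD[OF g])
        finally show ?thesis using card[OF S(1)] S(2) by simp
      qed
      then show "?k g \<in> indep A' R'" by (simp add: indep_def)
    qed
  qed
  then have "support_poly A R = (\<Sum>g\<in>indep A' R'. monom 1 (card {i \<in> A. ?h g i \<noteq> 0}))"
    unfolding support_poly_def by (rule sum.reindex_bij_betw[symmetric])
  also have "\<dots> = support_poly A' R'"
    unfolding support_poly_def
  proof (intro sum.cong refl)
    fix g assume "g \<in> indep A' R'"
    have "{i \<in> A'. g i \<noteq> 0} = \<sigma> ` {i \<in> A. ?h g i \<noteq> 0}" using img by auto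
    moreover have "inj_on \<sigma> {i \<in> A. ?h g i \<noteq> 0}" using inj by (rule inj_on_subset) auto
    ultimately have "card {i \<in> A'. g i \<noteq> 0} = card {i \<in> A. ?h g i \<noteq> 0}" by (simp only: card_image)
    then show "monom 1 (card {i \<in> A. ?h g i \<noteq> 0}) = (monom 1 (card {i \<in> A'. g i \<noteq> 0}) :: real poly)" by (simp only:)
  qed
  finally show ?thesis .
qed

lemma hat_edge_iff:
  "{Base a, Base b} \<in> snd (hat_graph V1 V2 E) \<longleftrightarrow> {a, b} \<in> E"
  "{Base a, Dplus1} \<in> snd (hat_graph V1 V2 E) \<longleftrightarrow> a \<in> V1"
  "{Base a, Dplus2} \<in> snd (hat_graph V1 V2 E) \<longleftrightarrow> a \<in> V2"
  "{Dplus1, Dplus2} \<in> snd (hat_graph V1 V2 E)"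
  "{Dplus1, Base a} \<in> snd (hat_graph V1 V2 E) \<longleftrightarrow> a \<in> V1"
proof -
  have "{a, b} \<in> E" if "e \<in> E" "{Base a, Base b} = Base ` e" for e
  proof -
    have "inj Base" by (simp add: inj_def)
    moreover have "Base ` {a, b} = Base ` e" using that by simp
    ultimately have "{a, b} = e" using inj_image_eq_iff by blast
    then show ?thesis using that by simp
  qed
  then show "{Base a, Base b} \<in> snd (hat_graph V1 V2 E) \<longleftrightarrow> {a, b} \<in> E"
    by (auto simp: hat_graph_def doubleton_eq_iff intro!: image_eqI[of _ _ "{a, b}"])
  show "{Base a, Dplus1} \<in> snd (hat_graph V1 V2 E) \<longleftrightarrow> a \<in> V1"
    by (auto simp: hat_graph_def doubleton_eq_iff)
  then show "{Dplus1, Base a} \<in> snd (hat_graph V1 V2 E) \<longleftrightarrow> a \<in> V1"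
    by (simp add: insert_commute)
  show "{Base a, Dplus2} \<in> snd (hat_graph V1 V2 E) \<longleftrightarrow> a \<in> V2"
    by (auto simp: hat_graph_def doubleton_eq_iff)
  show "{Dplus1, Dplus2} \<in> snd (hat_graph V1 V2 E)"
    by (auto simp: hat_graph_def doubleton_eq_iff)
qed

definition un_base :: "'n hat_vertex \<Rightarrow> 'n" where
  "un_base x = (case x of Base i \<Rightarrow> i)"

lemma un_base_Base [simp]: "un_base (Base i) = i"
  by (simp add: un_base_def)

text \<open>The apex edges force the sides: an element of \<open>V1\<close> is adjacent to
  \<open>Dplus1\<close>, which is a vertex of the hypergraph, so it is a hyperedge;
  \<open>Dplus2\<close> likewise makes the elements of \<open>V2\<close> vertices. This works for
  disconnected \<open>E\<close> too.\<close>

lemma interior_poly_oriented: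
  fixes V1 V2 :: "'n::finite set" and V :: "'v set"
  assumes bg: "bipartite_graph V1 V2 E" and un: "V1 \<union> V2 = UNIV" and hg: "hypergraph V Es"
    and bij: "bij_betw \<phi> (fst (Bip V Es)) UNIV"
    and edges: "(\<lambda>e. \<phi> ` e) ` snd (Bip V Es) = snd (hat_graph V1 V2 E)"
    and z: "z \<in> V" "\<phi> (Inl z) = Dplus1" and e0: "j\<^sub>0 < length Es" "\<phi> (Inr j\<^sub>0) = Dplus2"
  shows "hypergraph_interior_poly V Es = support_poly V1 (bip_rel V1 V2 E)"
proof -
  let ?HE = "snd (hat_graph V1 V2 E)" and ?n = "length Es"
  have disj: "V1 \<inter> V2 = {}" using bg by (auto simp: bipartite_graph_def)
  have inj: "inj_on \<phi> (Inl ` V \<union> Inr ` {..<?n})" and onto: "\<phi> ` (Inl ` V \<union> Inr ` {..<?n}) = UNIV"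
    using bij by (auto simp: bij_betw_def Bip_def)
  have injD: "a = b" if "\<phi> a = \<phi> b" "a \<in> Inl ` V \<union> Inr ` {..<?n}" "b \<in> Inl ` V \<union> Inr ` {..<?n}" for a b
    using inj_onD[OF inj that] .
  have sub: "Es ! j \<subseteq> V" if "j < ?n" for j using hg that by (auto simp: hypergraph_def)
  have edgeE: "\<exists>v j. v \<in> V \<and> j < ?n \<and> v \<in> Es ! j \<and> e = {\<phi> (Inl v), \<phi> (Inr j)}" if "e \<in> ?HE" for e
  proof -
    from that obtain e' where e': "e' \<in> snd (Bip V Es)" "e = \<phi> ` e'" unfolding edges[symmetric] by blast
    then obtain v j where "v \<in> V" "j < ?n" "v \<in> Es ! j" "e' = {Inl v, Inr j}" by (auto simp: Bip_def)
    then show ?thesis using e'(2) by (intro exI[of _ v] exI[of _ j]) simp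
  qed
  have mem: "v \<in> Es ! j \<longleftrightarrow> {\<phi> (Inl v), \<phi> (Inr j)} \<in> ?HE" if "v \<in> V" "j < ?n" for v j
  proof
    assume "v \<in> Es ! j"
    then have "{Inl v, Inr j} \<in> snd (Bip V Es)" using that by (auto simp: Bip_def)
    then have "\<phi> ` {Inl v, Inr j} \<in> ?HE" unfolding edges[symmetric] by (rule imageI)
    then show "{\<phi> (Inl v), \<phi> (Inr j)} \<in> ?HE" by simp
  next
    assume "{\<phi> (Inl v), \<phi> (Inr j)} \<in> ?HE"
    then obtain v' j' where *: "v' \<in> V" "j' < ?n" "v' \<in> Es ! j'" "{\<phi> (Inl v), \<phi> (Inr j)} = {\<phi> (Inl v'), \<phi> (Inr j')}"
      using edgeE by blast
    have ne: "\<phi> (Inl a) \<noteq> \<phi> (Inr b)" if "a \<in> V" "b < ?n" for a b using injD[of "Inl a" "Inr b"] that by auto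
    from *(4) ne[OF that(1) *(2)] have "\<phi> (Inl v) = \<phi> (Inl v')" "\<phi> (Inr j) = \<phi> (Inr j')"
      by (auto simp: doubleton_eq_iff)
    then have "v = v'" "j = j'"
      using injD[of "Inl v" "Inl v'"] injD[of "Inr j" "Inr j'"] that * by auto
    then show "v \<in> Es ! j" using * by simp
  qed
  have base1: "\<exists>j<?n. \<phi> (Inr j) = Base i" if "i \<in> V1" for i
  proof -
    have "{Base i, Dplus1} \<in> ?HE" using that by (simp add: hat_edge_iff)
    then obtain v j where vj: "v \<in> V" "j < ?n" "{Base i, Dplus1} = {\<phi> (Inl v), \<phi> (Inr j)}" using edgeE by blast
    have "\<phi> (Inr j) \<noteq> Dplus1" using injD[of "Inr j" "Inl z"] z vj by auto
    then show ?thesis using vj by (auto simp: doubleton_eq_iff)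
  qed
  have base2: "\<exists>v\<in>V. \<phi> (Inl v) = Base i" if "i \<in> V2" for i
  proof -
    have "{Base i, Dplus2} \<in> ?HE" using that by (simp add: hat_edge_iff)
    then obtain v j where vj: "v \<in> V" "j < ?n" "{Base i, Dplus2} = {\<phi> (Inl v), \<phi> (Inr j)}" using edgeE by blast
    have "\<phi> (Inl v) \<noteq> Dplus2" using injD[of "Inl v" "Inr j\<^sub>0"] e0 vj by auto
    then show ?thesis using vj by (auto simp: doubleton_eq_iff)
  qed
  have right: "\<exists>i\<in>V1. \<phi> (Inr j) = Base i" if j: "j < ?n" "j \<noteq> j\<^sub>0" for j
  proof (cases "\<phi> (Inr j)")
    case (Base i)
    have "i \<notin> V2"
    proof
      assume "i \<in> V2"
      then obtain v where "v \<in> V" "\<phi> (Inl v) = Base i" using base2 by blast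
      then show False using injD[of "Inl v" "Inr j"] Base j by auto
    qed
    then show ?thesis using un Base by auto
  next
    case Dplus1
    then show ?thesis using injD[of "Inr j" "Inl z"] z j by auto
  next
    case Dplus2
    then show ?thesis using injD[of "Inr j" "Inr j\<^sub>0"] e0 j by auto
  qed
  have left: "\<exists>i\<in>V2. \<phi> (Inl v) = Base i" if v: "v \<in> V" "v \<noteq> z" for v
  proof (cases "\<phi> (Inl v)")
    case (Base i)
    have "i \<notin> V1"
    proof
      assume "i \<in> V1"
      then obtain j where "j < ?n" "\<phi> (Inr j) = Base i" using base1 by blast
      then show False using injD[of "Inl v" "Inr j"] Base v by auto
    qed
    then show ?thesis using un Base by auto
  next
    case Dplus1
    then show ?thesis using injD[of "Inl v" "Inl z"] z v by auto
  next
    case Dplus2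
    then show ?thesis using injD[of "Inl v" "Inr j\<^sub>0"] e0 v by auto
  qed
  interpret hub_hypergraph V Es z j\<^sub>0
  proof
    show "finite V" using hg by (simp add: hypergraph_def)
    show "Es ! j \<subseteq> V" if "j < ?n" for j using sub that .
    show "z \<in> Es ! j" if j: "j < ?n" for j
    proof (cases "j = j\<^sub>0")
      case True
      then show ?thesis using mem[OF z(1) j] z e0 by (simp add: hat_edge_iff)
    next
      case False
      then obtain i where "i \<in> V1" "\<phi> (Inr j) = Base i" using right j by blast
      then show ?thesis using mem[OF z(1) j] z by (simp add: hat_edge_iff)
    qed
    show "j\<^sub>0 < ?n" by (rule e0)
    have "v \<in> Es ! j\<^sub>0" if v: "v \<in> V" for v
    proof (cases "v = z")
      case True
      then show ?thesis using mem[OF v e0(1)] z e0 by (simp add: hat_edge_iff)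
    next
      case False
      then obtain i where "i \<in> V2" "\<phi> (Inl v) = Base i" using left v by blast
      then show ?thesis using mem[OF v e0(1)] e0 by (simp add: hat_edge_iff)
    qed
    then show "Es ! j\<^sub>0 = V" using sub[OF e0(1)] by blast
  qed
  let ?A = "{..<?n} - {j\<^sub>0}" and ?B = "V - {z}"
  let ?R = "inc' \<inter> ({..<?n} - {j\<^sub>0}) \<times> UNIV"
  define \<sigma> where "\<sigma> j = un_base (\<phi> (Inr j))" for j
  define \<tau> where "\<tau> v = un_base (\<phi> (Inl v))" for v
  have \<sigma>: "\<phi> (Inr j) = Base (\<sigma> j)" "\<sigma> j \<in> V1" if "j \<in> ?A" for j
    using right[of j] that by (auto simp: \<sigma>_def)
  have \<tau>: "\<phi> (Inl v) = Base (\<tau> v)" "\<tau> v \<in> V2" if "v \<in> ?B" for v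
    using left[of v] that by (auto simp: \<tau>_def)
  have injs: "inj_on \<sigma> ?A"
  proof (rule inj_onI)
    fix j j' assume "j \<in> ?A" "j' \<in> ?A" "\<sigma> j = \<sigma> j'"
    then show "j = j'" using \<sigma>(1)[of j] \<sigma>(1)[of j'] injD[of "Inr j" "Inr j'"] by auto
  qed
  have injt: "inj_on \<tau> ?B"
  proof (rule inj_onI)
    fix v v' assume "v \<in> ?B" "v' \<in> ?B" "\<tau> v = \<tau> v'"
    then show "v = v'" using \<tau>(1)[of v] \<tau>(1)[of v'] injD[of "Inl v" "Inl v'"] by auto
  qed
  have ontos: "\<exists>j\<in>?A. \<sigma> j = i" if i: "i \<in> V1" for i
  proof -
    obtain j where j: "j < ?n" "\<phi> (Inr j) = Base i" using base1[OF i] by blast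
    then have "j \<in> ?A" using e0 by auto
    then show ?thesis using j by (intro bexI[of _ j]) (auto simp: \<sigma>_def)
  qed
  have ontot: "\<exists>v\<in>?B. \<tau> v = i" if i: "i \<in> V2" for i
  proof -
    obtain v where v: "v \<in> V" "\<phi> (Inl v) = Base i" using base2[OF i] by blast
    then have "v \<in> ?B" using z by auto
    then show ?thesis using v by (intro bexI[of _ v]) (auto simp: \<tau>_def)
  qed
  have adj: "(j, v) \<in> ?R \<longleftrightarrow> {\<sigma> j, \<tau> v} \<in> E" if "j \<in> ?A" "v \<in> ?B" for j v
  proof -
    have "(j, v) \<in> ?R \<longleftrightarrow> v \<in> Es ! j" using that by (auto simp: inc'_def)
    also have "\<dots> \<longleftrightarrow> {Base (\<tau> v), Base (\<sigma> j)} \<in> ?HE" using mem[of v j] that \<sigma>(1) \<tau>(1) by simp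
    also have "\<dots> \<longleftrightarrow> {\<sigma> j, \<tau> v} \<in> E" by (simp add: hat_edge_iff insert_commute)
    finally show ?thesis .
  qed
  have "bip_rel V1 V2 E = (\<lambda>(j, v). (\<sigma> j, \<tau> v)) ` ?R"
  proof (intro equalityI subsetI)
    fix t assume "t \<in> bip_rel V1 V2 E"
    then obtain i k where t: "t = (i, k)" "i \<in> V1" "k \<in> V2" "{i, k} \<in> E" by (auto simp: bip_rel_def)
    obtain j v where jv: "j \<in> ?A" "\<sigma> j = i" "v \<in> ?B" "\<tau> v = k" using ontos[OF t(2)] ontot[OF t(3)] by blast
    then have "(j, v) \<in> ?R" using adj t(4) by simp
    then show "t \<in> (\<lambda>(j, v). (\<sigma> j, \<tau> v)) ` ?R" using jv t(1) by force
  next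
    fix t assume "t \<in> (\<lambda>(j, v). (\<sigma> j, \<tau> v)) ` ?R"
    then obtain j v where jv: "(j, v) \<in> ?R" "t = (\<sigma> j, \<tau> v)" by auto
    then have AB: "j \<in> ?A" "v \<in> ?B" using inc'_sub by auto
    then show "t \<in> bip_rel V1 V2 E" using adj[OF AB] jv \<sigma>(2) \<tau>(2) by (simp add: bip_rel_def)
  qed
  moreover have "bij_betw \<sigma> ?A V1"
    using injs ontos \<sigma>(2) by (auto simp: bij_betw_def)
  moreover have "?R \<subseteq> ?A \<times> ?B" using inc'_sub by auto
  ultimately have "support_poly ?A ?R = support_poly V1 (bip_rel V1 V2 E)"
    using injt by (intro support_poly_iso) auto
  then show ?thesis using hypergraph_interior_poly_eq by simp
qed

section \<open>All presentations of the extended graph\<close>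

fun swap_apex :: "'n hat_vertex \<Rightarrow> 'n hat_vertex" where
  "swap_apex (Base i) = Base i"
| "swap_apex Dplus1 = Dplus2"
| "swap_apex Dplus2 = Dplus1"

lemma swap_apex_swap_apex [simp]: "swap_apex (swap_apex x) = x"
  by (cases x) auto

lemma swap_hat_edges: "(\<lambda>e. swap_apex ` e) ` snd (hat_graph V1 V2 E) = snd (hat_graph V2 V1 E)"
proof -
  have "(\<lambda>e. swap_apex ` e) ` snd (hat_graph V1 V2 E) \<subseteq> snd (hat_graph V2 V1 E)" for V1 V2 :: "'a set"
    by (auto simp: hat_graph_def image_image insert_commute)
  moreover have "swap_apex ` swap_apex ` e = e" for e :: "'a hat_vertex set" by (simp add: image_image)
  ultimately show ?thesis by (metis (no_types, lifting) image_eqI image_subset_iff subsetI subset_antisym)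
qed

text \<open>The edge between the two apex vertices has one end on each side, so two orientations are
  possible. The second becomes the first after exchanging \<open>V1\<close> and \<open>V2\<close>,
  and \<open>support_poly_swap\<close> undoes the exchange.\<close>

lemma interior_poly_any:
  fixes V1 V2 :: "'n::finite set" and V :: "'v set"
  assumes bg: "bipartite_graph V1 V2 E" and un: "V1 \<union> V2 = UNIV" and hg: "hypergraph V Es"
    and iso: "graph_isomorphic (Bip V Es) (hat_graph V1 V2 E)"
  shows "hypergraph_interior_poly V Es = support_poly V1 (bip_rel V1 V2 E)"
proof -
  have "fst (hat_graph V1 V2 E) = UNIV" by (simp add: hat_graph_def)
  then obtain \<phi> where bij: "bij_betw \<phi> (fst (Bip V Es)) UNIV"
    and edges: "(\<lambda>e. \<phi> ` e) ` snd (Bip V Es) = snd (hat_graph V1 V2 E)"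
    using iso by (auto simp: graph_isomorphic_def)
  have "{Dplus1, Dplus2} \<in> (\<lambda>e. \<phi> ` e) ` snd (Bip V Es)" unfolding edges by (rule hat_edge_iff)
  then obtain v j where vj: "v \<in> V" "j < length Es" "{Dplus1, Dplus2} = {\<phi> (Inl v), \<phi> (Inr j)}"
    by (auto simp: Bip_def)
  then consider "\<phi> (Inl v) = Dplus1" "\<phi> (Inr j) = Dplus2" | "\<phi> (Inl v) = Dplus2" "\<phi> (Inr j) = Dplus1"
    by (auto simp: doubleton_eq_iff)
  then show ?thesis
  proof cases
    case 1
    then show ?thesis using interior_poly_oriented[OF bg un hg bij edges vj(1) _ vj(2)] by blast
  next
    case 2
    have bg': "bipartite_graph V2 V1 E" and un': "V2 \<union> V1 = UNIV"
      using bg un by (fastforce simp: bipartite_graph_def)+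
    have "bij swap_apex" by (rule o_bij[of swap_apex]) (auto simp: fun_eq_iff)
    then have "bij_betw (swap_apex \<circ> \<phi>) (fst (Bip V Es)) UNIV" using bij by (rule bij_betw_trans[rotated])
    moreover have "(\<lambda>e. (swap_apex \<circ> \<phi>) ` e) ` snd (Bip V Es) = snd (hat_graph V2 V1 E)"
      unfolding swap_hat_edges[of V1 V2 E, symmetric] edges[symmetric] by (simp add: image_image)
    ultimately have "hypergraph_interior_poly V Es = support_poly V2 (bip_rel V2 V1 E)"
      using interior_poly_oriented[OF bg' un' hg, of "swap_apex \<circ> \<phi>" v j] vj 2 by simp
    then show ?thesis using support_poly_swap[OF bg un, of UNIV] by simp
  qed
qed

text \<open>The definite description needs at least one presentation: \<open>V2\<close> with
  \<open>Dplus1\<close> serves as vertex set, and the other side is listed as hyperedges in an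
  arbitrary order.\<close>

lemma hat_hypergraph_exists:
  fixes V1 V2 :: "'n::finite set"
  assumes bg: "bipartite_graph V1 V2 E" and un: "V1 \<union> V2 = UNIV"
  obtains V :: "'n hat_vertex set" and Es where "hypergraph V Es" "graph_isomorphic (Bip V Es) (hat_graph V1 V2 E)"
proof -
  let ?HE = "snd (hat_graph V1 V2 E)"
  have disj: "V1 \<inter> V2 = {}" using bg by (auto simp: bipartite_graph_def)
  define V where "V = insert Dplus1 (Base ` V2)"
  define C where "C = insert Dplus2 (Base ` V1)"
  have finC: "finite C" by (simp add: C_def)
  then obtain xs where xs: "set xs = C" "distinct xs" using finite_distinct_list by blast
  define Es where "Es = map (\<lambda>x. {y \<in> V. {y, x} \<in> ?HE}) xs"
  define \<phi> where "\<phi> = case_sum id (\<lambda>j. xs ! j)"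
  have VC: "V \<inter> C = {}" "V \<union> C = UNIV"
  proof -
    show "V \<inter> C = {}" using disj by (auto simp: V_def C_def)
    have "x \<in> V \<union> C" for x
    proof (cases x)
      case (Base i)
      then show ?thesis using un by (auto simp: V_def C_def)
    qed (auto simp: V_def C_def)
    then show "V \<union> C = UNIV" by blast
  qed
  have D1: "{Dplus1, x} \<in> ?HE" if "x \<in> C" for x
    using that by (auto simp: C_def hat_edge_iff)
  have "hypergraph V Es"
    unfolding hypergraph_def
  proof (intro conjI ballI)
    show "finite V" by (simp add: V_def)
    fix e assume "e \<in> set Es"
    then obtain x where x: "x \<in> C" "e = {y \<in> V. {y, x} \<in> ?HE}" using xs by (auto simp: Es_def)
    then have "Dplus1 \<in> e" using D1 by (simp add: V_def)
    then show "e \<noteq> {}" by blast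
    show "e \<subseteq> V" using x by blast
  qed
  moreover have "graph_isomorphic (Bip V Es) (hat_graph V1 V2 E)"
    unfolding graph_isomorphic_def
  proof (intro exI[of _ \<phi>] conjI)
    have len: "length Es = length xs" by (simp add: Es_def)
    have nth: "xs ! j \<in> C" if "j < length xs" for j using that xs by auto
    have "\<phi> ` (Inl ` V \<union> Inr ` {..<length xs}) = V \<union> (\<lambda>j. xs ! j) ` {..<length xs}"
      by (simp add: \<phi>_def image_Un image_image)
    also have "(\<lambda>j. xs ! j) ` {..<length xs} = C" using xs(1) by (auto simp: set_conv_nth)
    finally have "\<phi> ` (Inl ` V \<union> Inr ` {..<length xs}) = UNIV" using VC by simp
    moreover have "inj_on \<phi> (Inl ` V \<union> Inr ` {..<length xs})"
    proof (rule inj_onI)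
      fix a b assume "a \<in> Inl ` V \<union> Inr ` {..<length xs}" "b \<in> Inl ` V \<union> Inr ` {..<length xs}" "\<phi> a = \<phi> b"
      then show "a = b"
        using VC(1) nth xs(2) by (auto simp: \<phi>_def nth_eq_iff_index_eq)
    qed
    ultimately show "bij_betw \<phi> (fst (Bip V Es)) (fst (hat_graph V1 V2 E))"
      by (simp add: bij_betw_def Bip_def hat_graph_def len)
    show "(\<lambda>e. \<phi> ` e) ` snd (Bip V Es) = ?HE"
    proof (intro equalityI subsetI)
      fix e assume "e \<in> (\<lambda>e. \<phi> ` e) ` snd (Bip V Es)"
      then obtain v j where "v \<in> V" "j < length xs" "v \<in> Es ! j" "e = {v, xs ! j}"
        by (auto simp: Bip_def \<phi>_def len)
      then show "e \<in> ?HE" by (simp add: Es_def)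
    next
      fix e assume e: "e \<in> ?HE"
      have "\<exists>y x. y \<in> V \<and> x \<in> C \<and> e = {y, x}"
      proof -
        consider e' where "e' \<in> E" "e = Base ` e'" | i where "i \<in> V1" "e = {Base i, Dplus1}"
          | i where "i \<in> V2" "e = {Base i, Dplus2}" | "e = {Dplus1, Dplus2}"
          using e by (auto simp: hat_graph_def)
        then show ?thesis
        proof cases
          case 1
          then obtain i j where "i \<in> V1" "j \<in> V2" "e' = {i, j}" using bg by (auto simp: bipartite_graph_def)
          then show ?thesis using 1 by (intro exI[of _ "Base j"] exI[of _ "Base i"]) (auto simp: V_def C_def)
        qed (auto simp: V_def C_def intro: exI[of _ Dplus1] exI[of _ Dplus2])
      qed
      then obtain y x where yx: "y \<in> V" "x \<in> C" "e = {y, x}" by blast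
      then obtain j where j: "j < length xs" "xs ! j = x" using xs(1) by (auto simp: in_set_conv_nth)
      then have "y \<in> Es ! j" using yx e by (simp add: Es_def)
      then have "{Inl y, Inr j} \<in> snd (Bip V Es)" using yx j len by (auto simp: Bip_def)
      moreover have "\<phi> ` {Inl y, Inr j} = e" using yx j by (simp add: \<phi>_def)
      ultimately show "e \<in> (\<lambda>e. \<phi> ` e) ` snd (Bip V Es)" by blast
    qed
  qed
  ultimately show thesis by (rule that)
qed

theorem interior_poly_hat_graph:
  fixes V1 V2 :: "'n::finite set"
  assumes "bipartite_graph V1 V2 E" "V1 \<union> V2 = UNIV"
  shows "interior_poly (hat_graph V1 V2 E) = support_poly V1 (bip_rel V1 V2 E)"
  unfolding interior_poly_def
proof (rule the_equality)
  show "\<exists>(V :: 'n hat_vertex set) Es. hypergraph V Es \<and> graph_isomorphic (Bip V Es) (hat_graph V1 V2 E) \<and>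
    support_poly V1 (bip_rel V1 V2 E) = hypergraph_interior_poly V Es"
    using hat_hypergraph_exists[OF assms] interior_poly_any[OF assms] by metis
next
  fix p assume "\<exists>(V :: 'n hat_vertex set) Es. hypergraph V Es \<and> graph_isomorphic (Bip V Es) (hat_graph V1 V2 E) \<and>
    p = hypergraph_interior_poly V Es"
  then show "p = support_poly V1 (bip_rel V1 V2 E)" using interior_poly_any[OF assms] by blast
qed

theorem theorem0p3:
  fixes V1 V2 :: "'n::finite set" and E :: "'n set set"
  assumes "bipartite_graph V1 V2 E" and "V1 \<union> V2 = UNIV"
  shows "(\<forall>x::real. x \<noteq> - 1 \<longrightarrow>
            poly (h_star (B_polytope E)) x =
              (x + 1) ^ CARD('n) *
              poly (interior_poly (hat_graph V1 V2 E)) (4 * x / (x + 1)\<^sup>2))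
       \<and> gamma_positive (CARD('n)) (h_star (B_polytope E))
       \<and> (real_rooted (h_star (B_polytope E)) \<longleftrightarrow>
            real_rooted (interior_poly (hat_graph V1 V2 E)))"
proof -
  define I where "I = support_poly V1 (bip_rel V1 V2 E)"
  have I: "interior_poly (hat_graph V1 V2 E) = I"
    unfolding I_def by (rule interior_poly_hat_graph[OF assms])
  have h: "h_star (B_polytope E) = gamma_transform (CARD('n)) I"
    unfolding I_def gamma_transform_def by (rule h_star_B_polytope[OF assms])
  have deg: "degree I \<le> CARD('n) div 2"
    unfolding I_def by (rule h_star_B_polytope[OF assms])
  have finI: "finite (indep V1 (bip_rel V1 V2 E))"
    by (rule finite_indep[of _ V2]) (auto simp: bip_rel_def)
  have nn: "0 \<le> coeff I i" for i
    by (auto simp: I_def support_poly_def coeff_sum intro!: sum_nonneg)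
  \<comment> \<open>The zero vector contributes 1 to the constant coefficient, which keeps 0 from
    being a root of \<open>I\<close>.\<close>
  have "(\<lambda>_. 0) \<in> indep V1 (bip_rel V1 V2 E)" by (simp add: indep_def)
  then have "(\<lambda>g. coeff (monom (1::real) (card {i \<in> V1. g i \<noteq> (0::nat)})) 0) (\<lambda>_. 0) \<le> coeff I 0"
    unfolding I_def support_poly_def coeff_sum using finI by (intro member_le_sum) auto
  then have pos: "0 < coeff I 0" by simp
  have "poly (h_star (B_polytope E)) x = (x + 1) ^ CARD('n) * poly I (4 * x / (x + 1)\<^sup>2)" if "x \<noteq> - 1" for x :: real
    using poly_gamma_transform[OF deg that] by (simp add: h of_real_eq_id map_poly_id)
  moreover have "gamma_positive (CARD('n)) (h_star (B_polytope E))"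
    unfolding gamma_positive_def h gamma_transform_def
    using nn by (intro exI[of _ "\<lambda>i. 4 ^ i * coeff I i"]) auto
  moreover have "real_rooted (h_star (B_polytope E)) \<longleftrightarrow> real_rooted I"
    unfolding h by (rule real_rooted_gamma_transform[OF deg nn pos])
  ultimately show ?thesis unfolding I by blast
qed

end
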